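(* Let $m\ne 0,1$ be a square-free integer and $K=\mathbb{Q}(\sqrt{m})$. Then there exists an elliptic curve $E/K$ with everywhere good reduction over $K$ and rational $j$-invariant if and only if there exist a good integer $D$ and an integer $q$ with $m = qD$ such that: (a) $\left(\frac{-\epsilon_D q}{p}\right)=1$ for every (odd) prime $p$ dividing $D$; (b) $\left(\frac{\epsilon_D D}{\ell}\right)=1$ for every (odd) prime $\ell$ dividing $q$; (c) $m>0$ if $\epsilon_D D<0$; (d) if $D\equiv \pm 3 \pmod 8$ then $q\equiv D \pmod 4$; (e) if $D$ is even then $q \equiv D+1 \pmod 8$.
   Context: Let $\mathcal{R}=\{A\in\mathbb{Z} : \text{if } 2\mid A \text{ then } 16\mid A \text{ or } 16\mid A-4;\ \text{if } 3\mid A \text{ then } 27\mid A-12\}$. A square-free integer $D$ is called good if there exist $A\in\mathcal{R}$ and $t\in\mathbb{Z}$ with $Dt^2 = A^3-1728$. For good $D$, set $\epsilon_D = 1$ if $D\equiv 1 \pmod 4$ and $\epsilon_D=-1$ otherwise. $\left(\frac{a}{p}\right)$ denotes the Legendre symbol. An elliptic curve $E/K$ has everywhere good reduction if it has good reduction at every prime of $\mathcal{O}_K$. *)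

theory Defs
  imports Complex_Main "HOL-Number_Theory.Number_Theory"
    "HOL-Computational_Algebra.Polynomial" "HOL-Computational_Algebra.Squarefree"
begin

definition R_set :: "int set" where
  "R_set = {A. (2 dvd A \<longrightarrow> (16 dvd A \<or> 16 dvd (A - 4))) \<and>
                (3 dvd A \<longrightarrow> 27 dvd (A - 12))}"

definition good :: "int \<Rightarrow> bool" where
  "good D \<longleftrightarrow> squarefree D \<and> (\<exists>A \<in> R_set. \<exists>t::int. D * t^2 = A^3 - 1728)"

definition eps :: "int \<Rightarrow> int" where
  "eps D = (if D mod 4 = 1 then 1 else -1)"

definition qfield :: "int \<Rightarrow> complex set" where
  "qfield m = {of_rat a + of_rat b * csqrt (of_int m) | a b. True}"

definition alg_int :: "complex \<Rightarrow> bool" where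
  "alg_int x \<longleftrightarrow> (\<exists>p :: int poly. lead_coeff p = 1 \<and> poly (map_poly of_int p) x = 0)"

definition ring_of_integers :: "int \<Rightarrow> complex set" where
  "ring_of_integers m = {x \<in> qfield m. alg_int x}"

definition prime_ideal_OK :: "int \<Rightarrow> complex set \<Rightarrow> bool" where
  "prime_ideal_OK m P \<longleftrightarrow>
     P \<subseteq> ring_of_integers m \<and> 0 \<in> P \<and>
     (\<forall>x\<in>P. \<forall>y\<in>P. x + y \<in> P) \<and>
     (\<forall>x\<in>P. \<forall>r\<in>ring_of_integers m. r * x \<in> P) \<and>
     P \<noteq> {0} \<and> P \<noteq> ring_of_integers m \<and>
     (\<forall>x\<in>ring_of_integers m. \<forall>y\<in>ring_of_integers m. x * y \<in> P \<longrightarrow> x \<in> P \<or> y \<in> P)"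

definition local_ring :: "int \<Rightarrow> complex set \<Rightarrow> complex set" where
  "local_ring m P = {x \<in> qfield m. \<exists>s \<in> ring_of_integers m - P. s * x \<in> ring_of_integers m}"

definition local_unit :: "int \<Rightarrow> complex set \<Rightarrow> complex \<Rightarrow> bool" where
  "local_unit m P x \<longleftrightarrow> x \<noteq> 0 \<and> x \<in> local_ring m P \<and> inverse x \<in> local_ring m P"

type_synonym wcoeffs = "complex \<times> complex \<times> complex \<times> complex \<times> complex"
  (* (a1, a2, a3, a4, a6) *)

fun disc :: "wcoeffs \<Rightarrow> complex" where
  "disc (a1, a2, a3, a4, a6) =
    (let b2 = a1^2 + 4*a2; b4 = 2*a4 + a1*a3; b6 = a3^2 + 4*a6;
         b8 = a1^2*a6 + 4*a2*a6 - a1*a3*a4 + a2*a3^2 - a4^2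
     in 9*b2*b4*b6 - b2^2*b8 - 8*b4^3 - 27*b6^2)"

fun c4 :: "wcoeffs \<Rightarrow> complex" where
  "c4 (a1, a2, a3, a4, a6) =
    (let b2 = a1^2 + 4*a2; b4 = 2*a4 + a1*a3 in b2^2 - 24*b4)"

definition j_inv :: "wcoeffs \<Rightarrow> complex" where
  "j_inv a = c4 a ^ 3 / disc a"

text \<open>Change of variables x = u^2 x' + r, y = u^3 y' + u^2 s x' + t (Silverman III.1).\<close>
fun wchange :: "complex \<Rightarrow> complex \<Rightarrow> complex \<Rightarrow> complex \<Rightarrow> wcoeffs \<Rightarrow> wcoeffs" where
  "wchange u r s t (a1, a2, a3, a4, a6) =
    ((a1 + 2*s) / u,
     (a2 - s*a1 + 3*r - s^2) / u^2,
     (a3 + r*a1 + 2*t) / u^3,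
     (a4 - s*a3 + 2*r*a2 - (t + r*s)*a1 + 3*r^2 - 2*s*t) / u^4,
     (a6 + r*a4 + r^2*a2 + r^3 - t*a3 - t^2 - r*t*a1) / u^6)"

fun coeffs_in :: "complex set \<Rightarrow> wcoeffs \<Rightarrow> bool" where
  "coeffs_in S (a1, a2, a3, a4, a6) \<longleftrightarrow> a1 \<in> S \<and> a2 \<in> S \<and> a3 \<in> S \<and> a4 \<in> S \<and> a6 \<in> S"

definition elliptic_over :: "int \<Rightarrow> wcoeffs \<Rightarrow> bool" where
  "elliptic_over m a \<longleftrightarrow> coeffs_in (qfield m) a \<and> disc a \<noteq> 0"

definition good_reduction_at :: "int \<Rightarrow> complex set \<Rightarrow> wcoeffs \<Rightarrow> bool" where
  "good_reduction_at m P a \<longleftrightarrow>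
     (\<exists>u r s t. u \<in> qfield m \<and> u \<noteq> 0 \<and> r \<in> qfield m \<and> s \<in> qfield m \<and> t \<in> qfield m \<and>
        coeffs_in (local_ring m P) (wchange u r s t a) \<and>
        local_unit m P (disc (wchange u r s t a)))"

definition everywhere_good :: "int \<Rightarrow> wcoeffs \<Rightarrow> bool" where
  "everywhere_good m a \<longleftrightarrow> (\<forall>P. prime_ideal_OK m P \<longrightarrow> good_reduction_at m P a)"

end

theory Submission imports Defs "HOL-Computational_Algebra.Nth_Powers"
begin

text \<open>
  A curve \<open>a\<close> over \<open>K\<close> with good reduction everywhere and rational \<open>j\<close>-invariant has \<open>j = A\<^sup>3\<close> with an
  integer \<open>A\<close>, its discriminant has norm \<open>\<plusminus> n\<^sup>1\<^sup>2\<close>, and \<open>c\<^sub>6\<^sup>2 = (A\<^sup>3 - 1728) \<Delta>\<close>. Write \<open>A\<^sup>3 - 1728 = D t\<^sup>2\<close>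
  with \<open>D\<close> squarefree. At an odd prime dividing \<open>D\<close> but not \<open>m\<close> the valuation of \<open>c\<^sub>6\<^sup>2\<close> would be odd, so
  \<open>D\<close> divides \<open>m\<close>, and taking norms shows that \<open>\<kappa> D\<close> is a norm from \<open>K\<close> for a sign \<open>\<kappa>\<close>. Reading
  \<open>X\<^sup>2 - m Y\<^sup>2 = \<kappa> D Z\<^sup>2\<close> at the odd primes and at infinity gives (a)-(c). The shape of \<open>A\<close>, the value
  \<open>\<kappa> = \<epsilon>\<^sub>D\<close> and the congruences (d), (e) come from \<open>c\<^sub>4\<close> and \<open>c\<^sub>6\<close> of integral models at 2 and 3.

  Conversely, Legendre's theorem on ternary forms turns (a)-(c) into a primitive solution of
  \<open>D x\<^sup>2 - q y\<^sup>2 = \<epsilon>\<^sub>D z\<^sup>2\<close>. With \<open>w = D x + y \<surd>m\<close>, of norm \<open>\<epsilon>\<^sub>D D z\<^sup>2\<close>, the curve with \<open>c\<^sub>4 = A D w\<^sup>2\<close> and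
  \<open>c\<^sub>6 = t D\<^sup>2 w\<^sup>3\<close> has \<open>j = A\<^sup>3\<close> and good reduction away from 2; its twist by one of \<open>\<plusminus>1, \<plusminus>2\<close> has good
  reduction at 2 as well, which is where (d) and (e) enter.
\<close>

text \<open>Good reduction everywhere makes the discriminant ideal a twelfth power, but its root
  need not be principal, so \<open>c4\<close> and \<open>c6\<close> cannot be normalised by one
  global change of variables. Norms avoid the class group. Where \<open>P\<close> is stable under
  conjugation, a norm detects membership in \<open>P\<close>; at a split prime, a model at
  \<open>P\<close> is combined with the conjugate of a model at the other prime. So the norm of
  \<Delta> is a twelfth power up to sign, and norms in \<open>c4^3 = j \<Delta>\<close> show that
  \<open>j^2\<close>, hence \<open>j\<close>, is a cube. The norm of \<Delta> is a quotient of
  squares, hence positive; the one sign left open is that of the norm of \<open>c6\<close>, and this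
  is \<kappa>.

  In the converse, odd primes do not see a twist by 1, -1, 2 or -2, so these are the freedom left
  for 2. The target there is a square times an element that is 1 modulo 4, because the square root
  of such an element is unramified above 2. For even \<open>D\<close> the prime 2 ramifies and
  \<open>a1\<close> cannot be divisible by 2, so an equation with \<open>a1 = s\<close> is written
  down instead.

  Valuations are never introduced: local rings, their units and the statement that \<open>p\<close>
  generates the maximal ideal suffice.\<close>

lemma cong_E: fixes a b n :: int assumes "[a = b] (mod n)" obtains j where "a = b + n * j"
proof -
  have "n dvd a - b" using assms by (simp add: cong_iff_dvd_diff)
  then obtain j where "a - b = n * j" by (rule dvdE)
  then show ?thesis using that[of j] by simp
qed

lemma cong_I: "a = b + n * j \<Longrightarrow> [a = b] (mod n)" for a b n j :: int
  by (simp add: cong_iff_dvd_diff)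

lemma int_mod_eqI: "x = r + n * k \<Longrightarrow> 0 \<le> r \<Longrightarrow> r < n \<Longrightarrow> x mod n = r" for x r n k :: int
  by simp

lemma odd_square_mod_8: fixes x :: int assumes "odd x" shows "[x^2 = 1] (mod 8)"
proof -
  obtain k where k: "x = 2 * k + 1" using assms by (rule oddE)
  have "even (k * (k + 1))" by simp
  then obtain j where j: "k * (k + 1) = 2 * j" by (rule evenE)
  have "x^2 - 1 = 4 * (k * (k + 1))" unfolding k by (simp add: power2_eq_square algebra_simps)
  then have "x^2 - 1 = 8 * j" using j by simp
  then show ?thesis by (simp add: cong_iff_dvd_diff)
qed

lemma odd_square_E: fixes x :: int assumes "odd x" obtains k where "x^2 = 8 * k + 1"
proof -
  have "8 dvd x^2 - 1" using odd_square_mod_8[OF assms] by (simp add: cong_iff_dvd_diff)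
  then obtain k where "x^2 - 1 = 8 * k" by (rule dvdE)
  then show ?thesis using that[of k] by simp
qed

lemma rat_quotient_E:
  fixes r :: rat obtains u v :: int where "v > 0" "coprime u v" "r = of_int u / of_int v"
proof -
  obtain u v where q: "quotient_of r = (u, v)" by force
  show ?thesis by (rule that[of v u])
    (use q quotient_of_denom_pos quotient_of_coprime quotient_of_div in blast)+
qed

subsection \<open>Legendre's theorem on ternary forms\<close>

text \<open>One prime is split off at a time: \<open>n = p * k\<close> with \<open>p\<close> and
  \<open>k\<close> coprime because \<open>n\<close> is squarefree, and the Chinese remainder theorem
  glues a root modulo \<open>p\<close> to a root modulo \<open>k\<close>.\<close>

lemma sqrt_mod_squarefree:
  fixes a :: int
  assumes "squarefree n" "n > 0" "\<And>p. prime p \<Longrightarrow> p dvd n \<Longrightarrow> \<exists>r. p dvd r^2 - a"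
  shows "\<exists>r. n dvd r^2 - a"
  using assms
proof (induction "nat n" arbitrary: n rule: less_induct)
  case less
  show ?case
  proof (cases "n = 1")
    case True then show ?thesis by auto
  next
    case False
    then have "\<not> is_unit n" using less.prems by auto
    then obtain p where p: "prime p" "p dvd n"
      using less.prems(2) prime_divisor_exists[of n] by auto
    then obtain k where k: "n = p * k" by auto
    have p0: "p > 1" using p(1) prime_gt_1_int by blast
    have "k > 0" using k less.prems(2) p0 by (simp add: zero_less_mult_iff)
    have "k < n" using k \<open>k > 0\<close> p0 by simp
    have sk: "squarefree k" using less.prems(1) k squarefree_mono[of k n] by auto
    have cop: "coprime p k"
    proof (rule ccontr)
      assume "\<not> coprime p k"
      then have "p dvd k" using p(1) prime_imp_coprime by blast
      then have "p^2 dvd n" using k by (auto simp: power2_eq_square)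
      then have "is_unit p" using less.prems(1) squarefreeD by blast
      then show False using p(1) by auto
    qed
    have "\<exists>r. k dvd r^2 - a"
      by (rule less.hyps[OF _ sk \<open>k > 0\<close>]) (use \<open>k < n\<close> \<open>k > 0\<close> less.prems(3) k in auto)
    then obtain r1 where r1: "k dvd r1^2 - a" by auto
    obtain r2 where r2: "p dvd r2^2 - a" using less.prems(3) p by auto
    obtain x where x: "[x = r2] (mod p)" "[x = r1] (mod k)"
      using binary_chinese_remainder_int[OF cop] by blast
    have "[x^2 - a = r2^2 - a] (mod p)" "[x^2 - a = r1^2 - a] (mod k)"
      using x by (auto intro!: cong_diff cong_pow)
    then have "p dvd x^2 - a" "k dvd x^2 - a" using r1 r2 cong_dvd_iff by blast+
    then have "n dvd x^2 - a" using cop k divides_mult by blast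
    then show ?thesis by auto
  qed
qed

text \<open>\<open>X\<close> is the square root of \<open>n\<close> rounded up. It serves as the
  side of a pigeonhole box: \<open>{0..<X}\<close> has at least sqrt n points, while the square of a
  difference of two of them stays strictly below \<open>n\<close>.\<close>

lemma ceiling_sqrt_int:
  fixes n :: int assumes "n > 0"
  obtains X where "X > 0" "X^2 \<ge> n" "\<And>x. \<bar>x\<bar> < X \<Longrightarrow> x^2 < n"
proof -
  define P where "P k \<longleftrightarrow> int k ^ 2 \<ge> n" for k :: nat
  have "n \<le> n^2" using assms by (simp add: power2_eq_square)
  then have "P (nat n)" unfolding P_def using assms by simp
  then have L: "P (LEAST k. P k)" by (rule LeastI)
  define X where "X = int (LEAST k. P k)"
  have "X^2 \<ge> n" using L by (simp add: X_def P_def)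
  moreover have "X > 0"
    using calculation assms by (metis X_def gr0I less_le_not_le of_nat_0 of_nat_0_less_iff zero_power2)
  moreover have "x^2 < n" if "\<bar>x\<bar> < X" for x
  proof -
    have "nat \<bar>x\<bar> < (LEAST k. P k)" using that X_def by linarith
    then have "\<not> P (nat \<bar>x\<bar>)" using not_less_Least by blast
    then show ?thesis by (simp add: P_def)
  qed
  ultimately show ?thesis using that by blast
qed

lemma squarefree_eq_square_int:
  fixes x :: int assumes "squarefree (x^2)" shows "x^2 = 1"
proof -
  have "is_unit x" by (rule squarefreeD[OF assms]) simp
  then show ?thesis by (auto simp: zdvd1_eq abs_if split: if_splits)
qed

text \<open>The pigeonhole principle in the box \<open>x\<^sup>2 < |b|\<close>, \<open>y\<^sup>2 < |a|\<close>, \<open>z\<^sup>2 < |ab|\<close> gives a nonzero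
  triple at which \<open>z\<^sup>2 - a x\<^sup>2 - b y\<^sup>2\<close> is a multiple of \<open>a b\<close>; its size leaves only the values
  \<open>0\<close> and \<open>-a b\<close>, and the latter is removed by a multiplicative identity.\<close>

lemma legendre_ternary:
  fixes a b :: int
  assumes sf: "squarefree a" "squarefree b" and cop: "coprime a b"
    and sgn: "\<not> (a < 0 \<and> b < 0)" and r: "b dvd r^2 - a" and s: "a dvd s^2 - b"
  shows "\<exists>x y z. (x \<noteq> 0 \<or> y \<noteq> 0 \<or> z \<noteq> 0) \<and> z^2 = a * x^2 + b * y^2"
proof -
  consider "a = 1" | "b = 1" | "a \<noteq> 1" "b \<noteq> 1" by blast
  then show ?thesis
  proof cases
    case 1 then show ?thesis by (intro exI[of _ 1] exI[of _ 0]) auto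
  next
    case 2 then show ?thesis by (intro exI[of _ 0] exI[of _ 1]) auto
  next
    case 3
    have nz: "a \<noteq> 0" "b \<noteq> 0" using sf by auto
    obtain X where X: "X > 0" "X^2 \<ge> \<bar>b\<bar>" "\<And>x. \<bar>x\<bar> < X \<Longrightarrow> x^2 < \<bar>b\<bar>"
      using ceiling_sqrt_int[of "\<bar>b\<bar>"] nz by auto
    obtain Y where Y: "Y > 0" "Y^2 \<ge> \<bar>a\<bar>" "\<And>x. \<bar>x\<bar> < Y \<Longrightarrow> x^2 < \<bar>a\<bar>"
      using ceiling_sqrt_int[of "\<bar>a\<bar>"] nz by auto
    obtain Z where Z: "Z > 0" "Z^2 \<ge> \<bar>a\<bar> * \<bar>b\<bar>" "\<And>x. \<bar>x\<bar> < Z \<Longrightarrow> x^2 < \<bar>a\<bar> * \<bar>b\<bar>"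
      using ceiling_sqrt_int[of "\<bar>a\<bar> * \<bar>b\<bar>"] nz by auto
    \<comment> \<open>The pigeonhole principle needs a strict inequality. Equality in both bounds
      would make the squarefree numbers \<open>|a|\<close> and \<open>|b|\<close> squares, hence 1;
      since neither \<open>a\<close> nor \<open>b\<close> is 1, both would be -1, against
      \<open>sgn\<close>.\<close>
    have "X^2 \<noteq> \<bar>b\<bar> \<or> Y^2 \<noteq> \<bar>a\<bar>"
    proof (rule ccontr)
      assume h: "\<not> ?thesis"
      have "squarefree \<bar>a\<bar>" "squarefree \<bar>b\<bar>" using sf by (auto simp: abs_if squarefree_minus)
      then have "X^2 = 1" "Y^2 = 1" using h squarefree_eq_square_int by metis+
      then have "\<bar>a\<bar> = 1" "\<bar>b\<bar> = 1" using h by auto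
      then show False using 3 sgn by linarith
    qed
    then have XY: "X^2 * Y^2 > \<bar>b\<bar> * \<bar>a\<bar>"
      using X Y nz by (smt (verit, ccfv_SIG) mult_less_le_imp_less mult_le_less_imp_less zero_less_abs_iff)
    have "X^2 * Y^2 * Z^2 > (\<bar>b\<bar> * \<bar>a\<bar>) * (\<bar>a\<bar> * \<bar>b\<bar>)"
      by (rule mult_less_le_imp_less[OF XY Z(2)]) (use nz in auto)
    then have "(X * Y * Z)^2 > (\<bar>a\<bar> * \<bar>b\<bar>)^2" by (simp add: power2_eq_square mult_ac)
    then have big: "X * Y * Z > \<bar>a\<bar> * \<bar>b\<bar>"
      using X Y Z by (meson mult_pos_pos order_less_imp_le power2_less_imp_less)
    define B where "B = {0..<X} \<times> {0..<Y} \<times> {0..<Z}"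
    \<comment> \<open>A collision of \<open>f\<close> yields a difference with
      \<open>z = r x\<close> modulo \<open>b\<close> and \<open>z = s y\<close> modulo
      \<open>a\<close>; on this lattice the form vanishes modulo both.\<close>
    define f where "f = (\<lambda>(x::int,y::int,z::int). ((z - r*x) mod \<bar>b\<bar>, (z - s*y) mod \<bar>a\<bar>))"
    have cB: "int (card B) = X * Y * Z" unfolding B_def using X Y Z by (simp add: card_cartesian_product)
    have fB: "f ` B \<subseteq> {0..<\<bar>b\<bar>} \<times> {0..<\<bar>a\<bar>}" using nz by (auto simp: f_def)
    have "card (f ` B) \<le> card ({0..<\<bar>b\<bar>} \<times> {0..<\<bar>a\<bar>})" by (rule card_mono[OF _ fB]) auto
    then have "int (card (f ` B)) \<le> int (card ({0..<\<bar>b\<bar>} \<times> {0..<\<bar>a\<bar>}))" by (rule of_nat_mono)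
    then have "int (card (f ` B)) < int (card B)"
      unfolding cB using big by (simp add: card_cartesian_product mult.commute)
    then have "card (f ` B) < card B" by simp
    then have "\<not> inj_on f B" by (rule pigeonhole)
    then obtain u v where uv: "u \<in> B" "v \<in> B" "u \<noteq> v" "f u = f v" unfolding inj_on_def by blast
    obtain x1 y1 z1 x2 y2 z2 where e: "u = (x1,y1,z1)" "v = (x2,y2,z2)" by (metis prod_cases3)
    define x y z where xyz: "x = x1 - x2" "y = y1 - y2" "z = z1 - z2"
    have n0: "x \<noteq> 0 \<or> y \<noteq> 0 \<or> z \<noteq> 0" using uv(3) e xyz by auto
    have "\<bar>x\<bar> < X" "\<bar>y\<bar> < Y" "\<bar>z\<bar> < Z" using uv(1,2) e xyz by (auto simp: B_def)
    then have bd: "x^2 < \<bar>b\<bar>" "y^2 < \<bar>a\<bar>" "z^2 < \<bar>a\<bar> * \<bar>b\<bar>" using X Y Z by auto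
    have "\<bar>b\<bar> dvd (z1 - r*x1) - (z2 - r*x2)" "\<bar>a\<bar> dvd (z1 - s*y1) - (z2 - s*y2)"
      using uv(4) e unfolding f_def by (auto simp: mod_eq_dvd_iff)
    then have cg: "b dvd z - r * x" "a dvd z - s * y" by (auto simp: xyz algebra_simps)
    define F where "F = z^2 - a*x^2 - b*y^2"
    have "F = (z - r*x) * (z + r*x) + (r^2 - a) * x^2 - b * y^2"
      unfolding F_def by (simp add: algebra_simps power2_eq_square)
    then have bF: "b dvd F" using cg(1) r by auto
    have "F = (z - s*y) * (z + s*y) + (s^2 - b) * y^2 - a * x^2"
      unfolding F_def by (simp add: algebra_simps power2_eq_square)
    then have "a dvd F" using cg(2) s by auto
    then have "a * b dvd F" using bF cop divides_mult by blast
    then obtain k where k: "F = a * b * k" by auto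
    define M where "M = \<bar>a\<bar> * \<bar>b\<bar>"
    have M0: "M > 0" using nz by (simp add: M_def)
    have ax: "\<bar>a\<bar> * x^2 < M" "\<bar>a\<bar> * x^2 \<ge> 0" using bd nz by (auto simp: M_def)
    have byy: "\<bar>b\<bar> * y^2 < M" "\<bar>b\<bar> * y^2 \<ge> 0" using bd nz by (auto simp: M_def)
    have zz: "z^2 < M" "z^2 \<ge> 0" using bd by (auto simp: M_def)
    have kcase: "k = 0 \<or> k = -1"
    proof (cases "a > 0 \<and> b > 0")
      case True
      then have "F = z^2 - \<bar>a\<bar> * x^2 - \<bar>b\<bar> * y^2" "F = M * k" using k by (auto simp: F_def M_def)
      then have "F < M" "F > -2 * M" "F = M * k" using ax byy zz by linarith+
      then have "M * k < M * 1" "M * (-2) < M * k" by auto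
      then have "k < 1" "-2 < k" using M0 by (simp_all only: mult_less_cancel_left_pos)
      then show ?thesis by linarith
    next
      case False
      then have "F = z^2 - \<bar>a\<bar> * x^2 + \<bar>b\<bar> * y^2 \<or> F = z^2 + \<bar>a\<bar> * x^2 - \<bar>b\<bar> * y^2" "F = M * (-k)"
        using sgn nz k by (cases "a > 0"; auto simp: F_def M_def)+
      then have "F < 2 * M" "F > - M" "F = M * (-k)" using ax byy zz by linarith+
      then have "M * (-k) < M * 2" "M * (-1) < M * (-k)" by auto
      then show ?thesis using M0 by (simp only: mult_less_cancel_left_pos) linarith
    qed
    show ?thesis
    proof (cases "k = 0")
      case True
      then have "z^2 = a*x^2 + b*y^2" using k F_def by simp
      then show ?thesis using n0 by blast
    next
      case False
      then have F1: "z^2 + a*b = a*x^2 + b*y^2" using k kcase F_def by auto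
      have "z^2 + a * b \<noteq> 0"
      proof
        assume h: "z^2 + a*b = 0"
        then have "z^2 = - (a * b)" by simp
        then have "\<bar>a * b\<bar> = z^2 \<or> a*b > 0" by (cases "a * b > 0") auto
        then show False
        proof
          assume "\<bar>a * b\<bar> = z^2" then show False using zz by (simp add: M_def abs_mult)
        next
          assume "a * b > 0" then show False using h zz by simp
        qed
      qed
      \<comment> \<open>Composition of \<open>a x^2 + b y^2\<close> with \<open>z^2 + a b\<close>,
        the norm form of the field of sqrt(-ab). The new last coordinate \<open>z^2 + a b\<close> is
        nonzero because \<open>z^2 < |a b|\<close>.\<close>
      moreover have "(z^2 + a*b)^2 = a * (x*z - b*y)^2 + b * (y*z + a*x)^2"
      proof -
        have "a * (x*z - b*y)^2 + b * (y*z + a*x)^2 = (a*x^2 + b*y^2) * (z^2 + a*b)"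
          by (simp add: algebra_simps power2_eq_square)
        then show ?thesis using F1 by (simp add: power2_eq_square)
      qed
      ultimately show ?thesis by blast
    qed
  qed
qed

section \<open>Squarefree divisibility and the ternary equation behind (a)-(c)\<close>

lemma squarefree_dvd_mult_square_int:
  fixes D :: int assumes "squarefree D" "prime p" "p^2 dvd D * t^2" shows "p dvd t"
proof (rule ccontr)
  assume "\<not> p dvd t"
  then have "coprime (p^2) (t^2)" using assms(2) prime_imp_coprime by auto
  then have "p^2 dvd D" using assms(3) coprime_dvd_mult_left_iff by blast
  then have "is_unit p" using assms(1) squarefreeD by blast
  then show False using assms(2) by auto
qed

text \<open>A prime left over in the cofactor of \<open>gcd D m\<close> in \<open>D\<close> would
  divide the gcd as well, so its square would divide \<open>D\<close>.\<close>

lemma squarefree_dvdI: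
  fixes D m :: int
  assumes sf: "squarefree D" and p: "\<And>p. prime p \<Longrightarrow> p dvd D \<Longrightarrow> p dvd m"
  shows "D dvd m"
proof -
  obtain k where k: "D = gcd D m * k" by (meson dvdE gcd_dvd1)
  have "is_unit k"
  proof (rule ccontr)
    assume "\<not> is_unit k"
    moreover have "k \<noteq> 0" using k sf by auto
    ultimately obtain q where q: "prime q" "q dvd k" using prime_divisor_exists[of k] by auto
    then have "q dvd D" using k by (metis dvd_mult)
    then have "q dvd gcd D m" using p q by simp
    then have "q * q dvd gcd D m * k" using q by (intro mult_dvd_mono)
    then have "q^2 dvd D" using k by (simp add: power2_eq_square)
    then have "is_unit q" by (rule squarefreeD[OF sf])
    then show False using q by auto
  qed
  moreover have "D dvd gcd D m * k" using k by simp
  ultimately have "D dvd gcd D m" using dvd_mult_unit_iff by blast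
  then show ?thesis by (meson dvd_trans gcd_dvd2)
qed

lemma primitive_triple:
  fixes x y z :: int
  assumes "x \<noteq> 0 \<or> y \<noteq> 0 \<or> z \<noteq> 0"
  obtains g X Y Z where "g \<noteq> 0" "x = g * X" "y = g * Y" "z = g * Z"
    "\<forall>p. prime p \<longrightarrow> \<not> (p dvd X \<and> p dvd Y \<and> p dvd Z)"
proof -
  define g where "g = gcd x (gcd y z)"
  have gp: "g > 0" using assms by (auto simp: g_def less_le)
  obtain X Y Z where XYZ: "x = g * X" "y = g * Y" "z = g * Z"
    unfolding g_def by (metis dvdE dvd_trans gcd_dvd1 gcd_dvd2)
  have "g = gcd (g*X) (gcd (g*Y) (g*Z))" unfolding XYZ[symmetric] by (rule g_def)
  also have "gcd (g*Y) (g*Z) = g * gcd Y Z" using gcd_mult_distrib_int[of g Y Z] gp by simp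
  also have "gcd (g*X) (g * gcd Y Z) = g * gcd X (gcd Y Z)"
    using gcd_mult_distrib_int[of g X "gcd Y Z"] gp by simp
  finally have "gcd X (gcd Y Z) = 1" using gp by simp
  then have "\<forall>p. prime p \<longrightarrow> \<not> (p dvd X \<and> p dvd Y \<and> p dvd Z)"
    by (metis gcd_greatest not_prime_unit)
  then show ?thesis using gp XYZ by (intro that[of g X Y Z]) auto
qed

text \<open>The system \<open>D x\<^sup>2 - q y\<^sup>2 = e z\<^sup>2\<close> encodes that \<open>e D\<close> is a norm from \<open>\<rat>(\<surd>(q D))\<close>.\<close>

lemma legendre_norm_form:
  fixes D q e :: int
  assumes sf: "squarefree (q * D)" and e: "e = 1 \<or> e = -1"
    and a: "\<And>p. prime p \<Longrightarrow> odd p \<Longrightarrow> p dvd D \<Longrightarrow> \<exists>r. p dvd r^2 - (- e * q)"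
    and b: "\<And>p. prime p \<Longrightarrow> odd p \<Longrightarrow> p dvd q \<Longrightarrow> \<exists>r. p dvd r^2 - e * D"
    and c: "e * D < 0 \<Longrightarrow> q * D > 0"
  shows "\<exists>x y z. D * x^2 - q * y^2 = e * z^2 \<and> coprime x y \<and> coprime x z \<and> coprime y z"
proof -
  have ee: "e * e = 1" using e by auto
  have sfD: "squarefree D" and sfq: "squarefree q"
    using sf squarefree_mono[of D "q*D"] squarefree_mono[of q "q*D"] by auto
  have nz: "D \<noteq> 0" "q \<noteq> 0" using sfD sfq by auto
  have cop: "coprime D q"
  proof (rule coprimeI)
    fix c assume "c dvd D" "c dvd q"
    then have "c^2 dvd q * D" by (simp add: mult_dvd_mono power2_eq_square mult.commute)
    then show "is_unit c" using sf squarefreeD by blast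
  qed
  \<comment> \<open>Supplies the root at 2, where \<open>a\<close> and \<open>b\<close> say nothing:
    \<open>n^2 = n\<close> modulo 2.\<close>
  have two: "\<exists>r. p dvd r^2 - n" if "prime p" "\<not> odd p" for p n :: int
  proof -
    have "p = 2" using that primes_dvd_imp_eq[of 2 p] by auto
    moreover have "even (n^2 - n)" by simp
    ultimately show ?thesis by blast
  qed
  have "\<exists>r. \<bar>q\<bar> dvd r^2 - e*D"
  proof (rule sqrt_mod_squarefree)
    show "squarefree \<bar>q\<bar>" using sfq by (simp add: abs_if)
    show "\<exists>r. p dvd r^2 - e*D" if "prime p" "p dvd \<bar>q\<bar>" for p
      using b[of p] two[of p] that by auto
  qed (use nz in simp)
  then obtain r where r: "- e * q dvd r^2 - e*D" using e by auto
  have "\<exists>r. \<bar>D\<bar> dvd r^2 - (-e*q)"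
  proof (rule sqrt_mod_squarefree)
    show "squarefree \<bar>D\<bar>" using sfD by (simp add: abs_if)
    show "\<exists>r. p dvd r^2 - (-e*q)" if "prime p" "p dvd \<bar>D\<bar>" for p
      using a[of p] two[of p "-e*q"] that by auto
  qed (use nz in simp)
  then obtain s where s: "e * D dvd s^2 - (-e*q)" using e by auto
  \<comment> \<open>Multiplied by \<open>e\<close>, the equation takes Legendre's shape with
    coefficients \<open>e D\<close> and \<open>- e q\<close>. The roots \<open>r\<close> and
    \<open>s\<close> just found are its two congruence conditions, and \<open>c\<close> excludes two
    negative coefficients.\<close>
  have "\<exists>x y z. (x \<noteq> 0 \<or> y \<noteq> 0 \<or> z \<noteq> 0) \<and> z^2 = (e*D) * x^2 + (-e*q) * y^2"
  proof (rule legendre_ternary[OF _ _ _ _ r s])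
    show "squarefree (e*D)" "squarefree (-e*q)" using sfD sfq e by (auto simp: squarefree_minus)
    show "coprime (e*D) (-e*q)" using cop e by auto
    show "\<not> (e*D < 0 \<and> -e*q < 0)" using c e by (auto simp: zero_less_mult_iff)
  qed
  then obtain x y z where n0: "x \<noteq> 0 \<or> y \<noteq> 0 \<or> z \<noteq> 0" and eq: "z^2 = (e*D) * x^2 + (-e*q) * y^2"
    by blast
  obtain g X Y Z where g0: "g \<noteq> 0" and XYZ: "x = g * X" "y = g * Y" "z = g * Z"
    and prim: "\<forall>p. prime p \<longrightarrow> \<not> (p dvd X \<and> p dvd Y \<and> p dvd Z)"
    using n0 by (rule primitive_triple)
  have "g^2 * Z^2 = g^2 * ((e*D) * X^2 + (-e*q) * Y^2)"
    using eq XYZ by (simp add: power_mult_distrib algebra_simps)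
  then have "Z^2 = (e*D) * X^2 + (-e*q) * Y^2" using g0 by simp
  then have eq1: "e * Z^2 = D * X^2 - q * Y^2" using ee
    by (metis (no_types, opaque_lifting) mult.assoc mult_1 mult_minus_left distrib_left uminus_add_conv_diff add.commute mult_minus_right)
  have sq: "p^2 dvd w^2" if "p dvd w" for p w :: int using that by (simp add: dvd_power_same)
  \<comment> \<open>Primitive solutions are even pairwise coprime: a prime dividing two coordinates
    has its square dividing the third square times a unit or a squarefree coefficient, so it divides
    the third coordinate too.\<close>
  have XY: False if p: "prime p" "p dvd X" "p dvd Y" for p
  proof -
    have "p^2 dvd e * Z^2" using eq1 sq p by auto
    then have "p^2 dvd Z^2" using e by auto
    then have "p dvd Z" by simp
    then show False using prim p by blast
  qed
  have XZ: False if p: "prime p" "p dvd X" "p dvd Z" for p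
  proof -
    have "q * Y^2 = D * X^2 - e * Z^2" using eq1 by simp
    then have "p^2 dvd q * Y^2" using sq p by (metis dvd_diff dvd_mult)
    then show False using squarefree_dvd_mult_square_int[OF sfq] prim p by blast
  qed
  have YZ: False if p: "prime p" "p dvd Y" "p dvd Z" for p
  proof -
    have "D * X^2 = q * Y^2 + e * Z^2" using eq1 by simp
    then have "p^2 dvd D * X^2" using sq p by (metis dvd_add dvd_mult)
    then show False using squarefree_dvd_mult_square_int[OF sfD] prim p by blast
  qed
  have cI: "coprime u v" if "\<And>p. prime p \<Longrightarrow> p dvd u \<Longrightarrow> p dvd v \<Longrightarrow> False" for u v :: int
  proof (rule ccontr)
    assume h: "\<not> coprime u v"
    then obtain p where "prime p" "p dvd gcd u v"
    proof (cases "gcd u v = 0")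
      case True then show ?thesis using that[of 2] by auto
    next
      case False then show ?thesis using that h prime_divisor_exists[of "gcd u v"] coprime_iff_gcd_eq_1
        by (metis is_unit_gcd)
    qed
    then show False using that by auto
  qed
  show ?thesis using eq1 XY XZ YZ cI by metis
qed

subsection \<open>Quadratic fields and their integers\<close>

text \<open>In lowest terms the denominator \<open>v\<close> satisfies \<open>v^k dvd c\<close> for
  every \<open>k\<close>, which forces \<open>v = 1\<close>. Applied to the norm of an algebraic
  integer, this stands in for an argument with minimal polynomials.\<close>

lemma rat_powers_bounded_denominator:
  fixes r :: rat and c :: int
  assumes c: "c \<noteq> 0" and b: "\<And>k. of_int c * r ^ k \<in> \<int>"
  shows "r \<in> \<int>"
proof -
  obtain u v where v: "v > 0" and cop: "coprime u v" and r: "r = of_int u / of_int v" by (rule rat_quotient_E)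
  have dv: "v ^ k dvd c" for k
  proof -
    obtain z where z: "of_int c * r ^ k = of_int z" using b[of k] by (auto elim: Ints_cases)
    then have "of_int (c * u ^ k) = (of_int (z * v ^ k) :: rat)"
      using v r by (simp add: power_divide field_simps)
    then have "c * u ^ k = z * v ^ k" by (simp only: of_int_eq_iff)
    then have "v ^ k dvd c * u ^ k" by simp
    moreover have "coprime (v ^ k) (u ^ k)" using cop by (simp add: coprime_commute)
    ultimately show ?thesis using coprime_dvd_mult_left_iff by blast
  qed
  have "v = 1"
  proof (rule ccontr)
    assume "v \<noteq> 1"
    then have "v \<ge> 2" using v by simp
    define k where "k = nat \<bar>c\<bar>"
    have "\<bar>c\<bar> < 2 ^ k" unfolding k_def
      by (metis abs_ge_zero int_nat_eq of_nat_less_two_power)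
    also have "\<dots> \<le> v ^ k" using \<open>v \<ge> 2\<close> by (simp add: power_mono)
    also have "\<dots> \<le> \<bar>c\<bar>" using dvd_imp_le_int[OF c dv[of k]] by simp
    finally show False by simp
  qed
  then show ?thesis using r by simp
qed

text \<open>In lowest terms the square of the denominator divides \<open>n\<close>.\<close>

lemma squarefree_mult_square_Ints:
  fixes r :: rat and n :: int
  assumes "squarefree n" "of_int n * r^2 \<in> \<int>"
  shows "r \<in> \<int>"
proof -
  obtain u v where v: "v > 0" and cop: "coprime u v" and r: "r = of_int u / of_int v" by (rule rat_quotient_E)
  obtain z where z: "of_int n * r ^ 2 = of_int z" using assms(2) by (auto elim: Ints_cases)
  then have "of_int (n * u ^ 2) = (of_int (z * v ^ 2) :: rat)"
    using v r by (simp add: power_divide field_simps)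
  then have "n * u ^ 2 = z * v ^ 2" by (simp only: of_int_eq_iff)
  then have "v ^ 2 dvd n * u ^ 2" by simp
  moreover have "coprime (v ^ 2) (u ^ 2)" using cop by (simp add: coprime_commute)
  ultimately have "v^2 dvd n" using coprime_dvd_mult_left_iff by blast
  then have "is_unit v" by (rule squarefreeD[OF assms(1)])
  then have "v = 1" using v by simp
  then show ?thesis using r by simp
qed

locale quad_field =
  fixes m :: int
  assumes sqfree: "squarefree m" and ne1: "m \<noteq> 1"
begin

abbreviation K :: "complex set" where "K \<equiv> qfield m"
abbreviation OK :: "complex set" where "OK \<equiv> ring_of_integers m"

definition s :: complex where "s = csqrt (of_int m)"

lemma s2: "s^2 = of_int m" by (simp add: s_def)

lemma ss: "s * s = of_int m" using s2 by (simp add: power2_eq_square)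

lemma m0: "m \<noteq> 0" using sqfree by auto

lemma rat_square_ne: "(r::rat)^2 \<noteq> of_int m"
proof
  assume h: "r^2 = of_int m"
  then have "of_int 1 * r^2 \<in> \<int>" by simp
  then have "r \<in> \<int>" by (rule squarefree_mult_square_Ints[rotated]) simp
  then obtain z where "r = of_int z" by (auto elim: Ints_cases)
  then have "m = z^2" using h by (metis of_int_eq_iff of_int_power)
  then show False using sqfree squarefree_eq_square_int ne1 by metis
qed

definition em :: "rat \<Rightarrow> rat \<Rightarrow> complex" where "em a b = of_rat a + of_rat b * s"

lemma em_0_iff: "em a b = 0 \<longleftrightarrow> a = 0 \<and> b = 0"
proof
  assume h: "em a b = 0"
  have "b = 0"
  proof (rule ccontr)
    assume b: "b \<noteq> 0"
    then have "s = of_rat (- a / b)" using h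
      by (simp add: em_def of_rat_divide of_rat_minus field_simps add_eq_0_iff)
    then have "of_rat ((-a/b)^2) = s^2" by (simp add: of_rat_power of_rat_minus)
    then have "of_rat ((-a/b)^2) = (of_rat (of_int m) :: complex)" unfolding s2 by simp
    then show False using rat_square_ne by (simp only: of_rat_eq_iff)
  qed
  then show "a = 0 \<and> b = 0" using h by (simp add: em_def)
qed (simp add: em_def)

lemma em_diff: "em a b - em c d = em (a - c) (b - d)"
  by (simp add: em_def of_rat_diff algebra_simps)

lemma em_eq_iff: "em a b = em c d \<longleftrightarrow> a = c \<and> b = d"
proof -
  have "em a b = em c d \<longleftrightarrow> em (a - c) (b - d) = 0" by (simp flip: em_diff)
  then show ?thesis using em_0_iff by auto
qed

lemma em_add: "em a b + em c d = em (a + c) (b + d)"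
  by (simp add: em_def of_rat_add algebra_simps)

lemma em_mult: "em a b * em c d = em (a * c + of_int m * b * d) (a * d + b * c)"
proof -
  have "em a b * em c d = of_rat (a*c) + of_rat (b*d) * (s*s) + of_rat (a*d+b*c) * s"
    by (simp add: em_def of_rat_add of_rat_mult algebra_simps)
  then show ?thesis unfolding ss by (simp add: em_def of_rat_add of_rat_mult algebra_simps)
qed

lemma K_iff: "x \<in> K \<longleftrightarrow> (\<exists>a b. x = em a b)" by (auto simp: qfield_def em_def s_def)

lemma K_E: assumes "x \<in> K" obtains a b where "x = em a b" using assms K_iff by blast

lemma em_K [simp]: "em a b \<in> K" using K_iff by blast

lemma K_of_rat [simp]: "of_rat r \<in> K" using em_K[of r 0] by (simp add: em_def)
lemma K_of_int [simp]: "of_int r \<in> K" using K_of_rat[of "of_int r"] by simp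
lemma K_numeral [simp]: "numeral r \<in> K" using K_of_int[of "numeral r"] by simp
lemma K_01 [simp]: "0 \<in> K" "1 \<in> K" using K_of_int[of 0] K_of_int[of 1] by auto
lemma K_s [simp]: "s \<in> K" using em_K[of 0 1] by (simp add: em_def)

lemma K_add [simp, intro]: "x \<in> K \<Longrightarrow> y \<in> K \<Longrightarrow> x + y \<in> K"
  using em_add K_iff by metis
lemma K_diff [simp, intro]: "x \<in> K \<Longrightarrow> y \<in> K \<Longrightarrow> x - y \<in> K"
  using em_diff K_iff by metis
lemma K_uminus [simp, intro]: "x \<in> K \<Longrightarrow> - x \<in> K" using K_diff[of 0 x] by simp
lemma K_mult [simp, intro]: "x \<in> K \<Longrightarrow> y \<in> K \<Longrightarrow> x * y \<in> K"
  using em_mult K_iff by metis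
lemma K_power [simp, intro]: "x \<in> K \<Longrightarrow> x ^ n \<in> K" by (induction n) auto

text \<open>\<open>K\<close> is a set of complex numbers, so conjugation is read off from the
  coordinates of \<open>em\<close>, which are unique by \<open>em_eq_iff\<close>. Complex
  conjugation would be wrong for \<open>m > 0\<close>, where \<open>K\<close> is real. Outside
  \<open>K\<close> the value is unspecified.\<close>

definition cj :: "complex \<Rightarrow> complex" where
  "cj x = (THE y. \<exists>a b. x = em a b \<and> y = em a (- b))"

lemma cj_em: "cj (em a b) = em a (- b)"
  unfolding cj_def by (rule the_equality) (auto simp: em_eq_iff)

lemma cj_K [simp, intro]: "x \<in> K \<Longrightarrow> cj x \<in> K" using cj_em K_iff by metis
lemma cj_of_rat [simp]: "cj (of_rat r) = of_rat r" using cj_em[of r 0] by (simp add: em_def)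
lemma cj_of_int [simp]: "cj (of_int r) = of_int r" using cj_of_rat[of "of_int r"] by simp
lemma cj_numeral [simp]: "cj (numeral r) = numeral r" using cj_of_int[of "numeral r"] by simp
lemma cj_01 [simp]: "cj 0 = 0" "cj 1 = 1" using cj_of_int[of 0] cj_of_int[of 1] by auto
lemma cj_s [simp]: "cj s = - s" using cj_em[of 0 1] by (simp add: em_def of_rat_minus)
lemma cj_add: "x \<in> K \<Longrightarrow> y \<in> K \<Longrightarrow> cj (x + y) = cj x + cj y"
  by (auto simp: K_iff em_add cj_em)
lemma cj_mult: "x \<in> K \<Longrightarrow> y \<in> K \<Longrightarrow> cj (x * y) = cj x * cj y"
  by (auto simp: K_iff em_mult cj_em em_eq_iff)
lemma cj_diff: "x \<in> K \<Longrightarrow> y \<in> K \<Longrightarrow> cj (x - y) = cj x - cj y"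
  by (auto simp: K_iff em_diff cj_em)
lemma cj_power: "x \<in> K \<Longrightarrow> cj (x ^ n) = cj x ^ n"
  by (induction n) (auto simp: cj_mult)
lemma cj_cj [simp]: "x \<in> K \<Longrightarrow> cj (cj x) = x" by (auto simp: K_iff cj_em)

text \<open>Rational-valued rather than complex, so that norms can be compared by sign and absolute
  value.\<close>

definition N :: "complex \<Rightarrow> rat" where
  "N x = (THE r. \<exists>a b. x = em a b \<and> r = a^2 - of_int m * b^2)"

lemma N_em: "N (em a b) = a^2 - of_int m * b^2"
  unfolding N_def by (rule the_equality) (auto simp: em_eq_iff)

lemma N_cj: "x \<in> K \<Longrightarrow> of_rat (N x) = x * cj x"
  by (auto simp: K_iff cj_em N_em em_mult) (simp add: em_def power2_eq_square)

lemma N_mult: assumes "x \<in> K" "y \<in> K" shows "N (x * y) = N x * N y"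
proof -
  have "of_rat (N (x*y)) = (of_rat (N x * N y) :: complex)"
    using assms by (simp add: N_cj of_rat_mult cj_mult)
  then show ?thesis by (simp only: of_rat_eq_iff)
qed

lemma N_of_rat [simp]: "N (of_rat r) = r^2" using N_em[of r 0] by (simp add: em_def)
lemma N_of_int [simp]: "N (of_int r) = of_int r^2" using N_of_rat[of "of_int r"] by simp
lemma N_numeral [simp]: "N (numeral r) = numeral r^2" using N_of_int[of "numeral r"] by simp
lemma N_01 [simp]: "N 0 = 0" "N 1 = 1" using N_of_int[of 0] N_of_int[of 1] by auto
lemma N_power: "x \<in> K \<Longrightarrow> N (x ^ n) = N x ^ n" by (induction n) (auto simp: N_mult)
lemma N_s: "N s = - of_int m" using N_em[of 0 1] by (simp add: em_def)

lemma N_0_iff: assumes "x \<in> K" shows "N x = 0 \<longleftrightarrow> x = 0"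
proof
  obtain a b where x: "x = em a b" using assms K_iff by blast
  assume "N x = 0"
  then have e: "a^2 = of_int m * b^2" using x by (simp add: N_em)
  have "b = 0"
  proof (rule ccontr)
    assume "b \<noteq> 0"
    then have "(a/b)^2 = of_int m" using e by (simp add: power_divide)
    then show False using rat_square_ne by blast
  qed
  then show "x = 0" using e x by (simp add: em_def)
qed simp

lemma K_inverse [simp, intro]: assumes "x \<in> K" shows "inverse x \<in> K"
proof (cases "x = 0")
  case False
  have "inverse x = cj x * of_rat (inverse (N x))"
  proof (rule inverse_unique)
    have "x * (cj x * of_rat (inverse (N x))) = of_rat (N x * inverse (N x))"
      by (simp only: of_rat_mult N_cj[OF assms] mult.assoc)
    then show "x * (cj x * of_rat (inverse (N x))) = 1" using False N_0_iff[OF assms] by simp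
  qed
  then show ?thesis using assms by simp
qed simp

lemma K_divide [simp, intro]: "x \<in> K \<Longrightarrow> y \<in> K \<Longrightarrow> x / y \<in> K" by (simp add: divide_inverse)

lemma cj_0_iff [simp]: "x \<in> K \<Longrightarrow> cj x = 0 \<longleftrightarrow> x = 0" by (metis cj_01(1) cj_cj)

lemma cj_inverse: "x \<in> K \<Longrightarrow> cj (inverse x) = inverse (cj x)"
  by (cases "x = 0") (auto intro!: inverse_unique[symmetric] simp flip: cj_mult)

lemma cj_divide: "x \<in> K \<Longrightarrow> y \<in> K \<Longrightarrow> cj (x / y) = cj x / cj y"
  by (simp add: divide_inverse cj_mult cj_inverse)

text \<open>\<open>tau\<close> and \<open>nu\<close> are the trace and the norm of
  \<open>om\<close>, which will turn out to generate the ring of integers. With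
  \<open>om^2 = tau om - nu\<close> all classes of \<open>m\<close> modulo 4 share one set of
  formulas.\<close>

definition tau :: int where "tau = (if m mod 4 = 1 then 1 else 0)"
definition nu :: int where "nu = (if m mod 4 = 1 then (1 - m) div 4 else - m)"
definition om :: complex where "om = (if m mod 4 = 1 then (1 + s) / 2 else s)"

lemma m_mod4: "m mod 4 = 1 \<or> m mod 4 = 2 \<or> m mod 4 = 3"
proof -
  have "m mod 4 \<noteq> 0"
  proof
    assume "m mod 4 = 0"
    then have "2^2 dvd m" by auto
    then have "is_unit (2::int)" by (rule squarefreeD[OF sqfree])
    then show False by simp
  qed
  then show ?thesis by presburger
qed

lemma om2: "om^2 = of_int tau * om - of_int nu"
proof (cases "m mod 4 = 1")
  case True
  then obtain k where k: "m = 4 * k + 1" by (metis mult_div_mod_eq)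
  have "nu = - k" unfolding nu_def using True k by simp
  then have n: "of_int nu = - (of_int k :: complex)" by simp
  have "s^2 = of_int (4 * k + 1)" using s2 unfolding k .
  then have "(1 + s)^2 = 2 * (1 + s) + 4 * of_int k" by (simp add: power2_eq_square algebra_simps)
  then have "((1 + s) / 2)^2 = (1 + s) / 2 + of_int k" by (simp add: power_divide field_simps)
  then show ?thesis unfolding n using True by (simp add: om_def tau_def)
qed (auto simp: om_def tau_def nu_def s2)

lemma K_om [simp]: "om \<in> K" by (auto simp: om_def)

lemma cj_om: "cj om = of_int tau - om"
  by (auto simp: om_def tau_def cj_divide cj_add field_simps)

lemma N_Kint: "N (of_int a + of_int b * om) = of_int (a^2 + tau * a * b + nu * b^2)"
proof -
  have "of_rat (N (of_int a + of_int b * om)) = (of_int a + of_int b * om) * (of_int a + of_int b * (of_int tau - om))"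
    by (simp add: N_cj cj_add cj_mult cj_om)
  also have "\<dots> = of_int a^2 + of_int (a * b * tau) + of_int b^2 * (of_int tau * om - om^2)"
    by (simp add: algebra_simps power2_eq_square)
  also have "\<dots> = (of_rat (of_int (a^2 + tau * a * b + nu * b^2)) :: complex)"
    unfolding om2 by (simp add: algebra_simps power2_eq_square of_rat_add of_rat_mult)
  finally show ?thesis by (simp only: of_rat_eq_iff)
qed

text \<open>With trace \<open>t\<close> and norm \<open>n\<close> integral,
  \<open>m (2 b)^2 = t^2 - 4 n\<close>, and squarefreeness of \<open>m\<close> makes
  \<open>d = 2 b\<close> integral. The congruence between \<open>t^2\<close> and
  \<open>m d^2\<close> modulo 4 then decides the parities of \<open>t\<close> and
  \<open>d\<close>.\<close>

lemma int_of_trace_norm: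
  assumes x: "x = em a b" and t: "2 * a \<in> \<int>" and n: "N x \<in> \<int>"
  shows "\<exists>a b::int. x = of_int a + of_int b * om"
proof -
  obtain t where t: "2 * a = of_int t" using t by (auto elim: Ints_cases)
  obtain n where n: "a^2 - of_int m * b^2 = of_int n" using n x by (auto elim: Ints_cases simp: N_em)
  have "of_int m * (2*b)^2 = (2*a)^2 - 4 * of_int n" using n by (simp add: power_mult_distrib)
  then have mb: "of_int m * (2*b)^2 = of_int (t^2 - 4 * n)" by (simp add: t)
  then have "2 * b \<in> \<int>" using squarefree_mult_square_Ints[OF sqfree, of "2*b"] Ints_of_int by metis
  then obtain d where d: "2 * b = of_int d" by (auto elim: Ints_cases)
  have "of_int (m * d^2) = (of_int (t^2 - 4*n) :: rat)" using mb d by simp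
  then have "m * d^2 = t^2 - 4 * n" by (simp only: of_int_eq_iff)
  then have e: "4 dvd t^2 - m * d^2" by simp
  have x2: "2 * x = of_int t + of_int d * s"
  proof -
    have "2 * x = of_rat (2 * a) + of_rat (2 * b) * s" using x by (simp add: em_def of_rat_mult)
    then show ?thesis by (simp add: t d)
  qed
  show ?thesis
  proof (cases "m mod 4 = 1")
    case True
    have "even (t - d)"
    proof -
      have "even (t^2 - m * d^2)" by (rule dvd_trans[OF _ e]) simp
      moreover have "odd m" using True by presburger
      ultimately show ?thesis by auto
    qed
    then obtain k where k: "t = d + 2 * k" by (metis dvdE diff_eq_eq add.commute)
    have "x = of_int k + of_int d * om" using x2 k True by (simp add: om_def field_simps)
    then show ?thesis by blast
  next
    case False
    have "even t \<and> even d"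
    proof -
      obtain h where h: "m = 4 * h + 2 \<or> m = 4 * h + 3" using m_mod4 False by (metis mult_div_mod_eq)
      consider "even t" "even d" | t' where "t = 2*t'+1" "even d" | d' where "d = 2 * d' + 1" "even t"
        | t' d' where "t = 2*t'+1" "d = 2 * d' + 1" by (meson oddE)
      then show ?thesis
      proof cases
        case 2
        then have "odd (t^2 - m * d^2)" by simp
        moreover have "even (t^2 - m * d^2)" by (rule dvd_trans[OF _ e]) simp
        ultimately show ?thesis by blast
      next
        case 3
        then obtain t' where t': "t = 2 * t'" by auto
        have "t^2 - m*d^2 = 4 * (t'^2 - m * (d'^2 + d')) - m" using 3 t' by (simp add: power2_eq_square algebra_simps)
        then have "m = 4 * (t'^2 - m * (d'^2 + d')) - (t^2 - m*d^2)" by simp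
        then have "4 dvd m" using e by (metis dvd_diff dvd_triv_left)
        then show ?thesis using m_mod4 by auto
      next
        case 4
        have "t^2 - m*d^2 = 4 * (t'^2 + t' - m * (d'^2 + d')) + (1 - m)" using 4 by (simp add: power2_eq_square algebra_simps)
        then have "4 dvd 1 - m" using e by (metis dvd_add_right_iff dvd_triv_left)
        then show ?thesis using h by presburger
      qed auto
    qed
    then obtain t' d' where "t = 2 * t'" "d = 2 * d'" by (meson evenE)
    then have "2 * x = 2 * (of_int t' + of_int d' * om)" using x2 False by (simp add: om_def algebra_simps)
    then have "x = of_int t' + of_int d' * om" by (simp only: mult_cancel_left) simp
    then show ?thesis by blast
  qed
qed

lemma poly_of_int_sum:
  "poly (map_poly of_int p) (x::complex) = (\<Sum>i\<le>degree p. of_int (coeff p i) * x ^ i)"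
  by (simp add: poly_altdef coeff_map_poly degree_map_poly)

text \<open>A monic equation of degree \<open>n\<close> expresses every power by the first
  \<open>n\<close> of them with integer coefficients, so a common denominator of these finitely many
  powers serves for all.\<close>

lemma powers_common_denominator:
  assumes x: "x \<in> K" and alg: "alg_int x"
  shows "\<exists>c::int. c \<noteq> 0 \<and> (\<forall>k. \<exists>a b::int. of_int c * x ^ k = of_int a + of_int b * s)"
proof -
  define M where "M c = {y. \<exists>a b::int. of_int c * y = of_int a + of_int b * s}" for c :: int
  have M_add: "y + z \<in> M c" if asm: "y \<in> M c" "z \<in> M c" for c y z
  proof -
    obtain a b :: int where "of_int c * y = of_int a + of_int b * s" using asm unfolding M_def by blast
    moreover obtain a' b' :: int where "of_int c * z = of_int a' + of_int b' * s" using asm unfolding M_def by blast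
    ultimately have "of_int c * (y + z) = of_int (a + a') + of_int (b + b') * s" by (simp add: algebra_simps)
    then show ?thesis unfolding M_def by blast
  qed
  have M_mult: "of_int k * y \<in> M c" if asm: "y \<in> M c" for c k y
  proof -
    obtain a b :: int where h: "of_int c * y = of_int a + of_int b * s"
      using asm unfolding M_def by blast
    have "of_int c * (of_int k * y) = of_int k * (of_int c * y)" by simp
    also have "\<dots> = of_int (k * a) + of_int (k * b) * s" unfolding h by (simp add: algebra_simps)
    finally show ?thesis unfolding M_def by blast
  qed
  have M_0: "0 \<in> M c" for c unfolding M_def by (auto intro!: exI[of _ 0])
  have M_sum: "(\<Sum>i\<in>A. of_int (f i) * g i) \<in> M c" if "\<And>i. i \<in> A \<Longrightarrow> g i \<in> M c" "finite A"
    for c and f :: "nat \<Rightarrow> int" and g A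
    using that(2,1) by (induction A rule: finite_induct) (auto simp: M_0 intro!: M_add M_mult)
  have M_mono: "y \<in> M (c * d)" if asm: "y \<in> M c" for c d y
  proof -
    obtain a b :: int where h: "of_int c * y = of_int a + of_int b * s"
      using asm unfolding M_def by blast
    have "of_int (c * d) * y = of_int d * (of_int c * y)" by simp
    also have "\<dots> = of_int (d * a) + of_int (d * b) * s" unfolding h by (simp add: algebra_simps)
    finally show ?thesis unfolding M_def by blast
  qed
  have ex: "\<exists>c. c \<noteq> 0 \<and> y \<in> M c" if asm: "y \<in> K" for y
  proof -
    obtain a b where y: "y = em a b" using asm K_E by blast
    obtain u v where q: "quotient_of a = (u, v)" by force
    obtain u' v' where q': "quotient_of b = (u', v')" by force
    have v: "v > 0" "a = of_int u / of_int v" "v' > 0" "b = of_int u' / of_int v'"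
      using q q' quotient_of_denom_pos quotient_of_div by blast+
    have "of_int (v * v') * y = of_int (u * v') + of_int (u' * v) * s"
      using v(1,3) unfolding y v(2,4) by (simp add: em_def of_rat_divide field_simps)
    moreover have "v * v' \<noteq> 0" using v by simp
    ultimately show ?thesis unfolding M_def by blast
  qed
  obtain p where p: "lead_coeff p = 1" "poly (map_poly of_int p) x = 0"
    using alg by (auto simp: alg_int_def)
  define n where "n = degree p"
  have "\<exists>c. c \<noteq> 0 \<and> (\<forall>k<j. x ^ k \<in> M c)" for j
  proof (induction j)
    case 0 then show ?case by (intro exI[of _ 1]) auto
  next
    case (Suc j)
    then obtain c where c: "c \<noteq> 0" "\<forall>k<j. x ^ k \<in> M c" by blast
    obtain d where d: "d \<noteq> 0" "x ^ j \<in> M d" using ex x by blast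
    have "x ^ k \<in> M (c * d)" if "k < Suc j" for k
      using that c(2) d(2) M_mono[of "x^k" c d] M_mono[of "x^k" d c] by (auto simp: less_Suc_eq mult.commute)
    then show ?case using c d by (intro exI[of _ "c*d"]) auto
  qed
  then obtain c where c: "c \<noteq> 0" "\<forall>k<n. x ^ k \<in> M c" by blast
  have "x ^ k \<in> M c" for k
  proof (induction k rule: less_induct)
    case (less k)
    show ?case
    proof (cases "k < n")
      case False
      have "{..n} = insert n {..<n}" by auto
      then have "x ^ n + (\<Sum>i<n. of_int (coeff p i) * x ^ i) = 0"
        using p unfolding poly_of_int_sum n_def by simp
      then have xn: "x ^ n = (\<Sum>i<n. of_int (- coeff p i) * x ^ i)"
        by (simp add: sum_negf eq_neg_iff_add_eq_0)
      have "x ^ k = x ^ (k - n) * x ^ n" using False by (simp flip: power_add)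
      also have "\<dots> = (\<Sum>i<n. of_int (- coeff p i) * x ^ (k - n + i))"
        unfolding xn sum_distrib_left by (intro sum.cong) (auto simp: power_add)
      also have "\<dots> \<in> M c"
        by (rule M_sum) (use False less in auto)
      finally show ?thesis .
    qed (use c in auto)
  qed
  then show ?thesis using c unfolding M_def by blast
qed

text \<open>Taking norms turns a common denominator \<open>c\<close> of all powers of
  \<open>y\<close> into a common denominator \<open>c^2\<close> of all powers of the rational number
  \<open>N y\<close>.\<close>

lemma norm_Ints_of_powers:
  assumes y: "y \<in> K" and c: "c \<noteq> (0::int)"
    and p: "\<And>k. \<exists>a b::int. of_int c * y ^ k = of_int a + of_int b * s"
  shows "N y \<in> \<int>"
proof (rule rat_powers_bounded_denominator)
  show "c^2 \<noteq> 0" using c by simp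
  fix k
  obtain a b :: int where h: "of_int c * y ^ k = of_int a + of_int b * s" using p by blast
  have "N (of_int c * y ^ k) = of_int c ^ 2 * N y ^ k" using y by (simp add: N_mult N_power)
  moreover have "N (of_int a + of_int b * s) = of_int (a^2 - m * b^2)"
    using N_em[of "of_int a" "of_int b"] by (simp add: em_def)
  ultimately have "of_int (c^2) * N y ^ k = of_int (a^2 - m * b^2)" using h by simp
  then show "of_int (c^2) * N y ^ k \<in> \<int>" by (metis Ints_of_int)
qed

text \<open>The norms of \<open>x\<close> and of \<open>x + 1\<close> are both integers, and
  \<open>N (x + 1) - N x - 1\<close> is the trace of \<open>x\<close>; this reduces one direction to
  \<open>int_of_trace_norm\<close>. Conversely, the polynomial \<open>p\<close> is the
  characteristic polynomial of \<open>x\<close>.\<close>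

lemma OK_iff: "x \<in> OK \<longleftrightarrow> (\<exists>a b::int. x = of_int a + of_int b * om)"
proof
  assume "x \<in> OK"
  then have x: "x \<in> K" "alg_int x" by (auto simp: ring_of_integers_def)
  obtain c where c: "c \<noteq> 0" "\<And>k. \<exists>a b::int. of_int c * x ^ k = of_int a + of_int b * s"
    using powers_common_denominator[OF x] by blast
  have n0: "N x \<in> \<int>" using norm_Ints_of_powers[OF x(1) c] .
  have "\<exists>a b::int. of_int c * (x + 1) ^ k = of_int a + of_int b * s" for k
  proof -
    obtain f g where fg: "\<And>i. of_int c * x ^ i = of_int (f i) + of_int (g i) * s" using c(2) by metis
    have "of_int c * (x + 1) ^ k = (\<Sum>i\<le>k. of_nat (k choose i) * (of_int c * x ^ i))"
      by (simp add: binomial_ring sum_distrib_left mult_ac)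
    also have "\<dots> = of_int (\<Sum>i\<le>k. of_nat (k choose i) * f i) + of_int (\<Sum>i\<le>k. of_nat (k choose i) * g i) * s"
      unfolding fg by (simp add: algebra_simps sum.distrib sum_distrib_left sum_distrib_right)
    finally show ?thesis by blast
  qed
  then have n1: "N (x + 1) \<in> \<int>" using norm_Ints_of_powers[OF _ c(1), of "x + 1"] x by simp
  obtain a b where ab: "x = em a b" using x K_E by blast
  have "x + 1 = em (a + 1) b" by (simp add: ab em_def of_rat_add)
  then have "2 * a = N (x + 1) - N x - 1" by (simp add: ab N_em power2_eq_square algebra_simps)
  then have "2 * a \<in> \<int>" using n0 n1 by simp
  then show "\<exists>a b::int. x = of_int a + of_int b * om" using int_of_trace_norm ab n0 by blast
next
  assume "\<exists>a b::int. x = of_int a + of_int b * om"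
  then obtain a b :: int where x: "x = of_int a + of_int b * om" by blast
  define p where "p = [:a^2 + tau * a * b + nu * b^2, - (2 * a + tau * b), 1:]"
  have o: "of_int b * of_int b * om * om = of_int b * of_int b * (of_int tau * om - of_int nu)"
    using om2 by (simp add: power2_eq_square)
  have "poly (map_poly of_int p) x
      = of_int b * of_int b * om * om - of_int b * of_int b * (of_int tau * om - of_int nu)"
    by (simp add: p_def x map_poly_pCons power2_eq_square algebra_simps)
  then have "poly (map_poly of_int p) x = 0" using o by simp
  then show "x \<in> OK" unfolding ring_of_integers_def alg_int_def
    by (auto simp: x intro!: exI[of _ p]) (simp add: p_def)
qed

lemma OK_E: assumes "x \<in> OK" obtains a b :: int where "x = of_int a + of_int b * om"
  using assms OK_iff by blast

lemma OK_K [simp, intro]: "x \<in> OK \<Longrightarrow> x \<in> K" by (simp add: ring_of_integers_def)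
lemma OK_of_int [simp]: "of_int a \<in> OK" using OK_iff by (metis add.right_neutral mult_zero_left of_int_0)
lemma OK_numeral [simp]: "numeral a \<in> OK" using OK_of_int[of "numeral a"] by simp
lemma OK_01 [simp]: "0 \<in> OK" "1 \<in> OK" using OK_of_int[of 0] OK_of_int[of 1] by auto
lemma OK_om [simp]: "om \<in> OK" unfolding OK_iff by (rule exI[of _ 0], rule exI[of _ 1]) simp

lemma OK_add [simp, intro]: assumes "x \<in> OK" "y \<in> OK" shows "x + y \<in> OK"
proof -
  obtain a b c d :: int where "x = of_int a + of_int b * om" "y = of_int c + of_int d * om"
    using assms OK_iff by blast
  then have "x + y = of_int (a + c) + of_int (b + d) * om" by (simp add: algebra_simps)
  then show ?thesis using OK_iff by blast
qed

lemma OK_mult [simp, intro]: assumes "x \<in> OK" "y \<in> OK" shows "x * y \<in> OK"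
proof -
  obtain a b c d :: int where "x = of_int a + of_int b * om" "y = of_int c + of_int d * om"
    using assms OK_iff by blast
  then have "x * y = of_int (a * c) + of_int (a * d + b * c) * om + of_int (b * d) * om^2"
    by (simp add: algebra_simps power2_eq_square)
  also have "\<dots> = of_int (a * c - b * d * nu) + of_int (a * d + b * c + b * d * tau) * om"
    unfolding om2 by (simp add: algebra_simps)
  finally show ?thesis using OK_iff by blast
qed

lemma OK_uminus [simp, intro]: assumes "x \<in> OK" shows "- x \<in> OK"
  using OK_mult[OF OK_of_int[of "-1"] assms] by simp
lemma OK_diff [simp, intro]: "x \<in> OK \<Longrightarrow> y \<in> OK \<Longrightarrow> x - y \<in> OK"
  using OK_add[of x "-y"] by simp
lemma OK_power [simp, intro]: "x \<in> OK \<Longrightarrow> x ^ n \<in> OK" by (induction n) auto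

lemma OK_cj [simp, intro]: assumes "x \<in> OK" shows "cj x \<in> OK"
  using assms by (elim OK_E) (auto simp: cj_add cj_mult cj_om)

lemma OK_s [simp]: "s \<in> OK"
proof (cases "m mod 4 = 1")
  case True
  then have "s = 2 * om - 1" by (simp add: om_def field_simps)
  then show ?thesis by simp
next
  case False
  then show ?thesis using OK_om by (simp add: om_def)
qed

lemma om_cases: "m mod 4 = 1 \<and> 2 * om = 1 + s \<or> m mod 4 \<noteq> 1 \<and> om = s"
  by (simp add: om_def)

lemma om_int_eq_iff:
  "of_int a + of_int b * om = of_int c + of_int d * om \<longleftrightarrow> a = c \<and> b = d" for a b c d :: int
proof -
  have "om = em (1/2) (1/2)" if "m mod 4 = 1"
    using that by (simp add: om_def em_def of_rat_divide field_simps)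
  moreover have "om = em 0 1" if "m mod 4 \<noteq> 1" using that by (simp add: om_def em_def)
  ultimately obtain e f where o: "om = em e f" and f: "f \<noteq> 0"
    by (cases "m mod 4 = 1") (metis zero_neq_one divide_eq_0_iff zero_neq_numeral, metis zero_neq_one)
  have *: "of_int a + of_int b * om = em (of_int a + of_int b * e) (of_int b * f)" for a b :: int
    by (simp add: o em_def of_rat_add of_rat_mult algebra_simps)
  show ?thesis unfolding * em_eq_iff using f by auto
qed

lemma OK_N_int: assumes "x \<in> OK" shows "\<exists>n::int. N x = of_int n"
  using assms by (elim OK_E) (metis N_Kint)

lemma K_fraction: assumes "x \<in> K" shows "\<exists>y\<in>OK. \<exists>n::int. n > 0 \<and> x = y / of_int n"
proof -
  obtain a b where y: "x = em a b" using assms K_E by blast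
  obtain u v where v: "v > 0" "a = of_int u / of_int v" by (rule rat_quotient_E)
  obtain u' v' where v': "v' > 0" "b = of_int u' / of_int v'" by (rule rat_quotient_E)
  have "x = (of_int (u * v') + of_int (u' * v) * s) / of_int (v * v')"
    using v(1) v'(1) unfolding y v(2) v'(2) by (simp add: em_def of_rat_divide field_simps)
  moreover have "v * v' > 0" using v v' by simp
  moreover have "of_int (u * v') + of_int (u' * v) * s \<in> OK" by (intro OK_add OK_mult OK_of_int OK_s)
  ultimately show ?thesis by blast
qed

end

subsection \<open>Primes and localisation\<close>

locale prime_over = quad_field +
  fixes P :: "complex set" and p :: int
  assumes prime_ideal: "prime_ideal_OK m P" and prime_p: "prime p" and p_in_P: "of_int p \<in> P"
begin

abbreviation L :: "complex set" where "L \<equiv> local_ring m P"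
abbreviation lu :: "complex \<Rightarrow> bool" where "lu \<equiv> local_unit m P"

lemma P_OK: "x \<in> P \<Longrightarrow> x \<in> OK" using prime_ideal by (auto simp: prime_ideal_OK_def)
lemma P_0 [simp]: "0 \<in> P" using prime_ideal by (auto simp: prime_ideal_OK_def)
lemma P_add: "x \<in> P \<Longrightarrow> y \<in> P \<Longrightarrow> x + y \<in> P" using prime_ideal by (auto simp: prime_ideal_OK_def)
lemma P_mult: "x \<in> P \<Longrightarrow> r \<in> OK \<Longrightarrow> r * x \<in> P" using prime_ideal by (auto simp: prime_ideal_OK_def)
lemma P_mult2: "x \<in> P \<Longrightarrow> r \<in> OK \<Longrightarrow> x * r \<in> P" by (subst mult.commute) (rule P_mult)
lemma P_diff: "x \<in> P \<Longrightarrow> y \<in> P \<Longrightarrow> x - y \<in> P" using P_add[of x "-1 * y"] P_mult[of y "-1"] by auto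
lemma P_prime: "x \<in> OK \<Longrightarrow> y \<in> OK \<Longrightarrow> x * y \<in> P \<Longrightarrow> x \<in> P \<or> y \<in> P"
  using prime_ideal by (auto simp: prime_ideal_OK_def)

lemma one_notin_P: "1 \<notin> P"
proof
  assume "1 \<in> P"
  then have "x \<in> P" if "x \<in> OK" for x using P_mult[of 1 x] that by simp
  then have "P = OK" using P_OK by blast
  then show False using prime_ideal by (auto simp: prime_ideal_OK_def)
qed

lemma P_power: "x \<in> OK \<Longrightarrow> x ^ n \<in> P \<Longrightarrow> x \<in> P"
  by (induction n) (use one_notin_P P_prime in auto)

lemma int_in_P: "of_int k \<in> P \<longleftrightarrow> p dvd k"
proof
  assume k: "of_int k \<in> P"
  show "p dvd k"
  proof (rule ccontr)
    assume "\<not> p dvd k"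
    then have "coprime p k" using prime_p prime_imp_coprime by blast
    then obtain u v where "u * p + v * k = 1" using bezout_int[of p k] by auto
    then have "of_int u * of_int p + of_int v * of_int k = (1::complex)" by (metis of_int_1 of_int_add of_int_mult)
    then show False using P_add[OF P_mult[OF p_in_P, of "of_int u"] P_mult[OF k, of "of_int v"]] one_notin_P by simp
  qed
next
  assume "p dvd k" then show "of_int k \<in> P" using P_mult[OF p_in_P] by (auto simp: mult.commute)
qed

lemma L_iff: "x \<in> L \<longleftrightarrow> (\<exists>y\<in>OK. \<exists>t\<in>OK. t \<notin> P \<and> x = y / t)"
proof
  assume "x \<in> L"
  then obtain t where t: "t \<in> OK" "t \<notin> P" "t * x \<in> OK" by (auto simp: local_ring_def)
  then have "x = (t * x) / t" by auto
  then show "\<exists>y\<in>OK. \<exists>t\<in>OK. t \<notin> P \<and> x = y / t" using t by blast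
next
  assume "\<exists>y\<in>OK. \<exists>t\<in>OK. t \<notin> P \<and> x = y / t"
  then obtain y t where yt: "y \<in> OK" "t \<in> OK" "t \<notin> P" "x = y / t" by blast
  moreover have "t \<noteq> 0" using yt(3) P_0 by blast
  ultimately have "t * x = y" by auto
  moreover have "x \<in> K" unfolding yt(4) using yt(1,2) by (intro K_divide OK_K)
  ultimately show "x \<in> L" unfolding local_ring_def using yt(1,2,3) by blast
qed

lemma L_E:
  assumes "x \<in> L" obtains y t where "y \<in> OK" "t \<in> OK" "t \<notin> P" "t \<noteq> 0" "x = y / t"
  using assms L_iff P_0 by metis

lemma L_K: "x \<in> L \<Longrightarrow> x \<in> K" by (simp add: local_ring_def)
lemma OK_L [simp, intro]: "x \<in> OK \<Longrightarrow> x \<in> L" using L_iff one_notin_P by (metis div_by_1 OK_01(2))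

lemma notin_P_mult: "x \<in> OK \<Longrightarrow> y \<in> OK \<Longrightarrow> x \<notin> P \<Longrightarrow> y \<notin> P \<Longrightarrow> x * y \<notin> P"
  using P_prime by blast

lemma L_add [simp, intro]: assumes "x \<in> L" "y \<in> L" shows "x + y \<in> L"
proof -
  obtain a b c d where h: "a \<in> OK" "b \<in> OK" "b \<notin> P" "b \<noteq> 0" "x = a / b"
    "c \<in> OK" "d \<in> OK" "d \<notin> P" "d \<noteq> 0" "y = c / d" using assms L_E by metis
  have "x + y = (a * d + c * b) / (b * d)" using h by (simp add: field_simps)
  moreover have "b * d \<notin> P" using h notin_P_mult by blast
  ultimately show ?thesis using h L_iff by blast
qed

lemma L_mult [simp, intro]: assumes "x \<in> L" "y \<in> L" shows "x * y \<in> L"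
proof -
  obtain a b c d where h: "a \<in> OK" "b \<in> OK" "b \<notin> P" "b \<noteq> 0" "x = a / b"
    "c \<in> OK" "d \<in> OK" "d \<notin> P" "d \<noteq> 0" "y = c / d" using assms L_E by metis
  have "x * y = (a * c) / (b * d)" using h by (simp add: field_simps)
  moreover have "b * d \<notin> P" using h notin_P_mult by blast
  ultimately show ?thesis using h L_iff by blast
qed

lemma L_of_int [simp]: "of_int a \<in> L" by simp
lemma L_numeral [simp]: "numeral a \<in> L" by simp
lemma L_01 [simp]: "0 \<in> L" "1 \<in> L" by auto
lemma L_uminus [simp, intro]: assumes "x \<in> L" shows "- x \<in> L"
  using L_mult[OF L_of_int[of "-1"] assms] by simp
lemma L_diff [simp, intro]: "x \<in> L \<Longrightarrow> y \<in> L \<Longrightarrow> x - y \<in> L" using L_add[of x "-y"] by simp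
lemma L_power [simp, intro]: "x \<in> L \<Longrightarrow> x ^ n \<in> L" by (induction n) auto

lemma lu_L: "lu x \<Longrightarrow> x \<in> L" by (simp add: local_unit_def)
lemma lu_0: "lu x \<Longrightarrow> x \<noteq> 0" by (simp add: local_unit_def)
lemma lu_inverse [simp, intro]: "lu x \<Longrightarrow> lu (inverse x)" by (simp add: local_unit_def)
lemma lu_mult [simp, intro]: "lu x \<Longrightarrow> lu y \<Longrightarrow> lu (x * y)" by (auto simp: local_unit_def)
lemma lu_divide [simp, intro]: "lu x \<Longrightarrow> lu y \<Longrightarrow> lu (x / y)" by (simp add: divide_inverse)
lemma lu_1 [simp]: "lu 1" by (simp add: local_unit_def)
lemma lu_power [simp, intro]: "lu x \<Longrightarrow> lu (x ^ n)" by (induction n) auto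
lemma L_divide [simp, intro]: "x \<in> L \<Longrightarrow> lu y \<Longrightarrow> x / y \<in> L"
  using L_mult[of x "inverse y"] unfolding divide_inverse local_unit_def by blast
declare lu_L [simp]

lemma lu_OK: "x \<in> OK \<Longrightarrow> x \<notin> P \<Longrightarrow> lu x"
  using L_iff[of "inverse x"] unfolding local_unit_def inverse_eq_divide by (metis OK_01(2) OK_L P_0)

lemma lu_fraction_iff:
  assumes "y \<in> OK" "t \<in> OK" "t \<notin> P" shows "lu (y / t) \<longleftrightarrow> y \<notin> P"
proof
  assume u: "lu (y / t)"
  show "y \<notin> P"
  proof
    assume y: "y \<in> P"
    have "inverse (y / t) \<in> L" using u unfolding local_unit_def by blast
    then obtain a b where ab: "a \<in> OK" "b \<in> OK" "b \<notin> P" "b \<noteq> 0" "inverse (y / t) = a / b" by (rule L_E)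
    then have "b * t = a * y" using lu_0[OF u] by (auto simp: field_simps)
    then have "b * t \<in> P" using P_mult[OF y ab(1)] by simp
    then show False using P_prime ab assms by blast
  qed
next
  assume "y \<notin> P" then show "lu (y / t)" using assms lu_OK by blast
qed

lemma lu_OK_iff: "x \<in> OK \<Longrightarrow> lu x \<longleftrightarrow> x \<notin> P"
  using lu_fraction_iff[of x 1] one_notin_P by simp

lemma lu_int: "lu (of_int k) \<longleftrightarrow> \<not> p dvd k" using lu_OK_iff int_in_P by simp

lemma not_lu_mult: assumes "x \<in> L" "\<not> lu x" "y \<in> L" shows "\<not> lu (x * y)"
proof
  assume u: "lu (x * y)"
  then have "x \<noteq> 0" using lu_0 by fastforce
  have "inverse x = y * inverse (x * y)" using lu_0[OF u] by simp
  also have "\<dots> \<in> L" by (rule L_mult[OF assms(3) lu_L[OF lu_inverse[OF u]]])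
  finally show False using assms \<open>x \<noteq> 0\<close> unfolding local_unit_def by blast
qed

lemma lu_of_mult: "x \<in> L \<Longrightarrow> y \<in> L \<Longrightarrow> lu (x * y) \<Longrightarrow> lu x" using not_lu_mult by blast

lemma lu_of_power: "x \<in> L \<Longrightarrow> n > 0 \<Longrightarrow> lu (x ^ n) \<Longrightarrow> lu x"
  using lu_of_mult[of x "x^(n-1)"] by (metis L_power power_minus_mult mult.commute)

text \<open>Together with \<open>not_lu_add\<close> this says that \<open>L\<close> is a local ring:
  its nonunits form an ideal.\<close>

lemma lu_add: assumes "lu x" "y \<in> L" "\<not> lu y" shows "lu (x + y)"
proof -
  obtain a b where h: "a \<in> OK" "b \<in> OK" "b \<notin> P" "b \<noteq> 0" "x = a / b" using lu_L[OF assms(1)] by (rule L_E)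
  obtain c d where h': "c \<in> OK" "d \<in> OK" "d \<notin> P" "d \<noteq> 0" "y = c / d" using assms(2) by (rule L_E)
  have "x + y = (a * d + c * b) / (b * d)" using h h' by (simp add: field_simps)
  moreover have "a \<notin> P" using assms(1) h lu_fraction_iff by blast
  moreover have "c \<in> P" using assms(3) h' lu_fraction_iff by blast
  ultimately have "a * d + c * b \<notin> P" "x + y = (a * d + c * b) / (b * d)"
    using P_diff[of "a * d + c * b" "c * b"] P_mult2[of c b] h h' notin_P_mult[of a d] by auto
  then show ?thesis using h h' lu_fraction_iff notin_P_mult by auto
qed

lemma not_lu_add: assumes "x \<in> L" "\<not> lu x" "y \<in> L" "\<not> lu y" shows "\<not> lu (x + y)"
proof
  assume "lu (x + y)"
  then have "lu ((x + y) + (- y))" using assms lu_add[of "x + y" "- y"] not_lu_mult[of y "-1"] by auto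
  then show False using assms by simp
qed

lemma lu_1_add: assumes "p dvd k" "e \<in> L" shows "lu (1 + of_int k * e)"
  using lu_add[of 1 "of_int k * e"] not_lu_mult[of "of_int k" e] lu_int assms by auto

text \<open>The exit from \<open>L\<close> to divisibility in the integers. As \<open>p\<close> is a
  nonunit of \<open>L\<close>, a quotient by \<open>p\<close> that lies in \<open>L\<close> has its
  numerator in \<open>P\<close>; one factor \<open>p\<close> is peeled off at a time.\<close>

lemma int_fraction_in_L:
  assumes "of_int n / of_int p ^ k \<in> L" shows "p ^ k dvd n"
  using assms
proof (induction k arbitrary: n)
  case (Suc k)
  have p0: "of_int p \<noteq> (0::complex)" using prime_p by auto
  have "of_int n / of_int p ^ k = (of_int p * (of_int n / of_int p ^ Suc k) :: complex)" using p0 by simp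
  also have "\<dots> \<in> L" using Suc.prems by (intro L_mult) auto
  finally have "p ^ k dvd n" using Suc.IH by blast
  then obtain n' where n: "n = p ^ k * n'" by auto
  have "of_int n / of_int p ^ Suc k = of_int n' / (of_int p :: complex)" using p0 by (simp add: n)
  then have "of_int n' / of_int p \<in> L" using Suc.prems by simp
  then have "\<not> lu (of_int n')"
    using not_lu_mult[of "of_int p" "of_int n' / of_int p"] lu_int[of p] p0 by simp
  then have "p dvd n'" using lu_int by blast
  then show ?case using n by (simp add: mult.commute mult_dvd_mono)
qed simp

lemma rat_in_L: assumes "of_rat r \<in> L" shows "\<exists>a b. \<not> p dvd b \<and> r = of_int a / of_int b"
proof -
  obtain u v where v: "v > 0" and cop: "coprime u v" and r: "r = of_int u / of_int v" by (rule rat_quotient_E)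
  have "\<not> p dvd v"
  proof
    assume "p dvd v"
    then obtain v' where v': "v = p * v'" by auto
    have "of_int u / of_int p ^ 1 = of_int v' * (of_rat r :: complex)"
      using r v v' by (auto simp: of_rat_divide of_rat_mult)
    also have "\<dots> \<in> L" using assms by (intro L_mult) auto
    finally have "p dvd u" using int_fraction_in_L[of u 1] by simp
    then show False using cop v' prime_p by (metis coprime_common_divisor dvd_triv_left not_prime_unit)
  qed
  then show ?thesis using r by blast
qed

text \<open>Says that \<open>p\<close> itself generates the maximal ideal of \<open>L\<close>, that
  is, \<open>P\<close> has ramification index 1 over \<open>p\<close>.\<close>

definition unram :: bool where "unram \<longleftrightarrow> (\<forall>x\<in>L. lu x \<or> x / of_int p \<in> L)"

lemma unram_E:
  assumes unram "x \<in> L" "\<not> lu x" obtains y where "y \<in> L" "x = of_int p * y"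
proof -
  have "x / of_int p \<in> L" using assms by (auto simp: unram_def)
  moreover have "x = of_int p * (x / of_int p)" using prime_p by auto
  ultimately show ?thesis using that by blast
qed

text \<open>The norm bounds the exponent: if \<open>p^k\<close> divides \<open>y\<close> in
  \<open>L\<close>, it divides the nonzero integer \<open>N y\<close>. At the largest such
  \<open>k\<close> the quotient is a unit, since otherwise \<open>unram\<close> would remove one
  more factor \<open>p\<close>.\<close>

lemma unram_lu_OK:
  assumes unram "y \<in> OK" "y \<noteq> 0" shows "\<exists>k::nat. lu (y / of_int p ^ k)"
proof -
  have p0: "of_int p \<noteq> (0::complex)" using prime_p by auto
  obtain n where n: "N y = of_int n" using OK_N_int assms(2) by blast
  have n0: "n \<noteq> 0" using N_0_iff[of y] n assms by auto
  have "(of_rat (N y) :: complex) = y * cj y" using N_cj assms by blast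
  then have nn: "of_int n = y * cj y" by (simp add: n)
  have bound: "k \<le> nat \<bar>n\<bar>" if "y / of_int p ^ k \<in> L" for k
  proof -
    have "of_int n / of_int p ^ k = cj y * (y / of_int p ^ k)" by (simp add: nn)
    also have "\<dots> \<in> L" using that assms by (intro L_mult) auto
    finally have "p ^ k dvd n" using int_fraction_in_L by blast
    then have "p ^ k \<le> \<bar>n\<bar>" using dvd_imp_le_int[OF n0] abs_ge_self order_trans by blast
    moreover have "2 ^ k \<le> p ^ k" using prime_p prime_ge_2_int by (intro power_mono) auto
    moreover have "int k < 2 ^ k" by (rule of_nat_less_two_power)
    ultimately show ?thesis by linarith
  qed
  define k where "k = Max {k. y / of_int p ^ k \<in> L}"
  have fin: "finite {k. y / of_int p ^ k \<in> L}" using bound by (auto intro: finite_subset[of _ "{..nat \<bar>n\<bar>}"])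
  have "0 \<in> {k. y / of_int p ^ k \<in> L}" using assms by simp
  then have k: "y / of_int p ^ k \<in> L" using Max_in[OF fin] k_def by blast
  have "y / of_int p ^ Suc k \<notin> L" using Max_ge[OF fin, of "Suc k"] k_def by auto
  then have "y / of_int p ^ k / of_int p \<notin> L" by (simp add: mult.commute)
  then show ?thesis using k assms(1) unram_def by blast
qed

text \<open>The exponent \<open>k\<close> is the valuation of \<open>x\<close> at \<open>P\<close>;
  it is an integer because \<open>x\<close> is any nonzero element of the field.\<close>

lemma unram_val:
  assumes unram "x \<in> K" "x \<noteq> 0" shows "\<exists>k::int. lu (x / of_int p powi k)"
proof -
  have p0: "of_int p \<noteq> (0::complex)" using prime_p by auto
  obtain y n where y: "y \<in> OK" "n > 0" "x = y / of_int n" using K_fraction assms(2) by blast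
  obtain i where i: "lu (y / of_int p ^ i)" using unram_lu_OK[OF assms(1) y(1)] y assms by auto
  obtain j where j: "lu (of_int n / of_int p ^ j)" using unram_lu_OK[OF assms(1), of "of_int n"] y by auto
  have "x / of_int p powi (int i - int j) = (y / of_int p ^ i) / (of_int n / of_int p ^ j)"
    using y p0 by (simp add: power_int_diff field_simps)
  then show ?thesis using lu_divide[OF i j] by metis
qed

end

section \<open>Primes above a rational prime\<close>

context quad_field
begin

text \<open>The norm of a nonzero element of \<open>P\<close> is a nonzero integer in
  \<open>P\<close>, and primality of \<open>P\<close> puts one of its prime factors into
  \<open>P\<close>.\<close>

lemma prime_over_exists_of_ideal:
  assumes "prime_ideal_OK m P" shows "\<exists>p. prime_over m P p"
proof -
  have one: "1 \<notin> P" and P: "\<And>x r. x \<in> P \<Longrightarrow> r \<in> OK \<Longrightarrow> r * x \<in> P" "\<And>x. x \<in> P \<Longrightarrow> x \<in> OK" "P \<noteq> {0}" "0 \<in> P"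
    "\<And>x y. x \<in> OK \<Longrightarrow> y \<in> OK \<Longrightarrow> x * y \<in> P \<Longrightarrow> x \<in> P \<or> y \<in> P"
  proof -
    show "1 \<notin> P"
    proof
      assume "1 \<in> P"
      then have "x \<in> P" if "x \<in> OK" for x using assms that by (metis mult.right_neutral prime_ideal_OK_def)
      then show False using assms unfolding prime_ideal_OK_def by blast
    qed
  qed (use assms in \<open>auto simp: prime_ideal_OK_def\<close>)
  obtain x where x: "x \<in> P" "x \<noteq> 0" using P(3,4) by blast
  obtain n where n: "N x = of_int n" using OK_N_int P(2) x by blast
  have "(of_rat (N x) :: complex) = cj x * x" using N_cj P(2) x by (simp add: mult.commute)
  then have "of_int n \<in> P" using P(1)[of x "cj x"] P(2) x n by simp
  moreover have "n \<noteq> 0" using N_0_iff[of x] n x P(2) by auto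
  ultimately have "\<exists>p. prime p \<and> of_int p \<in> P"
  proof (induction "nat \<bar>n\<bar>" arbitrary: n rule: less_induct)
    case less
    have "\<not> is_unit n"
    proof
      assume "is_unit n"
      then have "n = 1 \<or> n = -1" by (auto simp: abs_if split: if_splits)
      then have "of_int n * of_int n \<in> P \<and> of_int n * of_int n = (1::complex)"
        using P(1)[OF less.prems(1), of "of_int n"] by auto
      then show False using one by metis
    qed
    then obtain q where q: "prime q" "q dvd n" using less.prems(2) prime_divisor_exists[of n] by auto
    then obtain k where k: "n = q * k" by auto
    then have "of_int q \<in> P \<or> of_int k \<in> P" using P(5)[of "of_int q" "of_int k"] less.prems by simp
    then show ?case
    proof
      assume kP: "of_int k \<in> P"
      have "k \<noteq> 0" using less.prems k by auto
      have "q > 1" using q(1) prime_gt_1_int by blast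
      then have "\<bar>k\<bar> < \<bar>n\<bar>" using k \<open>k \<noteq> 0\<close> by (simp add: abs_mult)
      then show ?case using less.hyps[of k] kP \<open>k \<noteq> 0\<close> by (metis nat_less_eq_zless abs_ge_zero)
    qed (use q in blast)
  qed
  then obtain p where p: "prime p" "of_int p \<in> P" by blast
  then show ?thesis using assms by (intro exI[of _ p]) (unfold_locales, auto)
qed

lemma om_mult:
  "(of_int a + of_int b * om) * (of_int c + of_int d * om) =
   of_int (a * c - b * d * nu) + of_int (a * d + b * c + b * d * tau) * om"
proof -
  have "(of_int a + of_int b * om) * (of_int c + of_int d * om)
      = of_int (a * c) + of_int (a * d + b * c) * om + of_int (b * d) * om^2"
    by (simp add: algebra_simps power2_eq_square)
  then show ?thesis unfolding om2 by (simp add: algebra_simps)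
qed

definition disc_K :: int where "disc_K = tau^2 - 4 * nu"

lemma disc_K_eq: "disc_K = (if m mod 4 = 1 then m else 4 * m)"
proof (cases "m mod 4 = 1")
  case True
  then have "4 dvd 1 - m" by presburger
  then show ?thesis using True by (simp add: disc_K_def tau_def nu_def)
qed (simp add: disc_K_def tau_def nu_def)

text \<open>\<open>P\<close> is the kernel of the homomorphism from \<open>OK\<close> to the
  integers modulo \<open>p\<close> that sends \<open>om\<close> to the root \<open>r\<close>. Modulo
  \<open>p\<close> the discriminant is \<open>(2 r - tau)^2\<close>, so \<open>p\<close> divides it
  exactly if \<open>r\<close> is a double root. A double root is its own conjugate, which makes
  \<open>P\<close> stable; a simple root makes \<open>p\<close> a uniformiser.\<close>

lemma prime_exists_root:
  assumes p: "prime p" and r: "p dvd r^2 - tau * r + nu"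
  shows "\<exists>P. prime_over m P p \<and> (\<not> p dvd disc_K \<longrightarrow> prime_over.unram m P p) \<and>
     (p dvd disc_K \<longrightarrow> (\<forall>x\<in>P. cj x \<in> P)) \<and> (\<forall>x\<in>OK. \<exists>k::int. x - of_int k \<in> P)"
proof -
  define P where "P = {x. \<exists>a b::int. x = of_int a + of_int b * om \<and> p dvd a + b * r}"
  have mem: "of_int a + of_int b * om \<in> P \<longleftrightarrow> p dvd a + b * r" for a b
    unfolding P_def using om_int_eq_iff by auto
  have memi: "of_int a \<in> P \<longleftrightarrow> p dvd a" for a using mem[of a 0] by simp
  have prodm: "(of_int a + of_int b * om) * (of_int c + of_int d * om) \<in> P \<longleftrightarrow> p dvd (a + b * r) * (c + d * r)" for a b c d
  proof -
    have "(a * c - b * d * nu) + (a * d + b * c + b * d * tau) * r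
        = (a + b * r) * (c + d * r) - b * d * (r^2 - tau * r + nu)"
      by (simp add: power2_eq_square algebra_simps)
    moreover have "p dvd b * d * (r^2 - tau * r + nu)" using r by simp
    ultimately show ?thesis unfolding om_mult mem by (metis diff_add_cancel dvd_add dvd_diff)
  qed
  have ideal: "prime_ideal_OK m P"
    unfolding prime_ideal_OK_def
  proof (intro conjI ballI impI)
    show "P \<subseteq> OK" unfolding P_def using OK_iff by blast
    show "0 \<in> P" using memi[of 0] by simp
    show "x + y \<in> P" if xy: "x \<in> P" "y \<in> P" for x y
    proof -
      obtain a b c d :: int where h: "x = of_int a + of_int b * om" "p dvd a + b * r"
        "y = of_int c + of_int d * om" "p dvd c + d * r" using xy unfolding P_def by blast
      have "x + y = of_int (a + c) + of_int (b + d) * om" by (simp add: h algebra_simps)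
      moreover have "p dvd (a + c) + (b + d) * r" using dvd_add[OF h(2,4)] by (simp add: algebra_simps)
      ultimately show ?thesis using mem by metis
    qed
    show "z * x \<in> P" if xz: "x \<in> P" "z \<in> OK" for x z
    proof -
      obtain a b where h: "x = of_int a + of_int b * om" "p dvd a + b * r" using xz unfolding P_def by blast
      obtain c d where h': "z = of_int c + of_int d * om" using xz OK_E by blast
      show ?thesis unfolding h' h(1) prodm using h(2) by simp
    qed
    have "of_int p \<in> P" using memi by simp
    then show "P \<noteq> {0}" using p by auto
    have "1 \<notin> P" using memi[of 1] p by auto
    then show "P \<noteq> OK" by auto
    show "x \<in> P \<or> y \<in> P" if xy: "x \<in> OK" "y \<in> OK" "x * y \<in> P" for x y
    proof -
      obtain a b where h: "x = of_int a + of_int b * om" using xy OK_E by blast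
      obtain c d where h': "y = of_int c + of_int d * om" using xy OK_E by blast
      show ?thesis using xy(3) p unfolding h h' prodm mem by (simp add: prime_dvd_mult_iff)
    qed
  qed
  interpret prime_over m P p
    by unfold_locales (use ideal p memi in auto)
  have dsc: "(2 * r - tau)^2 = 4 * (r^2 - tau * r + nu) + disc_K"
    by (simp add: disc_K_def power2_eq_square algebra_simps)
  have dsc': "p dvd disc_K \<longleftrightarrow> p dvd 2 * r - tau"
  proof -
    have "p dvd disc_K \<longleftrightarrow> p dvd (2 * r - tau)^2" unfolding dsc using dvd_add_right_iff[OF dvd_mult[OF r, of 4], of disc_K] by blast
    then show ?thesis using prime_dvd_power_iff[OF p, of 2 "2 * r - tau"] by (metis zero_less_numeral)
  qed
  have "unram" if nd: "\<not> p dvd disc_K"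
    unfolding unram_def
  proof (intro ballI)
    fix x assume "x \<in> L"
    then obtain y t where yt: "y \<in> OK" "t \<in> OK" "t \<notin> P" "t \<noteq> 0" "x = y / t" using L_E by blast
    show "lu x \<or> x / of_int p \<in> L"
    proof (cases "y \<in> P")
      case True
      then obtain a b where h: "y = of_int a + of_int b * om" "p dvd a + b * r" unfolding P_def by blast
      obtain k where k: "a + b * r = p * k" using h by auto
      obtain j where j: "r^2 - tau * r + nu = p * j" using r by auto
      \<comment> \<open>\<open>g\<close> is \<open>om\<close> minus the other root
        \<open>tau - r\<close>. The product of \<open>om - r\<close> and \<open>g\<close> is a
        multiple of \<open>p\<close>, and \<open>g\<close> is a unit at \<open>P\<close> because it
        reduces to \<open>2 r - tau\<close>.\<close>
      define g where "g = of_int (r - tau) + of_int 1 * om"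
      have gP: "g \<notin> P" unfolding g_def mem using nd dsc' by (simp add: algebra_simps)
      have gO: "g \<in> OK" unfolding g_def by auto
      have g0: "g \<noteq> 0" using gP by auto
      have "(om - of_int r) * g = om^2 - of_int tau * om - of_int r * of_int r + of_int r * of_int tau"
        unfolding g_def by (simp add: algebra_simps power2_eq_square)
      also have "\<dots> = - of_int (r^2 - tau * r + nu)" unfolding om2 by (simp add: power2_eq_square)
      finally have gg: "(om - of_int r) * g = - (of_int p * of_int j)" unfolding j by simp
      have "y = of_int (a + b * r) + of_int b * (om - of_int r)" by (simp add: h algebra_simps)
      then have yk: "y = of_int p * of_int k + of_int b * (om - of_int r)" unfolding k by simp
      have "y * g = of_int p * (of_int k * g) + of_int b * ((om - of_int r) * g)"
        by (subst yk) (simp only: distrib_right mult.assoc)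
      then have "y * g = of_int p * (of_int k * g - of_int b * of_int j)" unfolding gg by (simp add: algebra_simps)
      then have "y / of_int p = (of_int k * g - of_int b * of_int j) / g" using g0 prime_p by (auto simp: field_simps)
      also have "\<dots> \<in> L" using gO gP lu_OK by (intro L_divide) auto
      finally have "(y / of_int p) / t \<in> L" by (rule L_divide[OF _ lu_OK[OF yt(2,3)]])
      then show ?thesis using yt by (simp add: mult.commute)
    qed (use yt lu_fraction_iff in blast)
  qed
  moreover have "cj x \<in> P" if d: "p dvd disc_K" and x: "x \<in> P" for x
  proof -
    obtain a b where h: "x = of_int a + of_int b * om" "p dvd a + b * r" using x unfolding P_def by blast
    have "cj x = of_int (a + b * tau) + of_int (- b) * om" by (simp add: h cj_add cj_mult cj_om algebra_simps)
    moreover have "a + b * tau + (- b) * r = (a + b * r) - b * (2 * r - tau)" by (simp add: algebra_simps)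
    moreover have "p dvd (a + b * r) - b * (2 * r - tau)" using h d dsc' by (intro dvd_diff) auto
    ultimately show ?thesis using mem by metis
  qed
  moreover have "\<exists>k::int. x - of_int k \<in> P" if x: "x \<in> OK" for x
  proof -
    obtain a b where h: "x = of_int a + of_int b * om" using x OK_E by blast
    have "x - of_int (a + b * r) = of_int (- b * r) + of_int b * om" by (simp add: h)
    also have "\<dots> \<in> P" unfolding mem by simp
    finally show ?thesis by blast
  qed
  ultimately show ?thesis using prime_over_axioms by blast
qed

text \<open>Without a root modulo \<open>p\<close> the norm form has no nontrivial zero modulo
  \<open>p\<close>. Hence an integer of norm divisible by \<open>p\<close> is itself divisible by
  \<open>p\<close>, and the ideal generated by \<open>p\<close> is prime.\<close>

lemma prime_exists_inert:
  assumes p: "prime p" and nr: "\<not> (\<exists>r. p dvd r^2 - tau * r + nu)"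
  shows "\<exists>P. prime_over m P p \<and> prime_over.unram m P p \<and> (\<forall>x\<in>P. cj x \<in> P) \<and>
     (\<forall>x\<in>P. \<exists>y\<in>OK. x = of_int p * y)"
proof -
  define P where "P = {x. \<exists>y\<in>OK. x = of_int p * y}"
  have mem: "of_int a + of_int b * om \<in> P \<longleftrightarrow> p dvd a \<and> p dvd b" for a b
  proof
    assume "of_int a + of_int b * om \<in> P"
    then obtain c d where "of_int a + of_int b * om = of_int p * (of_int c + of_int d * om)"
      unfolding P_def using OK_E by blast
    then have "of_int a + of_int b * om = of_int (p * c) + of_int (p * d) * om" by (simp add: algebra_simps)
    then show "p dvd a \<and> p dvd b" unfolding om_int_eq_iff by auto
  next
    assume "p dvd a \<and> p dvd b"
    then obtain c d where "a = p * c" "b = p * d" by (meson dvdE)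
    then have "of_int a + of_int b * om = of_int p * (of_int c + of_int d * om)" by (simp add: algebra_simps)
    moreover have "of_int c + of_int d * om \<in> OK" by simp
    ultimately show "of_int a + of_int b * om \<in> P" unfolding P_def by (intro CollectI) (rule bexI)
  qed
  have memi: "of_int a \<in> P \<longleftrightarrow> p dvd a" for a using mem[of a 0] by simp
  have norm_dvd: "x \<in> P" if x: "x \<in> OK" and n: "N x = of_int n" "p dvd n" for x n
  proof -
    obtain a b where h: "x = of_int a + of_int b * om" using x OK_E by blast
    have "n = a^2 + tau * a * b + nu * b^2" using n(1) unfolding h N_Kint by (simp only: of_int_eq_iff)
    then have d: "p dvd a^2 + tau * a * b + nu * b^2" using n by simp
    have pb: "p dvd b"
    proof (rule ccontr)
      assume "\<not> p dvd b"
      then have "coprime b p" using p prime_imp_coprime coprime_commute by blast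
      then obtain c where c: "[b * c = 1] (mod p)" using cong_solve_coprime_int by blast
      then have c': "p dvd b * c - 1" by (simp add: cong_iff_dvd_diff)
      \<comment> \<open>This is \<open>- a / b\<close> modulo \<open>p\<close>, which would be a
        root of the minimal polynomial of \<open>om\<close>.\<close>
      define r where "r = - a * c"
      have "r^2 - tau * r + nu = (a^2 + tau * a * b + nu * b^2) * c^2 - (b * c - 1) * (tau * a * c + nu * (b * c + 1))"
        by (simp add: r_def power2_eq_square algebra_simps)
      also have "p dvd \<dots>" using d c' by (intro dvd_diff) auto
      finally show False using nr by blast
    qed
    have "a^2 = (a^2 + tau * a * b + nu * b^2) - b * (tau * a + nu * b)" by (simp add: power2_eq_square algebra_simps)
    also have "p dvd \<dots>" using d pb by (intro dvd_diff) auto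
    finally have "p dvd a" using p prime_dvd_power by blast
    then show ?thesis using mem pb h by blast
  qed
  have ideal: "prime_ideal_OK m P"
    unfolding prime_ideal_OK_def
  proof (intro conjI ballI impI)
    show "P \<subseteq> OK" unfolding P_def by auto
    show "0 \<in> P" using memi[of 0] by simp
    show "x + y \<in> P" if "x \<in> P" "y \<in> P" for x y
      using that unfolding P_def by (auto simp flip: distrib_left)
    show "z * x \<in> P" if "x \<in> P" "z \<in> OK" for x z
      using that unfolding P_def by (auto intro!: bexI[of _ "z * _"])
    have "of_int p \<in> P" using memi by simp
    then show "P \<noteq> {0}" using p by auto
    have "1 \<notin> P" using memi[of 1] p by auto
    then show "P \<noteq> OK" by auto
    show "x \<in> P \<or> y \<in> P" if xy: "x \<in> OK" "y \<in> OK" "x * y \<in> P" for x y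
    proof -
      obtain z where z: "z \<in> OK" "x * y = of_int p * z" using xy unfolding P_def by blast
      obtain a b c where n: "N x = of_int a" "N y = of_int b" "N z = of_int c" using OK_N_int xy z by metis
      have "N x * N y = of_int p^2 * N z" using z xy by (simp flip: N_mult) (simp add: N_mult)
      then have "of_int (a * b) = (of_int (p^2 * c) :: rat)" by (simp add: n)
      then have "a * b = p^2 * c" by (simp only: of_int_eq_iff)
      then have "p dvd a * b" by (simp add: power2_eq_square)
      then have "p dvd a \<or> p dvd b" using p prime_dvd_mult_iff by blast
      then show ?thesis using norm_dvd n xy by blast
    qed
  qed
  interpret prime_over m P p
    by unfold_locales (use ideal p memi in auto)
  have "unram"
    unfolding unram_def
  proof (intro ballI)
    fix x assume "x \<in> L"
    then obtain y t where yt: "y \<in> OK" "t \<in> OK" "t \<notin> P" "t \<noteq> 0" "x = y / t" using L_E by blast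
    show "lu x \<or> x / of_int p \<in> L"
    proof (cases "y \<in> P")
      case True
      then obtain z where z: "z \<in> OK" "y = of_int p * z" unfolding P_def by blast
      have "x / of_int p = z / t" using z yt prime_p by auto
      also have "\<dots> \<in> L" using z yt lu_OK by (intro L_divide) auto
      finally show ?thesis by blast
    qed (use yt lu_fraction_iff in blast)
  qed
  moreover have "cj x \<in> P" if "x \<in> P" for x
    using that unfolding P_def by (auto simp: cj_mult)
  moreover have "\<forall>x\<in>P. \<exists>y\<in>OK. x = of_int p * y" by (simp add: P_def)
  ultimately show ?thesis using prime_over_axioms by blast
qed

text \<open>The three alternatives are the ramified, the inert and the split case.\<close>

lemma prime_exists:
  assumes p: "prime p"
  shows "\<exists>P. prime_over m P p \<and>
     (p dvd disc_K \<and> (\<forall>x\<in>P. cj x \<in> P) \<or>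
      prime_over.unram m P p \<and> (\<forall>x\<in>P. cj x \<in> P) \<and> (\<forall>x\<in>P. \<exists>y\<in>OK. x = of_int p * y) \<or>
      \<not> p dvd disc_K \<and> prime_over.unram m P p \<and> (\<forall>x\<in>OK. \<exists>k::int. x - of_int k \<in> P))"
proof (cases "\<exists>r. p dvd r^2 - tau * r + nu")
  case True
  then show ?thesis using prime_exists_root[OF p] by metis
next
  case False
  then show ?thesis using prime_exists_inert[OF p] by metis
qed

text \<open>At a split prime the conjugate ideal is the second prime above \<open>p\<close>, and a
  norm involves both.\<close>

lemma prime_over_cj: assumes "prime_over m P p" shows "prime_over m (cj ` P) p"
proof -
  interpret prime_over m P p by fact
  have mem: "x \<in> cj ` P \<longleftrightarrow> x \<in> K \<and> cj x \<in> P" for x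
  proof
    assume "x \<in> cj ` P" then show "x \<in> K \<and> cj x \<in> P" using P_OK by auto
  next
    assume "x \<in> K \<and> cj x \<in> P"
    then have "x = cj (cj x)" "cj x \<in> P" by auto
    then show "x \<in> cj ` P" by blast
  qed
  have "prime_ideal_OK m (cj ` P)" unfolding prime_ideal_OK_def
  proof (intro conjI ballI impI)
    show "cj ` P \<subseteq> OK" using P_OK by auto
    show "0 \<in> cj ` P" by (simp add: mem)
    show "x + y \<in> cj ` P" if "x \<in> cj ` P" "y \<in> cj ` P" for x y using that unfolding mem by (auto simp: cj_add P_add)
    show "z * x \<in> cj ` P" if "x \<in> cj ` P" "z \<in> OK" for x z using that unfolding mem by (auto simp: cj_mult P_mult)
    have "of_int p \<in> cj ` P" using p_in_P by (simp add: mem)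
    then have "cj ` P = {0} \<Longrightarrow> of_int p = (0::complex)" by blast
    then show "cj ` P \<noteq> {0}" using prime_p by auto
    have "1 \<notin> cj ` P" using one_notin_P by (simp add: mem)
    then show "cj ` P \<noteq> OK" by auto
    show "x \<in> cj ` P \<or> y \<in> cj ` P" if "x \<in> OK" "y \<in> OK" "x * y \<in> cj ` P" for x y
      using that P_prime[of "cj x" "cj y"] unfolding mem by (auto simp: cj_mult)
  qed
  moreover have "of_int p \<in> cj ` P" using p_in_P by (simp add: mem)
  ultimately show ?thesis using prime_p by unfold_locales auto
qed

end

subsection \<open>Weierstrass models\<close>

fun b2 :: "wcoeffs \<Rightarrow> complex" where "b2 (a1, a2, a3, a4, a6) = a1^2 + 4*a2"
fun b4 :: "wcoeffs \<Rightarrow> complex" where "b4 (a1, a2, a3, a4, a6) = 2*a4 + a1*a3"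
fun b6 :: "wcoeffs \<Rightarrow> complex" where "b6 (a1, a2, a3, a4, a6) = a3^2 + 4*a6"

definition c6 :: "wcoeffs \<Rightarrow> complex" where
  "c6 a = 36 * b2 a * b4 a - b2 a ^ 3 - 216 * b6 a"

lemma c4_altdef: "c4 a = b2 a ^ 2 - 24 * b4 a"
  by (cases a) (simp add: Let_def)

lemma disc_c4_c6: "1728 * disc a = c4 a ^ 3 - c6 a ^ 2"
proof (cases a)
  case (fields a1 a2 a3 a4 a6)
  define b8 where "b8 = a1^2*a6 + 4*a2*a6 - a1*a3*a4 + a2*a3^2 - a4^2"
  have b8: "4 * b8 = b2 a * b6 a - b4 a ^ 2"
    unfolding fields b8_def by (simp add: algebra_simps power2_eq_square)
  have "disc a = 9 * b2 a * b4 a * b6 a - b2 a ^ 2 * b8 - 8 * b4 a ^ 3 - 27 * b6 a ^ 2"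
    unfolding fields b8_def by (simp add: Let_def)
  then have "1728 * disc a = 1728 * (9 * b2 a * b4 a * b6 a - 8 * b4 a ^ 3 - 27 * b6 a ^ 2) - 432 * b2 a ^ 2 * (4 * b8)"
    by simp
  also have "\<dots> = c4 a ^ 3 - c6 a ^ 2"
    unfolding b8 c4_altdef c6_def by (simp add: algebra_simps power2_eq_square power3_eq_cube)
  finally show ?thesis .
qed

lemma b2_wchange: "u \<noteq> 0 \<Longrightarrow> u ^ 2 * b2 (wchange u r s t a) = b2 a + 12 * r"
  by (cases a) (simp add: power_divide field_simps power2_eq_square)

lemma b4_wchange: "u \<noteq> 0 \<Longrightarrow> u ^ 4 * b4 (wchange u r s t a) = b4 a + r * b2 a + 6 * r^2"
  by (cases a) (simp add: field_simps power2_eq_square numeral_eq_Suc)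

lemma b6_wchange: "u \<noteq> 0 \<Longrightarrow> u ^ 6 * b6 (wchange u r s t a) = b6 a + 2 * r * b4 a + r^2 * b2 a + 4 * r^3"
  by (cases a) (simp add: field_simps power2_eq_square numeral_eq_Suc)

lemma c4_wchange: assumes "u \<noteq> 0" shows "u ^ 4 * c4 (wchange u r s t a) = c4 a"
proof -
  let ?b = "wchange u r s t a"
  have "u ^ 4 * c4 ?b = (u ^ 2 * b2 ?b) ^ 2 - 24 * (u ^ 4 * b4 ?b)"
    unfolding c4_altdef by (simp add: algebra_simps flip: power_mult)
  then show ?thesis unfolding b2_wchange[OF assms] b4_wchange[OF assms] c4_altdef
    by (simp add: algebra_simps power2_eq_square)
qed

lemma c6_wchange: assumes "u \<noteq> 0" shows "u ^ 6 * c6 (wchange u r s t a) = c6 a"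
proof -
  let ?b = "wchange u r s t a"
  have "u ^ 6 * c6 ?b = 36 * (u ^ 2 * b2 ?b) * (u ^ 4 * b4 ?b) - (u ^ 2 * b2 ?b) ^ 3 - 216 * (u ^ 6 * b6 ?b)"
    unfolding c6_def by (simp add: algebra_simps flip: power_mult power_add)
  then show ?thesis unfolding b2_wchange[OF assms] b4_wchange[OF assms] b6_wchange[OF assms] c6_def
    by (simp add: algebra_simps power2_eq_square power3_eq_cube)
qed

lemma disc_wchange: assumes "u \<noteq> 0" shows "u ^ 12 * disc (wchange u r s t a) = disc a"
proof -
  let ?b = "wchange u r s t a"
  have "1728 * (u ^ 12 * disc ?b) = u ^ 12 * (c4 ?b ^ 3 - c6 ?b ^ 2)" by (simp flip: disc_c4_c6)
  also have "\<dots> = (u ^ 4 * c4 ?b) ^ 3 - (u ^ 6 * c6 ?b) ^ 2" by (simp add: power_mult_distrib algebra_simps flip: power_mult)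
  also have "\<dots> = 1728 * disc a" unfolding c4_wchange[OF assms] c6_wchange[OF assms] disc_c4_c6 ..
  finally show ?thesis by simp
qed

text \<open>The equation \<open>y^2 = x^3 - (C/48) x - D/864\<close>; the constants are those that
  give it the invariants \<open>c4 = C\<close> and \<open>c6 = D\<close>.\<close>

definition short_curve :: "complex \<Rightarrow> complex \<Rightarrow> wcoeffs" where
  "short_curve C D = (0, 0, 0, - C / 48, - D / 864)"

lemma c4_short [simp]: "c4 (short_curve C D) = C" by (simp add: short_curve_def)
lemma c6_short [simp]: "c6 (short_curve C D) = D" by (simp add: short_curve_def c6_def)

text \<open>Undoes completing the square and the cube. Every equation is therefore a change of
  variables of the short one with the same invariants, up to the weights \<open>u^4\<close> and
  \<open>u^6\<close>.\<close>

lemma wchange_short_curve: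
  assumes u: "u \<noteq> 0"
  shows "wchange u (u^2 * (4 * a2 + a1^2) / 12) (u * a1 / 2) (u^3 * a3 / 2)
    (short_curve (u^4 * c4 (a1, a2, a3, a4, a6)) (u^6 * c6 (a1, a2, a3, a4, a6))) = (a1, a2, a3, a4, a6)"
proof -
  let ?s = "a1 / 2" and ?r = "(4 * a2 + a1^2) / 12" and ?t = "a3 / 2"
  let ?C = "c4 (a1, a2, a3, a4, a6)" and ?D = "c6 (a1, a2, a3, a4, a6)"
  have "wchange u (u^2 * ?r) (u * ?s) (u^3 * ?t) (short_curve (u^4 * ?C) (u^6 * ?D)) = wchange 1 ?r ?s ?t (short_curve ?C ?D)"
    using u unfolding short_curve_def by (simp add: field_simps power2_eq_square numeral_eq_Suc)
  also have "\<dots> = (a1, a2, a3, a4, a6)"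
    unfolding short_curve_def c6_def by (simp add: Let_def field_simps power2_eq_square power3_eq_cube)
  finally show ?thesis by simp
qed

context prime_over
begin

text \<open>Good reduction at \<open>P\<close> thus depends on the invariants alone: it suffices to
  exhibit some equation over \<open>L\<close> with unit discriminant whose \<open>c4\<close> and
  \<open>c6\<close> match up to scaling by \<open>u\<close>.\<close>

lemma good_reduction_short:
  assumes u: "u \<in> K" "u \<noteq> 0" and a: "coeffs_in L a" and C: "u^4 * c4 a = C" and D: "u^6 * c6 a = D"
    and d: "lu (disc a)"
  shows "good_reduction_at m P (short_curve C D)"
proof -
  obtain a1 a2 a3 a4 a6 where e: "a = (a1, a2, a3, a4, a6)" by (cases a) auto
  have aK: "a1 \<in> K" "a2 \<in> K" "a3 \<in> K" using a L_K unfolding e by auto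
  have "wchange u (u^2 * (4 * a2 + a1^2) / 12) (u * a1 / 2) (u^3 * a3 / 2) (short_curve C D) = a"
    using wchange_short_curve[OF u(2)] C D unfolding e by blast
  moreover have "u^2 * (4 * a2 + a1^2) / 12 \<in> K" "u * a1 / 2 \<in> K" "u^3 * a3 / 2 \<in> K"
    using aK u by (auto intro!: K_divide K_mult K_add K_power)
  ultimately show ?thesis unfolding good_reduction_at_def using a d u
    by (intro exI[of _ u] exI[of _ "u^2 * (4 * a2 + a1^2) / 12"] exI[of _ "u * a1 / 2"] exI[of _ "u^3 * a3 / 2"]) simp
qed

lemma common_denominator:
  assumes "x \<in> L" "t \<in> OK" "t \<notin> P" shows "\<exists>r\<in>OK. t * r \<notin> P \<and> t * r * x \<in> OK"
proof -
  obtain y r where yr: "y \<in> OK" "r \<in> OK" "r \<notin> P" "r \<noteq> 0" "x = y / r" using assms(1) L_E by blast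
  then have "t * r * x = t * y" by simp
  then show ?thesis using yr assms notin_P_mult[of t r] by (intro bexI[of _ r]) auto
qed

text \<open>A factor \<open>k\<close> outside \<open>P\<close> clears all denominators and stays a
  unit at \<open>P\<close>, so the discriminant stays outside \<open>P\<close>. Coefficients in
  \<open>OK\<close> rather than in \<open>L\<close> are wanted because their norms are then
  integers.\<close>

lemma integral_model:
  assumes g: "good_reduction_at m P a"
  shows "\<exists>v a'. v \<in> K \<and> v \<noteq> 0 \<and> coeffs_in OK a' \<and> disc a' \<in> OK \<and> disc a' \<notin> P \<and>
     c4 a = v^4 * c4 a' \<and> c6 a = v^6 * c6 a' \<and> disc a = v^12 * disc a'"
proof -
  obtain u r s t where h: "u \<in> K" "u \<noteq> 0" "coeffs_in L (wchange u r s t a)" "lu (disc (wchange u r s t a))"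
    using g unfolding good_reduction_at_def by blast
  obtain a1 a2 a3 a4 a6 where e: "wchange u r s t a = (a1, a2, a3, a4, a6)" by (metis prod_cases5)
  have aL: "a1 \<in> L" "a2 \<in> L" "a3 \<in> L" "a4 \<in> L" "a6 \<in> L" using h(3) unfolding e by auto
  obtain r1 where r1: "r1 \<in> OK" "r1 \<notin> P" "r1 * a1 \<in> OK" using common_denominator[OF aL(1), of 1] one_notin_P by auto
  obtain r2 where r2: "r2 \<in> OK" "r1 * r2 \<notin> P" "r1 * r2 * a2 \<in> OK" using common_denominator[OF aL(2)] r1 by blast
  obtain r3 where r3: "r3 \<in> OK" "r1 * r2 * r3 \<notin> P" "r1 * r2 * r3 * a3 \<in> OK"
    using common_denominator[OF aL(3), of "r1 * r2"] r1 r2 by blast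
  obtain r4 where r4: "r4 \<in> OK" "r1 * r2 * r3 * r4 \<notin> P" "r1 * r2 * r3 * r4 * a4 \<in> OK"
    using common_denominator[OF aL(4), of "r1 * r2 * r3"] r1 r2 r3 by blast
  obtain r6 where r6: "r6 \<in> OK" "r1 * r2 * r3 * r4 * r6 \<notin> P" "r1 * r2 * r3 * r4 * r6 * a6 \<in> OK"
    using common_denominator[OF aL(5), of "r1 * r2 * r3 * r4"] r1 r2 r3 r4 by blast
  define k where "k = r1 * r2 * r3 * r4 * r6"
  have kO: "k \<in> OK" and kP: "k \<notin> P" unfolding k_def using r1 r2 r3 r4 r6 by auto
  have k0: "k \<noteq> 0" using kP by auto
  have "k * a1 = (r2 * r3 * r4 * r6) * (r1 * a1)" "k * a2 = (r3 * r4 * r6) * (r1 * r2 * a2)"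
    "k * a3 = (r4 * r6) * (r1 * r2 * r3 * a3)" "k * a4 = r6 * (r1 * r2 * r3 * r4 * a4)"
    "k * a6 = r1 * r2 * r3 * r4 * r6 * a6" unfolding k_def by (simp_all add: mult_ac)
  moreover have "(r2 * r3 * r4 * r6) * (r1 * a1) \<in> OK" "(r3 * r4 * r6) * (r1 * r2 * a2) \<in> OK"
    "(r4 * r6) * (r1 * r2 * r3 * a3) \<in> OK" "r6 * (r1 * r2 * r3 * r4 * a4) \<in> OK"
    by (intro OK_mult[OF _ r1(3)] OK_mult[OF _ r2(3)] OK_mult[OF _ r3(3)] OK_mult[OF _ r4(3)] OK_mult r1 r2 r3 r4 r6)+
  ultimately have ka: "k * a1 \<in> OK" "k * a2 \<in> OK" "k * a3 \<in> OK" "k * a4 \<in> OK" "k * a6 \<in> OK"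
    using r6(3) by metis+
  \<comment> \<open>The coefficient \<open>a_i\<close> is multiplied by \<open>k^i\<close>, the
    scaling with \<open>u = 1 / k\<close>; one of the factors \<open>k\<close> makes it
    integral.\<close>
  define a' where "a' = (k * a1, k * (k * a2), k^2 * (k * a3), k^3 * (k * a4), k^5 * (k * a6))"
  have coeff: "coeffs_in OK a'" unfolding a'_def using ka kO by auto
  have a'w: "a' = wchange (1 / k) 0 0 0 (a1, a2, a3, a4, a6)"
    unfolding a'_def using k0 by (simp add: field_simps numeral_eq_Suc)
  let ?v = "u / k"
  have k1: "1 / k \<noteq> 0" using k0 by simp
  note w = c4_wchange[OF k1, of 0 0 0 "(a1, a2, a3, a4, a6)"] c6_wchange[OF k1, of 0 0 0 "(a1, a2, a3, a4, a6)"]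
    disc_wchange[OF k1, of 0 0 0 "(a1, a2, a3, a4, a6)"]
  note w' = w[folded a'w, folded e]
  have "c4 a = ?v^4 * c4 a'" "c6 a = ?v^6 * c6 a'" "disc a = ?v^12 * disc a'"
    unfolding c4_wchange[OF h(2), of r s t a, symmetric] c6_wchange[OF h(2), of r s t a, symmetric]
      disc_wchange[OF h(2), of r s t a, symmetric] w'[symmetric] by (simp_all add: power_divide)
  moreover have "disc a' \<in> OK"
  proof -
    obtain b1 b2 b3 b4 b6 where "a' = (b1, b2, b3, b4, b6)" by (metis prod_cases5)
    then show ?thesis using coeff by (simp add: Let_def)
  qed
  moreover have "lu (disc a')"
  proof -
    have "disc a' = k ^ 12 * disc (wchange u r s t a)" using w'(3) k0 by (simp add: field_simps)
    then show ?thesis using h(4) lu_OK[OF kO kP] by simp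
  qed
  ultimately show ?thesis using lu_OK_iff h k0 kO coeff
    by (intro exI[of _ "?v"] exI[of _ a']) auto
qed

end

text \<open>For \<open>e = 1\<close> and \<open>D = - C\<close> this is the familiar curve
  \<open>y^2 + x y = x^3 - 36 x / (j - 1728) - 1 / (j - 1728)\<close>; in general it is the
  quadratic twist of that curve by \<open>- D / C\<close>, the value of \<open>b2\<close>. Apart
  from the 4 in \<open>a2\<close>, only powers of \<open>C\<close> occur in denominators, so the
  model is useful where \<open>c4\<close> is a unit.\<close>

lemma two_torsion_model:
  fixes e C D \<Delta> :: complex
  assumes C: "C \<noteq> 0" and \<Delta>: "1728 * \<Delta> = C^3 - D^2"
  defines "a \<equiv> (e, (- D / C - e^2) / 4, 0, - 36 * \<Delta> / C^2, D * \<Delta> / C^3)"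
  shows "c4 a = C" "c6 a = D"
proof -
  have b: "b2 a = - D / C" "b4 a = - 72 * \<Delta> / C^2" "b6 a = 4 * D * \<Delta> / C^3"
    unfolding a_def by (simp_all add: diff_divide_distrib)
  have "c4 a = (D^2 + 1728 * \<Delta>) / C^2" unfolding c4_altdef b by (simp add: power_divide add_divide_distrib)
  then show "c4 a = C" unfolding \<Delta> using C by (simp add: power2_eq_square power3_eq_cube)
  have "c6 a = D * (D^2 + 1728 * \<Delta>) / C^3" unfolding c6_def b using C
    by (simp add: field_simps power2_eq_square power3_eq_cube)
  then show "c6 a = D" unfolding \<Delta> using C by simp
qed

section \<open>Local models with prescribed invariants\<close>

context prime_over
begin

text \<open>The common shape of the local models: with \<open>c4 = A \<delta>\<close>,
  \<open>c6 = t \<mu>\<close> and \<open>\<mu>^2 = D \<delta>^3\<close>, the difference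
  \<open>c4^3 - c6^2\<close> is \<open>(A^3 - D t^2) \<delta>^3\<close>, which is
  \<open>1728 \<delta>^3\<close>. The discriminant is a unit as soon as \<delta> is.\<close>

lemma disc_of_invariants:
  assumes "c4 a = of_int A * \<delta>" "c6 a = of_int t * \<mu>" "\<mu>^2 = of_int D * \<delta>^3" "D * t^2 = A^3 - 1728"
  shows "disc a = \<delta>^3"
proof -
  have "of_int (D * t^2) = (of_int (A^3 - 1728) :: complex)" using assms(4) by simp
  then have *: "of_int D * of_int t^2 = (of_int A^3 - 1728 :: complex)" by simp
  have "1728 * disc a = of_int A^3 * \<delta>^3 - of_int t^2 * \<mu>^2"
    unfolding disc_c4_c6 assms(1,2) by (simp add: power_mult_distrib)
  also have "\<dots> = of_int A^3 * \<delta>^3 - (of_int D * of_int t^2) * \<delta>^3" unfolding assms(3) by simp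
  also have "\<dots> = 1728 * \<delta>^3" unfolding * by (simp add: algebra_simps)
  finally show ?thesis by simp
qed

text \<open>The denominators 48 and 864 of the short equation are units away from 2 and 3.\<close>

lemma model_p5:
  assumes p: "p \<noteq> 2" "p \<noteq> 3" and \<delta>: "lu \<delta>" "\<mu> \<in> L" "\<mu>^2 = of_int D * \<delta>^3" and E: "D * t^2 = A^3 - 1728"
  shows "\<exists>a. coeffs_in L a \<and> c4 a = of_int A * \<delta> \<and> c6 a = of_int t * \<mu> \<and> lu (disc a)"
proof -
  have "\<not> p dvd 2" "\<not> p dvd 3"
    using p prime_p primes_dvd_imp_eq[of p 2] primes_dvd_imp_eq[of p 3] by auto
  then have nd: "\<not> p dvd 2 ^ 4 * 3" "\<not> p dvd 2 ^ 5 * 3 ^ 3"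
    using prime_p prime_dvd_mult_iff prime_dvd_power by blast+
  have u: "lu 48" "lu 864" using nd lu_int[of 48] lu_int[of 864] by simp_all
  let ?a = "short_curve (of_int A * \<delta>) (of_int t * \<mu>)"
  have "coeffs_in L ?a" unfolding short_curve_def
    using u \<delta> by (auto intro!: L_divide L_uminus L_mult)
  moreover have "disc ?a = \<delta>^3" by (rule disc_of_invariants[OF _ _ \<delta>(3) E]) auto
  ultimately show ?thesis using \<delta>(1) by (intro exI[of _ ?a]) auto
qed

text \<open>If 3 divides \<open>A\<close>, then \<open>A\<close> and \<open>t\<close> supply the
  factors 3 and 27 of the denominators 48 and 864 of the short equation. Otherwise \<open>c4\<close>
  is a unit and \<open>two_torsion_model\<close> with \<open>e = 0\<close> is integral.\<close>

lemma model_p3: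
  assumes p: "p = 3" and \<delta>: "lu \<delta>" "\<mu> \<in> L" "\<mu>^2 = of_int D * \<delta>^3" and E: "D * t^2 = A^3 - 1728"
    and t: "3 dvd A \<Longrightarrow> 27 dvd t"
  shows "\<exists>a. coeffs_in L a \<and> c4 a = of_int A * \<delta> \<and> c6 a = of_int t * \<mu> \<and> lu (disc a)"
proof (cases "3 dvd A")
  case True
  then obtain A' t' where At: "A = 3 * A'" "t = 27 * t'" using t by (meson dvdE)
  let ?a = "(0, 0, 0, - (of_int A' * \<delta>) / 16, - (of_int t' * \<mu>) / 32) :: wcoeffs"
  have u: "lu 16" "lu 32" using lu_int[of 16] lu_int[of 32] p by simp_all
  have "coeffs_in L ?a" using u \<delta> by (auto intro!: L_divide L_uminus L_mult)
  moreover have c: "c4 ?a = of_int A * \<delta>" "c6 ?a = of_int t * \<mu>" by (simp_all add: At c6_def)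
  moreover have "disc ?a = \<delta>^3" by (rule disc_of_invariants[OF c \<delta>(3) E])
  ultimately show ?thesis using \<delta>(1) by (intro exI[of _ ?a]) auto
next
  case False
  define C Dd where "C = of_int A * \<delta>" and "Dd = of_int t * \<mu>"
  have C: "lu C" using False lu_int p \<delta> by (auto simp: C_def)
  have CD: "1728 * \<delta>^3 = C^3 - Dd^2"
  proof -
    have "of_int (D * t^2) = (of_int (A^3 - 1728) :: complex)" using E by simp
    then have *: "of_int D * of_int t^2 = (of_int A^3 - 1728 :: complex)" by simp
    have "C^3 - Dd^2 = of_int A^3 * \<delta>^3 - (of_int D * of_int t^2) * \<delta>^3"
      unfolding C_def Dd_def by (simp add: power_mult_distrib \<delta>(3))
    then show ?thesis unfolding * by (simp add: algebra_simps)
  qed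
  let ?a = "(0, (- Dd / C - 0^2) / 4, 0, - 36 * \<delta>^3 / C^2, Dd * \<delta>^3 / C^3) :: wcoeffs"
  have DL: "Dd \<in> L" using \<delta> by (auto simp: Dd_def)
  have u: "lu 4" using lu_int[of 4] p by simp
  have "coeffs_in L ?a" using u \<delta> C DL
    by (auto intro!: L_divide[OF _ u] L_divide[OF _ C] L_divide[OF _ lu_power[OF C]] L_uminus L_mult L_power)
  moreover have c: "c4 ?a = of_int A * \<delta>" "c6 ?a = of_int t * \<mu>"
    using two_torsion_model[OF lu_0[OF C] CD, of 0] unfolding C_def Dd_def by auto
  moreover have "disc ?a = \<delta>^3" by (rule disc_of_invariants[OF c \<delta>(3) E])
  ultimately show ?thesis using \<delta>(1) by (intro exI[of _ ?a]) auto
qed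

text \<open>Congruence to 1 modulo 4 in \<open>L\<close>. Adjoining the square root of such a unit
  is unramified above 2, so a quadratic twist by it keeps good reduction.\<close>

definition one4 :: "complex \<Rightarrow> bool" where "one4 x \<longleftrightarrow> (\<exists>y\<in>L. x = 1 + 4 * y)"

lemma one4_mult: assumes "one4 x" "one4 y" shows "one4 (x * y)"
proof -
  obtain a b where "a \<in> L" "b \<in> L" "x = 1 + 4 * a" "y = 1 + 4 * b" using assms by (auto simp: one4_def)
  then have "x * y = 1 + 4 * (a + b + 4 * a * b)" "a + b + 4 * a * b \<in> L" by (auto simp: algebra_simps)
  then show ?thesis unfolding one4_def by blast
qed

lemma one4_1: "one4 1" unfolding one4_def by (rule bexI[of _ 0]) auto

lemma one4_power: "one4 x \<Longrightarrow> one4 (x ^ n)" by (induction n) (auto simp: one4_1 one4_mult)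

lemma one4_L: "one4 x \<Longrightarrow> x \<in> L" by (auto simp: one4_def)

lemma one4_lu: "p = 2 \<Longrightarrow> one4 x \<Longrightarrow> lu x"
  using lu_1_add[of 4] by (auto simp: one4_def)

lemma one4_int: assumes "n mod 4 = 1" shows "one4 (of_int n)"
proof -
  obtain k where "n = 1 + 4 * k" using assms by (metis mult_div_mod_eq add.commute)
  then have "of_int n = 1 + 4 * (of_int k :: complex)" by simp
  then show ?thesis unfolding one4_def by (intro bexI[of _ "of_int k"]) simp_all
qed

text \<open>For odd \<open>A\<close>, both \<open>c4\<close> and \<open>- c6\<close> are 1 modulo 4,
  so \<open>a2 = (- c6 / c4 - 1) / 4\<close> in \<open>two_torsion_model\<close> with
  \<open>e = 1\<close> is integral. For \<open>A\<close> divisible by 16 the curve is supersingular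
  above 2 and takes the form \<open>y^2 + y = x^3 + a4 x + a6\<close>, whose \<open>c6\<close> is 8
  times an element that is 1 modulo 4.\<close>

lemma model_p2:
  assumes p: "p = 2" and \<phi>: "one4 \<phi>" and E: "D * t^2 = A^3 - 1728" and D: "odd D"
    and A: "odd A \<and> A * D mod 4 = 1 \<and> t mod 4 = 3 \<or> 16 dvd A \<and> 8 dvd t \<and> (t div 8) mod 4 = 1"
  shows "\<exists>a. coeffs_in L a \<and> c4 a = of_int A * (of_int D * \<phi>^2) \<and> c6 a = of_int t * (of_int D^2 * \<phi>^3) \<and> lu (disc a)"
proof -
  define \<delta> \<mu> where "\<delta> = of_int D * \<phi>^2" and "\<mu> = of_int D^2 * \<phi>^3"
  have \<phi>u: "lu \<phi>" using \<phi> p one4_lu by blast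
  have \<delta>: "lu \<delta>" using \<phi>u D lu_int p by (auto simp: \<delta>_def)
  have rel: "\<mu>^2 = of_int D * \<delta>^3" unfolding \<delta>_def \<mu>_def
    by (simp add: power_mult_distrib power2_eq_square power3_eq_cube)
  have "D^2 mod 4 = 1"
  proof -
    have "[D^2 = 1] (mod 4)" by (rule cong_dvd_modulus[OF odd_square_mod_8[OF D]]) simp
    then show ?thesis by (simp add: cong_def)
  qed
  then have "one4 (of_int (D^2))" by (rule one4_int)
  then have \<mu>1: "one4 \<mu>" unfolding \<mu>_def using \<phi> by (simp add: one4_mult one4_power)
  from A show ?thesis
  proof
    assume A: "odd A \<and> A * D mod 4 = 1 \<and> t mod 4 = 3"
    define C Dd where "C = of_int A * \<delta>" and "Dd = of_int t * \<mu>"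
    have C1: "one4 C" unfolding C_def \<delta>_def
      using one4_mult[OF one4_int[of "A * D"] one4_power[OF \<phi>, of 2]] A by (simp add: mult.assoc)
    have "(- t) mod 4 = 1" using A by presburger
    then have D1: "one4 (- Dd)" unfolding Dd_def using one4_mult[OF one4_int[of "-t"] \<mu>1] by simp
    have C: "lu C" using C1 one4_lu p by blast
    have DL: "Dd \<in> L" using one4_L[OF D1] L_uminus by fastforce
    have CD: "1728 * \<delta>^3 = C^3 - Dd^2"
    proof -
      have "of_int (D * t^2) = (of_int (A^3 - 1728) :: complex)" using E by simp
      then have *: "of_int D * of_int t^2 = (of_int A^3 - 1728 :: complex)" by simp
      have "C^3 - Dd^2 = of_int A^3 * \<delta>^3 - (of_int D * of_int t^2) * \<delta>^3"
        unfolding C_def Dd_def by (simp add: power_mult_distrib rel)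
      then show ?thesis unfolding * by (simp add: algebra_simps)
    qed
    obtain x y where xy: "x \<in> L" "y \<in> L" "C = 1 + 4 * x" "- Dd = 1 + 4 * y" using C1 D1 by (auto simp: one4_def)
    define d where "d = y - x"
    have "(- Dd / C - 1^2) / 4 = (- Dd - C) / (4 * C)" using lu_0[OF C] by (simp add: field_simps)
    also have "- Dd - C = 4 * d" unfolding xy(3,4) d_def by simp
    finally have eq: "(- Dd / C - 1^2) / 4 = d / C" by simp
    have a2: "(- Dd / C - 1^2) / 4 \<in> L" unfolding eq d_def using L_divide[OF L_diff[OF xy(2,1)] C] .
    let ?a = "(1, (- Dd / C - 1^2) / 4, 0, - 36 * \<delta>^3 / C^2, Dd * \<delta>^3 / C^3) :: wcoeffs"
    have "coeffs_in L ?a" using a2 \<delta> C DL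
      by (auto intro!: L_divide[OF _ C] L_divide[OF _ lu_power[OF C]] L_uminus L_mult L_power)
    moreover have c: "c4 ?a = of_int A * \<delta>" "c6 ?a = of_int t * \<mu>"
      using two_torsion_model[OF lu_0[OF C] CD, of 1] unfolding C_def Dd_def by auto
    moreover have "disc ?a = \<delta>^3" by (rule disc_of_invariants[OF c rel E])
    ultimately show ?thesis using \<delta> unfolding \<delta>_def[symmetric] \<mu>_def[symmetric] by (intro exI[of _ ?a]) auto
  next
    assume A: "16 dvd A \<and> 8 dvd t \<and> (t div 8) mod 4 = 1"
    then obtain k t' where kt: "A = 16 * k" "t = 8 * t'" by (meson dvdE)
    then have t': "t' mod 4 = 1" using A by simp
    have "one4 (of_int t' * \<mu>)" using one4_mult one4_int t' \<mu>1 by blast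
    then obtain x where x: "x \<in> L" "of_int t' * \<mu> = 1 + 4 * x" by (auto simp: one4_def)
    \<comment> \<open>\<open>a4\<close> solves \<open>- 48 a4 = 16 k \<delta>\<close>, and
      \<open>a6\<close> solves \<open>- 216 (1 + 4 a6) = 8 (1 + 4 x)\<close>.\<close>
    let ?a = "(0, 0, 1, - (of_int k * \<delta>) / 3, (- 7 - x) / 27) :: wcoeffs"
    have u: "lu 3" "lu 27" using lu_int[of 3] lu_int[of 27] p by simp_all
    have "coeffs_in L ?a" using u \<delta> x by (auto intro!: L_divide L_uminus L_mult L_diff)
    moreover have c: "c4 ?a = of_int A * \<delta>" "c6 ?a = of_int t * \<mu>"
    proof -
      show "c4 ?a = of_int A * \<delta>" by (simp add: kt)
      have "c6 ?a = 8 * (1 + 4 * x)" by (simp add: c6_def field_simps)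
      then show "c6 ?a = of_int t * \<mu>" unfolding x(2)[symmetric] by (simp add: kt)
    qed
    moreover have "disc ?a = \<delta>^3" by (rule disc_of_invariants[OF c rel E])
    ultimately show ?thesis using \<delta> unfolding \<delta>_def[symmetric] \<mu>_def[symmetric] by (intro exI[of _ ?a]) auto
  qed
qed

text \<open>The element \<open>w = D x + y \<surd>m\<close> of norm \<open>e D z\<^sup>2\<close> generates, up to squares of ideals and primes
  above 2, the square root of the ideal \<open>(D)\<close>.\<close>

lemma odd_scaling:
  assumes p: "p \<noteq> 2" and m: "m = q * D" and eq: "D * x^2 - q * y^2 = e * z^2" and e: "e = 1 \<or> e = -1"
    and cop: "coprime x y" "coprime x z" "coprime y z"
  defines "w \<equiv> of_int (D * x) + of_int y * s"
  shows "\<exists>u\<in>K. u \<noteq> 0 \<and> lu (of_int D * w^2 / u^4) \<and> of_int D^2 * w^3 / u^6 \<in> L"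
proof -
  have sfm: "squarefree (q * D)" using sqfree m by simp
  have wO: "w \<in> OK" unfolding w_def by (intro OK_add OK_mult OK_of_int OK_s)
  define w' where "w' = of_int (D * x) - of_int y * s"
  have wO': "w' \<in> OK" unfolding w'_def by (intro OK_diff OK_mult OK_of_int OK_s)
  have "of_int (D * x^2 - q * y^2) = (of_int (e * z^2) :: complex)" using eq by simp
  then have eqc: "of_int D * of_int x^2 - of_int q * of_int y^2 = (of_int e * of_int z^2 :: complex)" by simp
  have sm: "s * s = of_int q * of_int D" using ss m by simp
  have "w * w' = of_int D^2 * of_int x^2 - of_int y^2 * (s * s)"
    unfolding w_def w'_def by (simp add: power2_eq_square algebra_simps)
  also have "\<dots> = of_int D * (of_int D * of_int x^2 - of_int q * of_int y^2)"
    unfolding sm by (simp add: power2_eq_square algebra_simps)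
  finally have ww: "w * w' = of_int D * (of_int e * of_int z^2)" unfolding eqc .
  have s0: "s \<noteq> 0" using s2 m0 by auto
  have D0: "D \<noteq> 0" "q \<noteq> 0" using m m0 by auto
  have nd: "\<not> (p dvd q \<and> p dvd D)"
  proof
    assume "p dvd q \<and> p dvd D"
    then have "p^2 dvd q * D" by (simp add: mult_dvd_mono power2_eq_square)
    then have "is_unit p" using sfm squarefreeD by blast
    then show False using prime_p by auto
  qed
  have cI: False if "coprime a b" "p dvd a" "p dvd b" for a b
    using that prime_p by (meson coprime_common_divisor not_prime_unit)
  \<comment> \<open>The scaling factor \<open>u\<close> is 1, \<open>s\<close> and \<open>z\<close>
    in the three cases: \<open>w\<close> is a unit; \<open>p\<close> divides \<open>D\<close> and
    \<open>w\<close> is \<open>s\<close> times a unit; \<open>p\<close> divides \<open>z\<close> and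
    \<open>w\<close> is \<open>z^2\<close> times a unit.\<close>
  consider "w \<notin> P" | "w \<in> P" "p dvd D" | "w \<in> P" "\<not> p dvd D" by blast
  then show ?thesis
  proof cases
    case 1
    have "\<not> p dvd D"
    proof
      assume d: "p dvd D"
      then have "of_int (D * x) \<in> P" "of_int m \<in> P" unfolding int_in_P using m by auto
      moreover have "s * s \<in> P" using calculation ss by simp
      then have "s \<in> P" using P_prime[of s s] by auto
      ultimately show False using 1 P_add[of "of_int (D*x)" "of_int y * s"] P_mult[of s "of_int y"] unfolding w_def by auto
    qed
    then show ?thesis using 1 wO lu_OK lu_int by (intro bexI[of _ 1]) auto
  next
    case 2
    have "of_int m \<in> P" unfolding int_in_P using m 2 by auto
    then have "s * s \<in> P" using ss by simp
    then have sP: "s \<in> P" using P_prime[of s s] by auto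
    have pq: "\<not> p dvd q" using nd 2 by blast
    have py: "\<not> p dvd y"
    proof
      assume py: "p dvd y"
      then have "p dvd e * z^2" using 2 eq by (metis dvd_diff dvd_mult dvd_mult2 power2_eq_square)
      then have "p dvd z" using e prime_p prime_dvd_power by auto
      then show False using cI cop py by blast
    qed
    \<comment> \<open>\<open>h\<close> is \<open>q w / s\<close>. It is congruent to
      \<open>q y\<close> modulo \<open>P\<close>, hence a unit.\<close>
    define h where "h = of_int (q * y) + of_int x * s"
    have hP: "h \<notin> P"
    proof
      assume "h \<in> P"
      then have "of_int (q * y) \<in> P" using P_diff[of h "of_int x * s"] P_mult[OF sP, of "of_int x"] by (simp add: h_def)
      then show False using int_in_P pq py prime_p prime_dvd_mult_iff by blast
    qed
    have hO: "h \<in> OK" unfolding h_def by (intro OK_add OK_mult OK_of_int OK_s)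
    have hu: "lu h" "lu (of_int q)" using hO hP lu_OK lu_int pq by auto
    have "of_int q * w = of_int x * (s * s) + of_int q * of_int y * s" unfolding sm w_def by (simp add: algebra_simps)
    then have qw: "of_int q * w = s * h" by (simp add: h_def algebra_simps)
    then have wh: "w = s * h / of_int q" using D0 by (simp add: field_simps)
    have s4: "s^4 = of_int q^2 * of_int D^2" using sm by (simp add: power4_eq_xxxx power2_eq_square)
    have "of_int D * w^2 / s^4 = of_int D * (s * s) * h^2 / (of_int q^2 * s^4)"
      unfolding wh by (simp add: power_divide power2_eq_square field_simps)
    also have "\<dots> = h^2 / of_int q^3" unfolding s4 sm using D0 by (simp add: field_simps power2_eq_square power3_eq_cube)
    finally have 1: "lu (of_int D * w^2 / s^4)" using hu by auto
    have "of_int D^2 * w^3 / s^6 = of_int D^2 * h^3 * s^4 / (of_int q^3 * s^6 * s)"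
      unfolding wh using s0 by (simp add: power_divide field_simps numeral_eq_Suc)
    also have "\<dots> = of_int D^2 * h^3 * s / (of_int q^3 * s^4)"
      using s0 D0 by (simp add: field_simps numeral_eq_Suc)
    also have "\<dots> = h^3 * s / of_int q^5" unfolding s4 using D0 by (simp add: field_simps numeral_eq_Suc)
    finally have 2: "of_int D^2 * w^3 / s^6 \<in> L" using hu by auto
    show ?thesis using 1 2 s0 by (intro bexI[of _ s]) auto
  next
    case 3
    have "of_int D * (of_int e * of_int z^2) \<in> P" using ww P_mult2[OF 3(1) wO'] by simp
    then have "of_int (D * (e * z^2)) \<in> P" by simp
    then have "p dvd D * (e * z^2)" using int_in_P by blast
    then have "p dvd z^2" using 3 e prime_p by (auto simp: prime_dvd_mult_iff)
    then have pz: "p dvd z" using prime_p prime_dvd_power by blast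
    have px: "\<not> p dvd x" using cI cop pz by blast
    \<comment> \<open>Of the two conjugates only \<open>w\<close> lies in \<open>P\<close>, because
      their sum \<open>2 D x\<close> does not; so \<open>w\<close> carries the whole factor
      \<open>z^2\<close> of the norm.\<close>
    have wP': "w' \<notin> P"
    proof
      assume "w' \<in> P"
      then have "w + w' \<in> P" using 3 P_add by blast
      moreover have "w + w' = of_int (2 * D * x)" by (simp add: w_def w'_def)
      ultimately have "p dvd 2 * D * x" using int_in_P by metis
      then have "p dvd 2" using px 3 prime_p by (simp add: prime_dvd_mult_iff)
      then show False using p prime_p primes_dvd_imp_eq[of p 2] by auto
    qed
    have wu: "lu w'" "lu (of_int D)" using wP' wO' lu_OK lu_int 3 by auto
    have z0: "z \<noteq> 0"
    proof
      assume "z = 0"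
      then have "w * w' = 0" using ww by simp
      then have "w = 0" using wP' by auto
      then have "em (of_int (D * x)) (of_int y) = 0" by (simp add: w_def em_def of_rat_mult)
      then show False using em_0_iff px D0 by auto
    qed
    have ee: "of_int e * of_int e = (1 :: complex)" using e by auto
    have w: "w = of_int D * of_int e * of_int z^2 / w'" using ww lu_0[OF wu(1)] by (simp add: field_simps)
    have "of_int D * w^2 / of_int z^4 = of_int D^3 * (of_int e * of_int e) / w'^2"
      unfolding w using z0 lu_0[OF wu(1)] by (simp add: field_simps numeral_eq_Suc)
    then have 1: "lu (of_int D * w^2 / of_int z^4)" unfolding ee using wu by auto
    have "of_int D^2 * w^3 / of_int z^6 = of_int D^5 * (of_int e ^ 3) / w'^3"
      unfolding w using z0 lu_0[OF wu(1)] by (simp add: field_simps numeral_eq_Suc)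
    then have 2: "of_int D^2 * w^3 / of_int z^6 \<in> L" using wu by auto
    show ?thesis using 1 2 z0 by (intro bexI[of _ "of_int z"]) auto
  qed
qed

end

section \<open>Models above 2: twists for odd \<open>D\<close>, an explicit equation for even
  \<open>D\<close>\<close>

context quad_field
begin

text \<open>Says that twisting by \<open>W\<close> is an unramified twist at every prime above 2.
  The square \<sigma> may depend on the prime, which matters when 2 splits.\<close>

definition sq4 :: "complex \<Rightarrow> bool" where
  "sq4 W \<longleftrightarrow> (\<forall>P. prime_over m P 2 \<longrightarrow>
     (\<exists>\<sigma>\<in>K. \<sigma> \<noteq> 0 \<and> (\<exists>\<phi>. prime_over.one4 m P \<phi> \<and> W = \<sigma>^2 * \<phi>)))"

lemma odd_sign: assumes "odd (i::int)" obtains n where "n = 1 \<or> n = -1" "(n * i) mod 4 = 1"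
proof (cases "i mod 4 = 1")
  case True then show ?thesis using that[of 1] by simp
next
  case False
  then have "(- i) mod 4 = 1" using assms by presburger
  then show ?thesis using that[of "-1"] by simp
qed

text \<open>An odd integer becomes 1 modulo 4 after a change of sign; this is where a twist by -1
  may be needed.\<close>

lemma sq4I:
  assumes \<sigma>: "\<sigma> \<in> K" "\<sigma> \<noteq> 0" and i: "odd i" and f: "f \<in> OK" and W: "W = \<sigma>^2 * (of_int i + 4 * f)"
  shows "\<exists>n. (n = 1 \<or> n = -1) \<and> sq4 (of_int n * W)"
proof -
  obtain n where n: "n = 1 \<or> n = -1" "(n * i) mod 4 = 1" using odd_sign[OF i] by blast
  obtain j where j: "n * i = 1 + 4 * j" using n(2) by (metis mult_div_mod_eq add.commute)
  have "of_int n * (of_int i + 4 * f) = of_int (n * i) + 4 * (of_int n * f)" by (simp add: algebra_simps)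
  also have "\<dots> = 1 + 4 * (of_int j + of_int n * f)" unfolding j by (simp add: algebra_simps)
  finally have e: "of_int n * (of_int i + 4 * f) = 1 + 4 * (of_int j + of_int n * f)" .
  have O: "of_int j + of_int n * f \<in> OK" using f by auto
  have "sq4 (of_int n * W)" unfolding sq4_def
  proof (intro allI impI)
    fix P assume "prime_over m P 2"
    then interpret prime_over m P 2 .
    have "one4 (of_int n * (of_int i + 4 * f))" unfolding e one4_def using OK_L[OF O] by (rule bexI[rotated]) (rule refl)
    moreover have "of_int n * W = \<sigma>^2 * (of_int n * (of_int i + 4 * f))" by (simp add: W)
    ultimately show "\<exists>\<sigma>\<in>K. \<sigma> \<noteq> 0 \<and> (\<exists>\<phi>. one4 \<phi> \<and> of_int n * W = \<sigma>^2 * \<phi>)" using \<sigma> by blast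
  qed
  then show ?thesis using n by blast
qed

text \<open>\<open>v\<close> and \<open>X - v\<close> have odd sum and a product divisible by 4, so
  at each prime above 2 exactly one of them is a unit, and that one is \<open>X\<close> modulo 4.
  Where it is \<open>X - v\<close>, the other factor \<open>v = E z^2 / (X - v)\<close> is still a
  square times a unit of the right class, because \<open>E\<close> is 1 modulo 4.\<close>

lemma sq4_split:
  assumes v: "v \<in> OK" and X: "odd X" and vv: "v * (of_int X - v) = of_int (E * z^2)"
    and E: "E mod 4 = 1" and z: "even z" "z \<noteq> 0"
  shows "\<exists>n. (n = 1 \<or> n = -1) \<and> sq4 (of_int n * (4 * v))"
proof -
  obtain n where n: "n = 1 \<or> n = -1" "(n * X) mod 4 = 1" using odd_sign[OF X] by blast
  obtain z' where z': "z = 2 * z'" using z by auto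
  define N' where "N' = E * z'^2"
  have N: "E * z^2 = 4 * N'" by (simp add: N'_def z' power2_eq_square)
  define v' where "v' = of_int X - v"
  have v'O: "v' \<in> OK" using v by (auto simp: v'_def)
  have vv': "v * v' = 4 * of_int N'" using vv unfolding v'_def N by simp
  have sumv: "v + v' = of_int X" by (simp add: v'_def)
  obtain j where j: "n * X = 1 + 4 * j" using n(2) by (metis mult_div_mod_eq add.commute)
  have X1: "of_int (n * X) = 1 + 4 * (of_int j :: complex)" unfolding j by simp
  have "sq4 (of_int n * (4 * v))" unfolding sq4_def
  proof (intro allI impI)
    fix P assume "prime_over m P 2"
    then interpret prime_over m P 2 .
    have unit: "one4 (of_int n * u)" if u: "lu u" "u' * u = 4 * of_int N'" "u' + u = of_int X" for u u'
    proof -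
      have "u' = 4 * of_int N' / u" using u lu_0[OF u(1)] by (simp add: field_simps)
      then have "of_int n * u = of_int (n * X) - of_int n * (4 * of_int N' / u)"
        using u(3) by (simp add: algebra_simps flip: u(3))
      also have "\<dots> = 1 + 4 * (of_int j - of_int n * of_int N' / u)"
        unfolding X1 by (simp add: algebra_simps)
      finally have eq: "of_int n * u = 1 + 4 * (of_int j - of_int n * of_int N' / u)" .
      show ?thesis unfolding one4_def
        using eq by (rule bexI) (intro L_diff L_divide L_mult L_of_int u)
    qed
    show "\<exists>\<sigma>\<in>K. \<sigma> \<noteq> 0 \<and> (\<exists>\<phi>. one4 \<phi> \<and> of_int n * (4 * v) = \<sigma>^2 * \<phi>)"
    proof (cases "v \<in> P")
      case False
      then have "lu v" using lu_OK v by blast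
      then have "one4 (of_int n * v)" using unit[of v v'] vv' sumv by (simp add: mult.commute add.commute)
      moreover have "of_int n * (4 * v) = 2^2 * (of_int n * v)" by simp
      ultimately show ?thesis by (intro bexI[of _ 2]) auto
    next
      case True
      have "v' \<notin> P"
      proof
        assume "v' \<in> P"
        then have "of_int X \<in> P" using P_add[OF True] sumv by metis
        then show False using int_in_P X by blast
      qed
      then have u: "lu v'" using lu_OK v'O by blast
      then have "one4 (of_int n * v')" using unit[of v' v] vv' sumv by simp
      then have o: "one4 (of_int E * (of_int n * v'))" using one4_mult[OF one4_int[OF E]] by blast
      have "v * v' = of_int (E * z^2)" unfolding vv' N by simp
      then have "v = of_int E * of_int z^2 / v'" using lu_0[OF u] by (simp add: field_simps)
      then have "of_int n * (4 * v) = (2 * of_int z / v')^2 * (of_int E * (of_int n * v'))"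
        using lu_0[OF u] by (simp add: field_simps power2_eq_square)
      then show ?thesis using o z lu_0[OF u] v'O
        by (intro bexI[of _ "2 * of_int z / v'"] conjI exI[of _ "of_int E * (of_int n * v')"]) auto
    qed
  qed
  then show ?thesis using n by blast
qed

text \<open>The two-adic part of the construction: over every prime above 2, a suitable multiple of
  \<open>w = X + y \<surd>m\<close> is a square times a unit congruent to 1 modulo 4.\<close>

lemma two_adic_twist:
  assumes D: "odd D" and m: "m = q * D" and E1: "E mod 4 = 1" and E8: "m mod 4 \<noteq> 1 \<Longrightarrow> E mod 8 = 1"
    and eq: "X^2 - m * y^2 = E * z^2" and oddX: "odd y \<and> odd z \<or> odd y \<and> even z \<and> odd X \<or> even y \<and> odd z"
    and z0: "z \<noteq> 0"
  defines "w \<equiv> of_int X + of_int y * s"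
  shows "\<exists>n::int. n \<in> {1, -1, 2, -2} \<and> sq4 (of_int n * w)"
proof -
  have fin: "\<exists>n::int. n \<in> {1, -1, 2, -2} \<and> sq4 (of_int n * w)"
    if asm: "\<sigma> \<in> K" "\<sigma> \<noteq> 0" "odd i" "f \<in> OK" "k * w = \<sigma>^2 * (of_int i + 4 * f)" "k = 1 \<or> k = 2" for \<sigma> i f k
  proof -
    obtain n where "n = 1 \<or> n = -1" "sq4 (of_int n * (k * w))" using sq4I[OF asm(1-5)] by blast
    then show ?thesis using asm(6)
      by (intro exI[of _ "n * (if k = 1 then 1 else 2)"]) (auto simp: mult.assoc)
  qed
  have oddE: "odd E" using E1 by presburger
  have w2: "w * (of_int X - of_int y * s) = of_int (E * z^2)"
  proof -
    have "w * (of_int X - of_int y * s) = of_int X^2 - of_int y^2 * (s * s)"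
      unfolding w_def by (simp add: power2_eq_square algebra_simps)
    also have "\<dots> = of_int (X^2 - m * y^2)" unfolding ss by simp
    finally show ?thesis unfolding eq .
  qed
  consider "m mod 4 = 1" | "m mod 4 = 3" | "m mod 4 = 2" using m_mod4 by blast
  then show ?thesis
  proof cases
    case 1
    then have s: "s = 2 * om - 1" by (simp add: om_def field_simps)
    have oddm: "odd m" using 1 by presburger
    show ?thesis
    proof (cases "odd z")
      case True
      obtain Z where Z: "z^2 = 8 * Z + 1" using True by (rule odd_square_E)
      \<comment> \<open>Otherwise \<open>X\<close> is even and the equation gives
        \<open>m + E = 0\<close> modulo 4, while both summands are 1.\<close>
      have "even y"
      proof (rule ccontr)
        assume y: "odd y"
        obtain Y where Y: "y^2 = 8 * Y + 1" using y by (rule odd_square_E)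
        have "even (X^2)"
        proof -
          have "X^2 = E * z^2 + m * y^2" using eq by simp
          then show ?thesis using True y oddE oddm by simp
        qed
        then obtain a where a: "X = 2 * a" by auto
        have "m + E = 4 * (a^2 - 2 * m * Y - 2 * E * Z)" using eq unfolding Y Z a
          by (simp add: power2_eq_square algebra_simps)
        then show False using 1 E1 by presburger
      qed
      then obtain y' where y': "y = 2 * y'" by auto
      have "X^2 = E * z^2 + m * y^2" using eq by simp
      then have X: "odd X" using True y' oddE by (metis even_add even_mult_iff even_power odd_even_add dvd_triv_left power2_eq_square)
      have "1 * w = 1^2 * (of_int (X - 2 * y') + 4 * (of_int y' * om))"
        unfolding w_def y' s by (simp add: algebra_simps)
      then show ?thesis using X by (intro fin[of 1 "X - 2 * y'" "of_int y' * om" 1]) auto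
    next
      case False
      then have yX: "odd y" "odd X" using oddX by auto
      then have "even (X - y)" by simp
      then obtain b where b: "X - y = 2 * b" by (rule evenE)
      define v where "v = of_int b + of_int y * om"
      have vO: "v \<in> OK" unfolding v_def by auto
      have wv: "w = 2 * v"
      proof -
        have "of_int X = of_int y + 2 * (of_int b :: complex)" using b by (metis diff_eq_eq of_int_add of_int_mult of_int_numeral add.commute)
        then show ?thesis unfolding w_def v_def s by (simp add: algebra_simps)
      qed
      obtain z' where z': "z = 2 * z'" using False by auto
      have "4 * (v * (of_int X - v)) = w * (2 * of_int X - w)" unfolding wv by (simp add: algebra_simps)
      also have "2 * of_int X - w = of_int X - of_int y * s" unfolding w_def by simp
      also have "w * \<dots> = 4 * of_int (E * z'^2)" unfolding w2 z' by (simp add: power2_eq_square)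
      finally have vv: "v * (of_int X - v) = of_int (E * z'^2)" by simp
      show ?thesis
      proof (cases "odd z'")
        case True
        obtain Z where Z: "z'^2 = 8 * Z + 1" using True by (rule odd_square_E)
        obtain X' where X': "X^2 = 8 * X' + 1" using yX(2) by (rule odd_square_E)
        obtain E' where E': "E = 4 * E' + 1" using E1 by (metis mult_div_mod_eq)
        \<comment> \<open>Here \<open>v^2 - X v + N' = 0\<close> with \<open>X\<close> and
          \<open>N'\<close> odd, so 2 is inert and \<open>v\<close> has order 3 in the residue
          field. Its cube is congruent to the odd integer \<open>- X N'\<close> modulo 4, and
          \<open>v\<close> differs from its cube by a square.\<close>
        define N' where "N' = E * z'^2"
        have "X^2 - N' = 4 * (2 * X' - 2 * Z - E' - 8 * E' * Z)" unfolding N'_def X' Z E' by (simp add: algebra_simps)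
        then obtain r where r: "X^2 - N' = 4 * r" by blast
        have v2: "v^2 = of_int X * v - of_int N'" using vv unfolding N'_def by (simp add: power2_eq_square algebra_simps)
        have v0: "v \<noteq> 0" using vv z' z0 E1 by auto
        have "v^3 = v * v^2" by (simp add: power2_eq_square power3_eq_cube)
        also have "v * v^2 = v * (of_int X * v - of_int N')" by (simp only: v2)
        also have "\<dots> = of_int X * v^2 - of_int N' * v" by (simp add: power2_eq_square algebra_simps)
        also have "\<dots> = of_int (X^2 - N') * v - of_int (X * N')" unfolding v2 by (simp add: power2_eq_square algebra_simps)
        also have "\<dots> = of_int (- (X * N')) + 4 * (of_int r * v)" unfolding r by simp
        finally have v3: "v^3 = of_int (- (X * N')) + 4 * (of_int r * v)" .
        have "2 * w = (2 / v)^2 * v^3" unfolding wv using v0 by (simp add: power2_eq_square power3_eq_cube)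
        then have "2 * w = (2 / v)^2 * (of_int (- (X * N')) + 4 * (of_int r * v))" unfolding v3 .
        then show ?thesis using v0 vO yX True oddE
          by (intro fin[of "2 / v" "- (X * N')" "of_int r * v" 2]) (auto simp: N'_def)
      next
        case False
        then obtain n where n: "n = 1 \<or> n = -1" "sq4 (of_int n * (4 * v))"
          using sq4_split[OF vO yX(2) vv E1] z' z0 by auto
        have "of_int n * (4 * v) = of_int (2 * n) * w" unfolding wv by simp
        then show ?thesis using n by (intro exI[of _ "2 * n"]) auto
      qed
    qed
  next
    case 2
    have "E mod 8 = 1" using E8 2 by simp
    then obtain E' where E': "E = 8 * E' + 1" by (metis mult_div_mod_eq)
    have oddm: "odd m" using 2 by presburger
    have z: "odd z"
    proof (rule ccontr)
      assume nz: "\<not> odd z"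
      then have y: "odd y" "odd X" using oddX by auto
      obtain Y where Y: "y^2 = 8 * Y + 1" using y(1) by (rule odd_square_E)
      obtain X' where X': "X^2 = 8 * X' + 1" using y(2) by (rule odd_square_E)
      obtain z' where z': "z = 2 * z'" using nz by auto
      have "1 - m = 4 * (E * z'^2 - 2 * X' + 2 * m * Y)" using eq unfolding Y X' z'
        by (simp add: power2_eq_square algebra_simps)
      then show False using 2 by presburger
    qed
    obtain Z where Z: "z^2 = 8 * Z + 1" using z by (rule odd_square_E)
    show ?thesis
    proof (cases "even y")
      case True
      then obtain y' where y': "y = 2 * y'" by auto
      have "X^2 = E * z^2 + 4 * m * y'^2" using eq y' by (simp add: power2_eq_square)
      then have "odd (X^2)" using z oddE by simp
      then have X: "odd X" by simp
      obtain X' where X': "X^2 = 8 * X' + 1" using X by (rule odd_square_E)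
      have "4 * (m * y'^2) = 8 * (X' - Z - E' - 8 * E' * Z)" using eq unfolding y' Z X' E'
        by (simp add: power2_eq_square algebra_simps)
      then have "m * y'^2 = 2 * (X' - Z - E' - 8 * E' * Z)" by simp
      then have "even (m * y'^2)" by simp
      then obtain y'' where y'': "y' = 2 * y''" using oddm by auto
      have "1 * w = 1^2 * (of_int X + 4 * (of_int y'' * s))" unfolding w_def y' y'' by simp
      then show ?thesis using X by (intro fin[of 1 X "of_int y'' * s" 1]) auto
    next
      case False
      obtain Y where Y: "y^2 = 8 * Y + 1" using False by (rule odd_square_E)
      have "X^2 = E * z^2 + m * y^2" using eq by simp
      then have "even (X^2)" using z False oddE oddm by simp
      then obtain a where a: "X = 2 * a" by auto
      obtain j where j: "m = 4 * j + 3" using 2 by (metis mult_div_mod_eq)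
      define M where "M = 2 * (j + 1)"
      have "m = 2 * M - 1" unfolding M_def j by simp
      then have M: "of_int m = 2 * of_int M - (1 :: complex)" by simp
      have "4 * a^2 - 4 * (j + 1) = 8 * (m * Y + Z + E' + 8 * E' * Z)" using eq unfolding Y Z a E'
        by (simp add: j power2_eq_square algebra_simps)
      then have "a^2 - (j + 1) = 2 * (m * Y + Z + E' + 8 * E' * Z)" by simp
      then have "even (a^2 - (j + 1))" by simp
      then have "even (a + y * (j + 1))" using False by auto
      then obtain c where c: "a + y * (j + 1) = 2 * c" by (rule evenE)
      \<comment> \<open>\<eta> is \<open>(1 + s)^2 / 2\<close>. Multiplication by it makes
        \<open>w\<close> an odd integer modulo 4, and since \<open>2 \<eta>\<close> is a square,
        this costs a twist by 2.\<close>
      define \<eta> where "\<eta> = of_int M + s"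
      have "\<eta> = em (of_int M) 1" by (simp add: \<eta>_def em_def)
      then have \<eta>0: "\<eta> \<noteq> 0" "\<eta> \<in> K" using em_0_iff em_K by auto
      have pi: "(1 + s)^2 = 2 * \<eta>"
      proof -
        have "(1 + s)^2 = 1 + s * s + 2 * s" by (simp add: power2_eq_square algebra_simps)
        then show ?thesis unfolding ss M \<eta>_def by simp
      qed
      have "1 + s = em 1 1" by (simp add: em_def)
      then have pi0: "1 + s \<noteq> 0" using em_0_iff by auto
      have "\<eta> * w = of_int (M * X) + of_int y * (s * s) + of_int (X + y * M) * s"
        unfolding \<eta>_def w_def by (simp add: algebra_simps)
      also have "X + y * M = 4 * c" unfolding a M_def using c by (simp add: algebra_simps)
      also have "of_int (M * X) + of_int y * (s * s) + of_int (4 * c) * s = of_int (y * m) + 4 * (of_int ((j + 1) * a) + of_int c * s)"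
        unfolding ss M_def a by (simp add: algebra_simps)
      finally have \<eta>w: "\<eta> * w = of_int (y * m) + 4 * (of_int ((j + 1) * a) + of_int c * s)" .
      have "2 * w = ((1 + s) / \<eta>)^2 * (\<eta> * w)" unfolding power_divide pi using \<eta>0 by (simp add: power2_eq_square)
      then have "2 * w = ((1 + s) / \<eta>)^2 * (of_int (y * m) + 4 * (of_int ((j + 1) * a) + of_int c * s))" unfolding \<eta>w .
      then show ?thesis
        by (intro fin[of "(1 + s) / \<eta>" "y * m" "of_int ((j + 1) * a) + of_int c * s" 2])
          (use \<eta>0 pi0 False oddm in \<open>auto simp del: of_int_mult of_int_add\<close>)
    qed
  next
    case 3
    have "E mod 8 = 1" using E8 3 by simp
    then obtain E' where E': "E = 8 * E' + 1" by (metis mult_div_mod_eq)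
    have evm: "even m" using 3 by presburger
    have Xz: "odd X \<longleftrightarrow> odd z"
    proof -
      have "X^2 = E * z^2 + m * y^2" using eq by simp
      then have "even (X^2) \<longleftrightarrow> even (E * z^2)" using evm by simp
      then show ?thesis using oddE by simp
    qed
    then have X: "odd X" "odd z" using oddX by auto
    obtain X' where X': "X^2 = 8 * X' + 1" using X(1) by (rule odd_square_E)
    obtain Z where Z: "z^2 = 8 * Z + 1" using X(2) by (rule odd_square_E)
    have my: "m * y^2 = 8 * (X' - Z - E' - 8 * E' * Z)" using eq unfolding X' Z E' by (simp add: algebra_simps)
    have "even y"
    proof (rule ccontr)
      assume y: "odd y"
      obtain Y where Y: "y^2 = 8 * Y + 1" using y by (rule odd_square_E)
      have "m = 8 * (X' - Z - E' - 8 * E' * Z - m * Y)" using my unfolding Y by (simp add: algebra_simps)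
      then show False using 3 by presburger
    qed
    then obtain y' where y': "y = 2 * y'" by auto
    show ?thesis
    proof (cases "even y'")
      case True
      then obtain y'' where y'': "y' = 2 * y''" by auto
      have "1 * w = 1^2 * (of_int X + 4 * (of_int y'' * s))" unfolding w_def y' y'' by simp
      then show ?thesis using X by (intro fin[of 1 X "of_int y'' * s" 1]) auto
    next
      case False
      \<comment> \<open>The square \<open>(1 - s)^2\<close> is chosen so that, after multiplication,
        the coefficient of \<open>s\<close> in \<open>w\<close> becomes
        \<open>2 (y' (1 + m) - X)\<close>, which is divisible by 4.\<close>
      have "even (y' * (1 + m) - X)" using False evm X by simp
      then obtain c where c: "y' * (1 + m) - X = 2 * c" by (rule evenE)
      have "1 - s = em 1 (-1)" by (simp add: em_def of_rat_minus)
      then have s0: "1 - s \<noteq> 0" "1 - s \<in> K" using em_0_iff em_K by auto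
      have "w * (1 - s)^2 = w * (1 - 2 * s + s * s)" by (simp add: power2_eq_square algebra_simps)
      also have "\<dots> = of_int (X * (1 + m)) - 4 * (of_int y' * (s * s)) + 2 * of_int (y' * (1 + m) - X) * s"
        unfolding ss w_def y' by (simp add: algebra_simps ss)
      also have "\<dots> = of_int (X * (1 + m)) + 4 * (of_int (- y' * m) + of_int c * s)"
        unfolding ss c by (simp add: algebra_simps)
      finally have ws: "w * (1 - s)^2 = of_int (X * (1 + m)) + 4 * (of_int (- y' * m) + of_int c * s)" .
      have "1 * w = (1 / (1 - s))^2 * (w * (1 - s)^2)" using s0 by (simp add: power_divide)
      then have "1 * w = (1 / (1 - s))^2 * (of_int (X * (1 + m)) + 4 * (of_int (- y' * m) + of_int c * s))"
        unfolding ws .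
      then show ?thesis
        by (intro fin[of "1 / (1 - s)" "X * (1 + m)" "of_int (- y' * m) + of_int c * s" 1])
          (use s0 X evm in \<open>auto simp del: of_int_mult of_int_add of_int_minus\<close>)
    qed
  qed
qed

end

text \<open>The integrality conditions of the equation in \<open>model_p2_even\<close>, isolated as
  congruences between integers: \<open>e0\<close>, \<open>e1\<close> are the coordinates of
  \<open>h^2\<close> and \<open>c0\<close>, \<open>c1\<close> those of \<open>h^3\<close> for
  \<open>h = q y + x s\<close>, and \<beta> is half of \<open>b2\<close>. The hypotheses determine
  \<open>D'\<close>, \<open>q\<close> and \<open>m\<close> modulo 8 in terms of
  \<open>k\<close>.\<close>

lemma even_model_congruences:
  fixes q D' k t' x y m \<beta> :: int
  assumes t': "D' * t'^2 = 32*k^3 + 24*k^2 + 6*k - 13" and q: "[q = 2 * D' + 1] (mod 8)" and m: "m = 2 * D' * q"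
    and odd: "odd x" "odd y" and \<beta>: "[\<beta> * x = - t'] (mod 4)" "\<beta> = (if even k then 1 else 3)"
  defines "A \<equiv> 4 * k + 1"
  defines "e0 \<equiv> q^2 * y^2 + x^2 * m" and "e1 \<equiv> 2 * q * x * y"
  defines "c0 \<equiv> q * y * e0 + x * e1 * m" and "c1 \<equiv> q * y * e1 + x * e0"
  shows "4 dvd \<beta>^2 - A * q * e0" "4 dvd A * q * e1 + 6"
    "8 dvd \<beta>^3 - 3 * \<beta> * (A * q * e0) - 2 * t' * q * c1 * m - 54"
    "8 dvd 3 * \<beta> * (A * q * e1) + 2 * t' * q * c0"
proof -
  have rhs: "32*k^3 + 24*k^2 + 6*k - 13 = 6*k + 3 + 8 * (4*k^3 + 3*k^2 - 2)" by simp
  have oddt: "odd t'"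
  proof
    assume "even t'"
    then have "even (D' * t'^2)" by simp
    then show False unfolding t' by simp
  qed
  obtain T where T: "t'^2 = 8 * T + 1" using oddt by (rule odd_square_E)
  \<comment> \<open>\<open>t'^2\<close> is 1 modulo 8, so the equation \<open>t'\<close> gives the
    class of \<open>D'\<close> itself.\<close>
  have D: "[D' = 6*k + 3] (mod 8)"
    by (rule cong_I[of _ _ _ "4*k^3 + 3*k^2 - 2 - D' * T"]) (use t' T rhs in \<open>simp add: algebra_simps\<close>)
  obtain d where d: "D' = 6*k + 3 + 8 * d" using D by (rule cong_E)
  obtain j0 where "q = 2 * D' + 1 + 8 * j0" using q by (rule cong_E)
  then have "q = 12*k + 7 + 8 * (2 * d + j0)" using d by simp
  then obtain j1 where j1: "q = 12*k + 7 + 8 * j1" by blast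
  have oddq: "odd q" using j1 by presburger
  have "A * q = 7 + 8 * (6*k^2 + 5*k + j1 * A)" unfolding j1 A_def by (simp add: algebra_simps power2_eq_square)
  then obtain j4 where j4: "A * q = 7 + 8 * j4" by blast
  have "m = 4*k + 2 + 8 * (18*k^2 + 19*k + 5 + 2 * d * q + 2 * (6*k+3) * j1)"
    unfolding m d j1 by (simp add: algebra_simps power2_eq_square)
  then obtain j5 where j5: "m = 4*k + 2 + 8 * j5" by blast
  obtain X where X: "x^2 = 8 * X + 1" using odd(1) by (rule odd_square_E)
  obtain Y where Y: "y^2 = 8 * Y + 1" using odd(2) by (rule odd_square_E)
  obtain Q where Q: "q^2 = 8 * Q + 1" using oddq by (rule odd_square_E)
  have "e0 = 4*k + 3 + 8 * (8 * Q * Y + Q + Y + X * m + j5)"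
    unfolding e0_def X Y Q by (simp add: algebra_simps) (simp add: j5)
  then obtain j2 where j2: "e0 = 4*k + 3 + 8 * j2" by blast
  obtain j3 where j3: "\<beta> * x = - t' + 4 * j3" using \<beta>(1) by (rule cong_E)
  have "odd \<beta>" using \<beta>(2) by simp
  then obtain B where B: "\<beta>^2 = 8 * B + 1" by (rule odd_square_E)
  have Ae: "A * q * e0 = 28 * k + 21 + 8 * (7 * j2 + j4 * e0)" unfolding j4 by (simp add: j2 algebra_simps)
  then obtain j6 where j6: "A * q * e0 = 28 * k + 21 + 8 * j6" by blast
  have "\<beta>^2 - A * q * e0 = 4 * (2 * B - 7 * k - 5 - 2 * j6)" unfolding B j6 by simp
  then show "4 dvd \<beta>^2 - A * q * e0" by simp
  have "odd (q * x * y)" using oddq odd by simp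
  then obtain j7 where j7: "q * x * y = 2 * j7 + 1" by (rule oddE)
  have e1: "e1 = 2 * (2 * j7 + 1)" unfolding e1_def j7[symmetric] by simp
  have "A * q * e1 + 6 = 4 * (7 * j7 + 5 + 8 * j4 * j7 + 4 * j4)" unfolding j4 e1 by (simp add: algebra_simps)
  then show "4 dvd A * q * e1 + 6" by simp
  have "odd c1" unfolding c1_def using oddq odd e1 j2 by simp
  moreover have "odd (D' * q)" using d oddq by simp
  ultimately have "odd (t' * q * c1 * (D' * q))" using oddt oddq by simp
  then obtain j8 where j8: "t' * q * c1 * (D' * q) = 2 * j8 + 1" by (rule oddE)
  have "2 * t' * q * c1 * m = 4 * (t' * q * c1 * (D' * q))" unfolding m by simp
  then have tc: "2 * t' * q * c1 * m = 8 * j8 + 4" unfolding j8 by simp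
  \<comment> \<open>This congruence dictates the value of \<beta>: with the other choice the left
    side would be 4 modulo 8.\<close>
  show "8 dvd \<beta>^3 - 3 * \<beta> * (A * q * e0) - 2 * t' * q * c1 * m - 54"
  proof (cases "even k")
    case True
    then obtain i where "k = 2 * i" by (rule evenE)
    then have "\<beta>^3 - 3 * \<beta> * (A * q * e0) - 2 * t' * q * c1 * m - 54 = 8 * (- 21 * i - 3 * j6 - j8 - 15)"
      unfolding j6 tc using \<beta>(2) True by simp
    then show ?thesis by (rule dvdI)
  next
    case False
    then obtain i where "k = 2 * i + 1" by (rule oddE)
    then have "\<beta>^3 - 3 * \<beta> * (A * q * e0) - 2 * t' * q * c1 * m - 54 = 8 * (- 63 * i - 9 * j6 - j8 - 59)"
      unfolding j6 tc using \<beta>(2) False by simp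
    then show ?thesis by (rule dvdI)
  qed
  have "21 * (\<beta> * x) + t' * q * (4*k+3) = 4 * (21 * j3 + t' * (12*k^2 + 16*k + 2 * j1 * (4*k+3)))"
    unfolding j3 unfolding j1 by (simp add: algebra_simps power2_eq_square)
  then obtain j9 where j9: "21 * (\<beta> * x) + t' * q * (4*k+3) = 4 * j9" by blast
  have "3 * \<beta> * (A * q * e1) + 2 * t' * q * c0
      = 2 * q * y * (21 * (\<beta> * x) + t' * q * (4*k+3)) + 8 * (6 * \<beta> * j4 * q * x * y + 2 * t' * q * q * y * j2 + t' * q * x * q * x * y * (D' * q))"
    unfolding c0_def j4 unfolding j2 e1_def m by (simp add: algebra_simps)
  also have "\<dots> = 8 * (q * y * j9 + (6 * \<beta> * j4 * q * x * y + 2 * t' * q * q * y * j2 + t' * q * x * q * x * y * (D' * q)))"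
    unfolding j9 by simp
  finally show "8 dvd 3 * \<beta> * (A * q * e1) + 2 * t' * q * c0" by simp
qed

context prime_over
begin

text \<open>Since \<open>c4\<close> is divisible by 4 but not by 16 up to scaling, \<open>a1\<close>
  must lie in \<open>P\<close> without being divisible by 2, and \<open>a3\<close> must be a unit.
  The simplest such choice is \<open>a1 = s\<close> and \<open>a3 = 1\<close>. The value of
  \<open>b2\<close> is then set to \<open>2 \<beta>\<close> through \<open>a2\<close>, and the
  prescribed \<open>c4\<close> and \<open>c6\<close> determine \<open>a4\<close> and
  \<open>a6\<close>.\<close>

lemma model_p2_even:
  fixes q D D' k t' x y \<beta> :: int
  assumes p: "p = 2" and m: "m = q * D" and D: "D = 2 * D'"
    and t': "D' * t'^2 = 32*k^3 + 24*k^2 + 6*k - 13" and q: "[q = D + 1] (mod 8)"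
    and odd: "odd x" "odd y" and \<beta>: "[\<beta> * x = - t'] (mod 4)" "\<beta> = (if even k then 1 else 3)"
  defines "w \<equiv> of_int (D * x) + of_int y * s"
  shows "\<exists>u\<in>K. u \<noteq> 0 \<and> (\<exists>a. coeffs_in L a \<and> u^4 * c4 a = of_int (16*k+4) * of_int D * w^2 \<and>
    u^6 * c6 a = of_int (8*t') * of_int D^2 * w^3 \<and> lu (disc a))"
proof -
  define A where "A = 4 * k + 1"
  define e0 e1 where "e0 = q^2 * y^2 + x^2 * m" and "e1 = 2 * q * x * y"
  define c0 c1 where "c0 = q * y * e0 + x * e1 * m" and "c1 = q * y * e1 + x * e0"
  have m': "m = 2 * D' * q" using m D by simp
  have q': "[q = 2 * D' + 1] (mod 8)" using q D by simp
  note C = even_model_congruences[OF t' q' m' odd \<beta>, folded A_def e0_def e1_def, folded c0_def c1_def]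
  obtain i1 where i1: "\<beta>^2 - A * q * e0 = 4 * i1" using C(1) by (rule dvdE)
  obtain i2 where i2: "A * q * e1 + 6 = 4 * i2" using C(2) by (rule dvdE)
  obtain i3 where i3: "\<beta>^3 - 3 * \<beta> * (A * q * e0) - 2 * t' * q * c1 * m - 54 = 8 * i3" using C(3) by (rule dvdE)
  obtain i4 where i4: "3 * \<beta> * (A * q * e1) + 2 * t' * q * c0 = 8 * i4" using C(4) by (rule dvdE)
  have oddD': "odd D'"
  proof
    assume "even D'"
    then have "even (D' * t'^2)" by simp
    then show False unfolding t' by simp
  qed
  have oddq: "odd q"
  proof -
    obtain j where "q = 2 * D' + 1 + 8 * j" using q' by (rule cong_E)
    then show ?thesis by presburger
  qed
  define h where "h = of_int (q * y) + of_int x * s"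
  have h2: "h^2 = of_int e0 + of_int e1 * s"
  proof -
    have "h^2 = of_int (q * y)^2 + of_int x^2 * (s * s) + of_int e1 * s"
      unfolding h_def e1_def by (simp add: power2_eq_square algebra_simps)
    then show ?thesis unfolding ss e0_def by (simp add: power_mult_distrib)
  qed
  have h3: "h^3 = of_int c0 + of_int c1 * s"
  proof -
    have "h^3 = h * h^2" by (simp add: power2_eq_square power3_eq_cube)
    also have "\<dots> = of_int (q * y * e0) + of_int (x * e1) * (s * s) + of_int c1 * s"
      unfolding h2 unfolding h_def c1_def by (simp add: algebra_simps)
    finally show ?thesis unfolding ss c0_def by simp
  qed
  have hO: "h \<in> OK" unfolding h_def by (intro OK_add OK_mult OK_of_int OK_s)
  have "h \<notin> P"
  proof
    assume "h \<in> P"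
    then have "h * (of_int (q * y) - of_int x * s) \<in> P"
      by (rule P_mult2) (intro OK_diff OK_mult OK_of_int OK_s)
    also have "h * (of_int (q * y) - of_int x * s) = of_int (q * y)^2 - of_int x^2 * (s * s)"
      unfolding h_def by (simp add: power2_eq_square algebra_simps)
    also have "\<dots> = of_int ((q * y)^2 - x^2 * m)" unfolding ss by simp
    finally have "2 dvd (q * y)^2 - x^2 * m" using int_in_P p by blast
    moreover have "odd ((q * y)^2)" "even m" using oddq odd m' by auto
    ultimately show False by simp
  qed
  then have hu: "lu h" using lu_OK hO by blast
  have qu: "lu (of_int q)" using lu_int p oddq by blast
  have m2: "m = 2 * (D' * q)" using m' by simp
  \<comment> \<open>With \<open>a1 = s\<close> one has \<open>b2 = m + 4 a2\<close>, so
    \<open>a2 = g\<close> must satisfy \<open>m + 4 g = 2 \<beta>\<close>.\<close>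
  have "even (\<beta> - D' * q)" using \<beta>(2) oddD' oddq by simp
  then obtain g where g: "\<beta> - D' * q = 2 * g" by (rule evenE)
  \<comment> \<open>\<open>X\<close> and \<open>Y\<close> are \<open>3 a4\<close> and
    \<open>27 a6\<close>, obtained by solving \<open>c4 = 4 G\<close> and \<open>c6 = 8 H\<close>
    for \<open>b4\<close> and \<open>b6\<close>.\<close>
  define X where "X = of_int i1 - of_int i2 * s"
  define Y where "Y = of_int i3 - of_int i4 * s"
  have XO: "X \<in> OK" "Y \<in> OK" unfolding X_def Y_def by auto
  define G where "G = of_int (A * q) * h^2"
  define H where "H = of_int (t' * q) * s * h^3"
  have GX: "of_int \<beta>^2 - G - 6 * s = 4 * X"
  proof -
    have "of_int \<beta>^2 - G - 6 * s = of_int (\<beta>^2 - A * q * e0) - of_int (A * q * e1 + 6) * s"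
      unfolding G_def h2 by (simp add: algebra_simps)
    then show ?thesis unfolding i1 i2 X_def by (simp add: algebra_simps)
  qed
  have HY: "of_int \<beta>^3 - 3 * of_int \<beta> * G - 2 * H - 54 = 8 * Y"
  proof -
    have "H = of_int (t' * q * c0) * s + of_int (t' * q * c1) * (s * s)" unfolding H_def h3 by (simp add: algebra_simps)
    then have "H = of_int (t' * q * c0) * s + of_int (t' * q * c1 * m)" unfolding ss by simp
    then have "of_int \<beta>^3 - 3 * of_int \<beta> * G - 2 * H - 54
      = of_int (\<beta>^3 - 3 * \<beta> * (A * q * e0) - 2 * t' * q * c1 * m - 54) - of_int (3 * \<beta> * (A * q * e1) + 2 * t' * q * c0) * s"
      unfolding G_def h2 by (simp add: algebra_simps)
    then show ?thesis unfolding i3 i4 Y_def by (simp add: algebra_simps)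
  qed
  define a :: wcoeffs where "a = (s, of_int g, 1, X / 3, Y / 27)"
  have u3: "lu 3" "lu 27" using lu_int[of 3] lu_int[of 27] p by simp_all
  have aL: "coeffs_in L a" unfolding a_def using XO u3 by (auto intro!: L_divide)
  have b2: "b2 a = 2 * of_int \<beta>"
  proof -
    have "b2 a = of_int (m + 4 * g)" by (simp add: a_def s2)
    also have "m + 4 * g = 2 * \<beta>" using g m2 by simp
    finally show ?thesis by simp
  qed
  have b4: "b4 a = (of_int \<beta>^2 - G) / 6"
  proof -
    have "6 * b4 a = 4 * X + 6 * s" by (simp add: a_def)
    then show ?thesis unfolding GX[symmetric] by (simp add: field_simps)
  qed
  have b6: "b6 a = (of_int \<beta>^3 - 3 * of_int \<beta> * G - 2 * H) / 54"
  proof -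
    have "54 * b6 a = 54 + 8 * Y" by (simp add: a_def)
    then show ?thesis unfolding HY[symmetric] by (simp add: field_simps)
  qed
  have c4: "c4 a = 4 * G" unfolding c4_altdef b2 b4 by (simp add: field_simps power2_eq_square)
  have c6: "c6 a = 8 * H" unfolding c6_def b2 b4 b6
    by (simp add: field_simps power2_eq_square power3_eq_cube)
  have D0: "D \<noteq> 0" "q \<noteq> 0" using m m0 by auto
  have s0: "s \<noteq> 0" using s2 m0 by auto
  have sm: "s * s = of_int q * of_int D" using ss m by simp
  have "of_int q * w = of_int x * (s * s) + of_int q * of_int y * s" unfolding sm w_def by (simp add: algebra_simps)
  then have qw: "of_int q * w = s * h" by (simp add: h_def algebra_simps)
  then have wh: "w = s * h / of_int q" using D0 by (simp add: field_simps)
  \<comment> \<open>From \<open>w = s h / q\<close>: this scaling removes the factor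
    \<open>s\<close> that \<open>w\<close> carries above 2 and leaves the unit
    \<open>h\<close>.\<close>
  let ?u = "s / of_int q"
  have s4: "s^4 = of_int q^2 * of_int D^2" using sm by (simp add: power4_eq_xxxx power2_eq_square)
  have r4: "?u^4 * c4 a = of_int (16*k+4) * of_int D * w^2"
  proof -
    have "?u^4 * c4 a = of_int D * (of_int q * of_int D) * 4 * of_int A * h^2 / of_int q^2"
      unfolding c4 G_def power_divide s4 using D0 by (simp add: field_simps numeral_eq_Suc)
    also have "\<dots> = of_int (16*k+4) * of_int D * (s * s) * h^2 / of_int q^2"
      unfolding sm A_def by (simp add: field_simps)
    also have "\<dots> = of_int (16*k+4) * of_int D * w^2" unfolding wh by (simp add: power_divide power2_eq_square)
    finally show ?thesis .
  qed
  have r6: "?u^6 * c6 a = of_int (8*t') * of_int D^2 * w^3"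
  proof -
    have "?u^6 * c6 a = s^4 * s^3 * of_int (8 * t') * h^3 / of_int q^5"
      unfolding c6 H_def power_divide using D0 by (simp add: field_simps numeral_eq_Suc)
    also have "\<dots> = of_int D^2 * s^3 * of_int (8 * t') * h^3 / of_int q^3"
      unfolding s4 using D0 by (simp add: field_simps numeral_eq_Suc)
    also have "\<dots> = of_int (8*t') * of_int D^2 * w^3" unfolding wh by (simp add: power_divide power_mult_distrib)
    finally show ?thesis .
  qed
  have "disc a = of_int q^3 * h^6"
  proof -
    have "A^3 - 27 = 2 * (D' * t'^2)" unfolding t' A_def by (simp add: power3_eq_cube power2_eq_square algebra_simps)
    then have "A^3 = D * t'^2 + 27" unfolding D by simp
    then have A3: "of_int A^3 = (of_int D * of_int t'^2 + 27 :: complex)" by (metis of_int_add of_int_mult of_int_numeral of_int_power)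
    have "1728 * disc a = 64 * of_int q^3 * h^6 * of_int A^3 - 64 * of_int t'^2 * of_int q^2 * (s * s) * h^6"
      unfolding disc_c4_c6 c4 c6 G_def H_def by (simp add: power_mult_distrib numeral_eq_Suc)
    also have "\<dots> = 1728 * (of_int q^3 * h^6)" unfolding sm A3 by (simp add: algebra_simps numeral_eq_Suc)
    finally show ?thesis by simp
  qed
  then have "lu (disc a)" using hu qu by simp
  then show ?thesis using aL r4 r6 s0 D0 by (intro bexI[of _ ?u] conjI exI[of _ a]) simp_all
qed

text \<open>Adds the twist by \<open>n\<close> to \<open>odd_scaling\<close>. As \<open>n\<close>
  divides 2, it is a unit at every odd prime and does no harm there.\<close>

lemma odd_good:
  assumes p: "p \<noteq> 2" and m: "m = q * D" and eq: "D * x^2 - q * y^2 = e * z^2" and e: "e = 1 \<or> e = -1"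
    and cop: "coprime x y" "coprime x z" "coprime y z" and E: "D * t^2 = A^3 - 1728"
    and t: "3 dvd A \<Longrightarrow> 27 dvd t" and n: "n \<in> {1, -1, 2, -2}"
  defines "W \<equiv> of_int n * (of_int (D * x) + of_int y * s)"
  shows "\<exists>u\<in>K. u \<noteq> 0 \<and> (\<exists>a. coeffs_in L a \<and> u^4 * c4 a = of_int A * of_int D * W^2 \<and>
    u^6 * c6 a = of_int t * of_int D^2 * W^3 \<and> lu (disc a))"
proof -
  define w where "w = of_int (D * x) + of_int y * s"
  obtain u where u: "u \<in> K" "u \<noteq> 0" "lu (of_int D * w^2 / u^4)" "of_int D^2 * w^3 / u^6 \<in> L"
    using odd_scaling[OF p m eq e cop] unfolding w_def by blast
  define \<delta> \<mu> where "\<delta> = of_int n^2 * (of_int D * w^2 / u^4)" and "\<mu> = of_int n^3 * (of_int D^2 * w^3 / u^6)"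
  have "\<not> p dvd 2" using p prime_p primes_dvd_imp_eq[of p 2] by auto
  moreover have "n dvd 2" using n by auto
  ultimately have "\<not> p dvd n" using dvd_trans by blast
  then have nu: "lu (of_int n)" using lu_int by blast
  have \<delta>: "lu \<delta>" unfolding \<delta>_def using u(3) nu by blast
  have \<mu>: "\<mu> \<in> L" unfolding \<mu>_def using u(4) by (intro L_mult L_power L_of_int)
  have rel: "\<mu>^2 = of_int D * \<delta>^3" unfolding \<delta>_def \<mu>_def using u(2) by (simp add: field_simps numeral_eq_Suc)
  have "\<exists>a. coeffs_in L a \<and> c4 a = of_int A * \<delta> \<and> c6 a = of_int t * \<mu> \<and> lu (disc a)"
  proof (cases "p = 3")
    case True
    show ?thesis by (rule model_p3[OF True \<delta> \<mu> rel E t])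
  next
    case False
    show ?thesis by (rule model_p5[OF p False \<delta> \<mu> rel E])
  qed
  then obtain a where a: "coeffs_in L a" "c4 a = of_int A * \<delta>" "c6 a = of_int t * \<mu>" "lu (disc a)" by blast
  have "u^4 * c4 a = of_int A * of_int D * W^2" unfolding a \<delta>_def W_def w_def[symmetric] using u(2)
    by (simp add: power_mult_distrib)
  moreover have "u^6 * c6 a = of_int t * of_int D^2 * W^3" unfolding a \<mu>_def W_def w_def[symmetric] using u(2)
    by (simp add: power_mult_distrib)
  ultimately show ?thesis using a u by blast
qed

end

section \<open>From the conditions to a curve\<close>

lemma Legendre_eq_1_E: assumes "Legendre a p = 1" obtains r where "p dvd r^2 - a"
  using assms unfolding Legendre_def QuadRes_def
  by (auto simp: cong_iff_dvd_diff split: if_splits)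

lemma eps_cases: "eps D = 1 \<or> eps D = -1" by (simp add: eps_def)

lemma eps_mult_mod_4: assumes "odd D" shows "eps D * D mod 4 = 1"
proof -
  have "D mod 4 = 1 \<or> D mod 4 = 3" using assms by presburger
  then show ?thesis by (auto simp: eps_def zmod_zminus1_eq_if)
qed

lemma eps_mult_mod_8: "D mod 8 = 1 \<or> D mod 8 = 7 \<Longrightarrow> eps D * D mod 8 = 1"
  using mod_mod_cancel[of 4 8 D] by (auto simp: eps_def zmod_zminus1_eq_if)

text \<open>The power of 2 in \<open>A^3 - 1728\<close> is known in each allowed class of
  \<open>A\<close>: it is odd for odd \<open>A\<close>, 64 times an odd number for
  \<open>A = 16 k\<close>, and 128 times an odd number for \<open>A = 16 k + 4\<close>. As
  \<open>D\<close> is squarefree, the square factors go into \<open>t\<close>, and only in the last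
  case a single 2 remains for \<open>D\<close>.\<close>

lemma good_cases:
  fixes A D t :: int
  assumes A: "2 dvd A \<Longrightarrow> 16 dvd A \<or> 16 dvd A - 4" and sf: "squarefree D" and E: "D * t^2 = A^3 - 1728"
  obtains (odd) "odd A" "odd D" "odd t" "A * D mod 4 = 1"
  | (sixteen) t' where "16 dvd A" "odd D" "t = 8 * t'" "odd t'" "D mod 8 = 5"
  | (four) k t' D' where "A = 16 * k + 4" "D = 2 * D'" "t = 8 * t'" "D' * t'^2 = 32*k^3 + 24*k^2 + 6*k - 13"
proof -
  have two: "\<exists>r'. r = 2 * r' \<and> D * r'^2 = c" if h: "D * r^2 = 4 * c" for r c :: int
  proof -
    have "2^2 dvd D * r^2" unfolding h by simp
    then have "2 dvd r" using squarefree_dvd_mult_square_int[OF sf, of 2 r] by simp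
    then obtain r' where r': "r = 2 * r'" by (rule dvdE)
    then show ?thesis using h by (simp add: power_mult_distrib)
  qed
  have eight: "\<exists>t'. t = 8 * t' \<and> D * t'^2 = c" if "D * t^2 = 64 * c" for c
  proof -
    obtain t1 where t1: "t = 2 * t1" "D * t1^2 = 16 * c" using two[of t "16 * c"] \<open>D * t^2 = 64 * c\<close> by auto
    obtain t2 where t2: "t1 = 2 * t2" "D * t2^2 = 4 * c" using two[of t1 "4 * c"] t1 by auto
    obtain t3 where t3: "t2 = 2 * t3" "D * t3^2 = c" using two[of t2 c] t2 by auto
    then show ?thesis using t1 t2 by auto
  qed
  consider "odd A" | "16 dvd A" | "16 dvd A - 4" using A by blast
  then show ?thesis
  proof cases
    case 1
    then have "odd (D * t^2)" unfolding E by simp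
    then have Dt: "odd D" "odd t" by auto
    obtain a where a: "A^2 = 8 * a + 1" using 1 by (rule odd_square_E)
    obtain b where b: "t^2 = 8 * b + 1" using Dt(2) by (rule odd_square_E)
    obtain d where d: "D^2 = 8 * d + 1" using Dt(1) by (rule odd_square_E)
    have "A * D = A * D * (8 * a + 1) - 8 * a * (A * D)" by (simp add: algebra_simps)
    also have "A * D * (8 * a + 1) = D * A^3" unfolding a[symmetric] by (simp add: power2_eq_square power3_eq_cube)
    also have "A^3 = D * t^2 + 1728" using E by simp
    also have "D * (D * t^2 + 1728) = D^2 * t^2 + 1728 * D" by (simp add: power2_eq_square algebra_simps)
    also have "\<dots> - 8 * a * (A * D) = 1 + 4 * (16 * d * b + 2 * d + 2 * b + 432 * D - 2 * a * A * D)"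
      unfolding d b by (simp add: algebra_simps)
    finally have "A * D mod 4 = 1" by (rule int_mod_eqI) simp_all
    then show ?thesis using odd 1 Dt by blast
  next
    case 2
    then obtain k where k: "A = 16 * k" by auto
    have "D * t^2 = 64 * (64 * k^3 - 27)" unfolding E k by (simp add: power_mult_distrib)
    then obtain t' where t': "t = 8 * t'" "D * t'^2 = 64 * k^3 - 27" using eight by blast
    have "odd (D * t'^2)" unfolding t' by simp
    then have Dt: "odd D" "odd t'" by auto
    obtain b where b: "t'^2 = 8 * b + 1" using Dt(2) by (rule odd_square_E)
    have "D = 5 + 8 * (8 * k^3 - 4 - D * b)" using t'(2) unfolding b by (simp add: algebra_simps)
    then have "D mod 8 = 5" by (rule int_mod_eqI) simp_all
    then show ?thesis using sixteen 2 Dt t' by blast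
  next
    case 3
    then obtain k where "A - 4 = 16 * k" by auto
    then have k: "A = 16 * k + 4" by simp
    have "D * t^2 = 64 * (2 * (32*k^3 + 24*k^2 + 6*k - 13))" unfolding E k
      by (simp add: power3_eq_cube power2_eq_square algebra_simps)
    then obtain t' where t': "t = 8 * t'" "D * t'^2 = 2 * (32*k^3 + 24*k^2 + 6*k - 13)" using eight by blast
    have "even D"
    proof (rule ccontr)
      assume D: "odd D"
      have "even (D * t'^2)" unfolding t' by simp
      then have "even t'" using D by simp
      then obtain t'' where "t' = 2 * t''" by auto
      then have "32*k^3 + 24*k^2 + 6*k - 13 = 2 * (D * t''^2)" using t'(2) by (simp add: power_mult_distrib)
      then have "even (32*k^3 + 24*k^2 + 6*k - 13)" by (metis dvd_triv_left)
      then show False by simp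
    qed
    then obtain D' where D': "D = 2 * D'" by auto
    then have "D' * t'^2 = 32*k^3 + 24*k^2 + 6*k - 13" using t'(2) by simp
    then show ?thesis using four k D' t' by blast
  qed
qed

text \<open>Because \<open>12^3 = 1728\<close>, the cube of \<open>27 k + 12\<close> differs from
  1728 by a multiple of \<open>3^6\<close>; squarefreeness of \<open>D\<close> lets \<open>t\<close>
  absorb three factors 3.\<close>

lemma three_dvd_imp_27_dvd:
  fixes A D t :: int
  assumes "27 dvd A - 12" "squarefree D" "D * t^2 = A^3 - 1728" shows "27 dvd t"
proof -
  obtain k where "A - 12 = 27 * k" using assms(1) by auto
  then have k: "A = 27 * k + 12" by simp
  have three: "\<exists>r'. r = 3 * r' \<and> D * r'^2 = c" if h: "D * r^2 = 9 * c" for r c :: int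
  proof -
    have "3^2 dvd D * r^2" unfolding h by simp
    then have "3 dvd r" using squarefree_dvd_mult_square_int[OF assms(2), of 3 r] by simp
    then obtain r' where r': "r = 3 * r'" by (rule dvdE)
    then show ?thesis using h by (simp add: power_mult_distrib)
  qed
  define c where "c = 27 * k^3 + 36 * k^2 + 16 * k"
  have "D * t^2 = 9 * (81 * c)" unfolding assms(3) k c_def
    by (simp add: power3_eq_cube power2_eq_square algebra_simps)
  then obtain t1 where t1: "t = 3 * t1" "D * t1^2 = 81 * c" using three by blast
  obtain t2 where t2: "t1 = 3 * t2" "D * t2^2 = 9 * c" using three[of t1 "9 * c"] t1 by auto
  obtain t3 where t3: "t2 = 3 * t3" using three[of t2 c] t2 by auto
  show ?thesis unfolding t1 t2 t3 by simp
qed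

context quad_field
begin

text \<open>One global short equation, with discriminant \<open>D^3 W^6\<close>, is compared with a
  separate model at each prime. The scalings \<open>u\<close> need not come from a common element,
  which is how a nontrivial ideal class does no harm.\<close>

lemma curve_of_local_models:
  assumes D: "D \<noteq> 0" and A: "A \<noteq> 0" and E: "D * t^2 = A^3 - 1728" and W: "W \<in> K" "W \<noteq> 0"
    and loc: "\<And>P p. prime_over m P p \<Longrightarrow> \<exists>u\<in>K. u \<noteq> 0 \<and> (\<exists>a. coeffs_in (local_ring m P) a \<and>
      u^4 * c4 a = of_int A * of_int D * W^2 \<and> u^6 * c6 a = of_int t * of_int D^2 * W^3 \<and> local_unit m P (disc a))"
  shows "\<exists>a. elliptic_over m a \<and> everywhere_good m a \<and> j_inv a \<in> \<rat>"
proof -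
  define C Dd where "C = of_int A * of_int D * W^2" and "Dd = of_int t * of_int D^2 * W^3"
  let ?a = "short_curve C Dd"
  have "of_int (D * t^2) = (of_int (A^3 - 1728) :: complex)" using E by simp
  then have *: "of_int D * of_int t^2 = (of_int A^3 - 1728 :: complex)" by simp
  have "1728 * disc ?a = of_int A^3 * of_int D^3 * W^6 - (of_int D * of_int t^2) * (of_int D^3 * W^6)"
    unfolding disc_c4_c6 by (simp add: C_def Dd_def power_mult_distrib numeral_eq_Suc)
  then have "1728 * disc ?a = 1728 * (of_int D^3 * W^6)" unfolding * by (simp add: algebra_simps)
  then have d: "disc ?a = of_int D^3 * W^6" by simp
  have "elliptic_over m ?a" unfolding elliptic_over_def d using D W
    by (auto simp: short_curve_def C_def Dd_def intro!: K_divide K_uminus K_mult K_power)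
  moreover have "everywhere_good m ?a" unfolding everywhere_good_def
  proof (intro allI impI)
    fix P assume "prime_ideal_OK m P"
    then obtain p where "prime_over m P p" using prime_over_exists_of_ideal by blast
    then interpret prime_over m P p .
    obtain u a where "u \<in> K" "u \<noteq> 0" "coeffs_in L a" "u^4 * c4 a = C" "u^6 * c6 a = Dd" "lu (disc a)"
      using loc[OF prime_over_axioms] unfolding C_def Dd_def by blast
    then show "good_reduction_at m P ?a" by (rule good_reduction_short)
  qed
  moreover have "j_inv ?a = of_int A ^ 3" unfolding j_inv_def d using D W
    by (simp add: C_def power_mult_distrib numeral_eq_Suc)
  then have "j_inv ?a \<in> \<rat>" by simp
  ultimately show ?thesis by blast
qed

lemma curve_of_norm_condition:
  assumes good: "good D" and mq: "m = q * D"
    and a: "\<forall>p. prime p \<and> odd p \<and> p dvd D \<longrightarrow> Legendre (- eps D * q) p = 1"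
    and b: "\<forall>l. prime l \<and> odd l \<and> l dvd q \<longrightarrow> Legendre (eps D * D) l = 1"
    and c: "eps D * D < 0 \<longrightarrow> m > 0"
    and d: "(D mod 8 = 3 \<or> D mod 8 = 5) \<longrightarrow> [q = D] (mod 4)"
    and e: "even D \<longrightarrow> [q = D + 1] (mod 8)"
  shows "\<exists>a. elliptic_over m a \<and> everywhere_good m a \<and> j_inv a \<in> \<rat>"
proof -
  obtain A t0 where sfD: "squarefree D" and A: "A \<in> R_set" and E0: "D * t0^2 = A^3 - 1728"
    using good by (auto simp: good_def)
  have A2: "2 dvd A \<Longrightarrow> 16 dvd A \<or> 16 dvd A - 4" and A3: "3 dvd A \<Longrightarrow> 27 dvd A - 12"
    using A by (auto simp: R_set_def)
  have A0: "A \<noteq> 0" using A3 by auto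
  have D0: "D \<noteq> 0" "q \<noteq> 0" using m0 mq by auto
  have "\<exists>x y z. D * x^2 - q * y^2 = eps D * z^2 \<and> coprime x y \<and> coprime x z \<and> coprime y z"
  proof (rule legendre_norm_form[OF _ eps_cases])
    show "squarefree (q * D)" using sqfree mq by simp
    show "\<exists>r. p dvd r^2 - - eps D * q" if "prime p" "odd p" "p dvd D" for p
      using a that Legendre_eq_1_E by metis
    show "\<exists>r. p dvd r^2 - eps D * D" if "prime p" "odd p" "p dvd q" for p
      using b that Legendre_eq_1_E by metis
    show "eps D * D < 0 \<Longrightarrow> 0 < q * D" using c mq by simp
  qed
  then obtain x y z where eq: "D * x^2 - q * y^2 = eps D * z^2"
    and cop: "coprime x y" "coprime x z" "coprime y z" by blast
  define w where "w = of_int (D * x) + of_int y * s"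
  have wK: "w \<in> K" unfolding w_def by (intro K_add K_mult K_of_int K_s)
  have w_em: "w = em (of_int (D * x)) (of_int y)" unfolding w_def em_def by (simp add: of_rat_mult)
  have w0: "w \<noteq> 0" unfolding w_em em_0_iff using cop(1) D0 by auto
  have ev: "\<not> (even u \<and> even v)" if "coprime u v" for u v :: int
    using that by (meson coprime_common_divisor odd_one)
  have finish: ?thesis
    if E: "D * t^2 = A^3 - 1728" and n: "n \<in> {1, -1, 2, -2}"
      and two: "\<And>P. prime_over m P 2 \<Longrightarrow> \<exists>u\<in>K. u \<noteq> 0 \<and> (\<exists>a. coeffs_in (local_ring m P) a \<and>
      u^4 * c4 a = of_int A * of_int D * (of_int n * w)^2 \<and>
      u^6 * c6 a = of_int t * of_int D^2 * (of_int n * w)^3 \<and> local_unit m P (disc a))" for t n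
  proof (rule curve_of_local_models[OF D0(1) A0 E])
    show "of_int n * w \<in> K" using wK by simp
    show "of_int n * w \<noteq> 0" using w0 n by auto
    have t27: "3 dvd A \<Longrightarrow> 27 dvd t" using three_dvd_imp_27_dvd[OF A3 sfD E] .
    fix P p assume P: "prime_over m P p"
    show "\<exists>u\<in>K. u \<noteq> 0 \<and> (\<exists>a. coeffs_in (local_ring m P) a \<and>
      u^4 * c4 a = of_int A * of_int D * (of_int n * w)^2 \<and>
      u^6 * c6 a = of_int t * of_int D^2 * (of_int n * w)^3 \<and> local_unit m P (disc a))"
    proof (cases "p = 2")
      case True
      then show ?thesis using two P by simp
    next
      case False
      show ?thesis unfolding w_def
        by (rule prime_over.odd_good[OF P False mq eq eps_cases cop E t27 n])
    qed
  qed
  have finish_odd: ?thesis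
    if E: "D * t^2 = A^3 - 1728" and D: "odd D"
    and At: "odd A \<and> A * D mod 4 = 1 \<and> t mod 4 = 3 \<or> 16 dvd A \<and> 8 dvd t \<and> (t div 8) mod 4 = 1" for t
  proof -
    have "\<exists>n::int. n \<in> {1, -1, 2, -2} \<and> sq4 (of_int n * w)" unfolding w_def
    proof (rule two_adic_twist[OF D mq eps_mult_mod_4[OF D]])
      \<comment> \<open>The role of (d): if \<open>D\<close> is 3 or 5 modulo 8, then
        \<open>q = D\<close> modulo 4 makes \<open>m = q D\<close> congruent to 1 modulo 4.\<close>
      show "eps D * D mod 8 = 1" if m4: "m mod 4 \<noteq> 1"
      proof (rule eps_mult_mod_8, rule ccontr)
        assume "\<not> (D mod 8 = 1 \<or> D mod 8 = 7)"
        then have "D mod 8 = 3 \<or> D mod 8 = 5" using D by presburger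
        then obtain j where "q = D + 4 * j" using d cong_E by metis
        moreover obtain i where "D^2 = 8 * i + 1" using D by (rule odd_square_E)
        ultimately have "m = 1 + 4 * (2 * i + j * D)" unfolding mq by (simp add: power2_eq_square algebra_simps)
        then have "m mod 4 = 1" by (rule int_mod_eqI) simp_all
        then show False using m4 by simp
      qed
      show "(D * x)^2 - m * y^2 = eps D * D * z^2"
      proof -
        have "(D * x)^2 - m * y^2 = D * (D * x^2 - q * y^2)" unfolding mq by (simp add: power2_eq_square algebra_simps)
        then show ?thesis unfolding eq by simp
      qed
      show "odd y \<and> odd z \<or> odd y \<and> even z \<and> odd (D * x) \<or> even y \<and> odd z"
        using ev[OF cop(1)] ev[OF cop(2)] ev[OF cop(3)] D by auto
      show "z \<noteq> 0"
      proof
        assume "z = 0"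
        then have "D * (D * x^2 - q * y^2) = 0" using eq by simp
        then have "(D * x)^2 - m * y^2 = 0" unfolding mq by (simp add: power2_eq_square algebra_simps)
        then have "N w = 0" unfolding w_em N_em by (metis of_int_0 of_int_diff of_int_mult of_int_power)
        then show False using N_0_iff wK w0 by blast
      qed
    qed
    then obtain n where n: "n \<in> {1, -1, 2, -2}" "sq4 (of_int n * w)" by blast
    show ?thesis
    proof (rule finish[OF E n(1)])
      fix P assume P: "prime_over m P 2"
      then interpret prime_over m P 2 .
      obtain \<sigma> \<phi> where \<sigma>: "\<sigma> \<in> K" "\<sigma> \<noteq> 0" "one4 \<phi>" "of_int n * w = \<sigma>^2 * \<phi>"
        using n(2) P unfolding sq4_def by blast
      obtain a where "coeffs_in L a" "c4 a = of_int A * (of_int D * \<phi>^2)"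
        "c6 a = of_int t * (of_int D^2 * \<phi>^3)" "lu (disc a)"
        using model_p2[OF refl \<sigma>(3) E D At] by blast
      then show "\<exists>u\<in>K. u \<noteq> 0 \<and> (\<exists>a. coeffs_in L a \<and>
        u^4 * c4 a = of_int A * of_int D * (of_int n * w)^2 \<and>
        u^6 * c6 a = of_int t * of_int D^2 * (of_int n * w)^3 \<and> lu (disc a))"
        using \<sigma>(1,2) unfolding \<sigma>(4)
        by (intro bexI[of _ \<sigma>] conjI exI[of _ a]) (simp_all add: power_mult_distrib flip: power_mult)
    qed
  qed
  show ?thesis
  proof (rule good_cases[OF A2 sfD E0])
    assume odd: "odd A" "odd D" "odd t0" "A * D mod 4 = 1"
    show ?thesis
    \<comment> \<open>Only the square of \<open>t0\<close> enters the defining equation, so its sign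
      may be chosen to suit \<open>model_p2\<close>.\<close>
    proof (cases "t0 mod 4 = 3")
      case True
      then show ?thesis using finish_odd[OF E0 odd(2)] odd by blast
    next
      case False
      then have "(- t0) mod 4 = 3" using odd(3) by presburger
      then show ?thesis using finish_odd[of "- t0", OF _ odd(2)] E0 odd by simp
    qed
  next
    fix t' assume sixteen: "16 dvd A" "odd D" "t0 = 8 * t'" "odd t'" "D mod 8 = 5"
    show ?thesis
    proof (cases "t' mod 4 = 1")
      case True
      then show ?thesis using finish_odd[OF E0 sixteen(2)] sixteen by simp
    next
      case False
      then have "(- t') mod 4 = 1" using sixteen(4) by presburger
      moreover have "(- t0) = 8 * (- t')" using sixteen by simp
      ultimately have "8 dvd - t0 \<and> (- t0) div 8 mod 4 = 1"
        by (metis dvd_triv_left nonzero_mult_div_cancel_left zero_neq_numeral)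
      then show ?thesis using finish_odd[of "- t0", OF _ sixteen(2)] E0 sixteen(1) by simp
    qed
  next
    fix k t' D' assume four: "A = 16 * k + 4" "D = 2 * D'" "t0 = 8 * t'" "D' * t'^2 = 32*k^3 + 24*k^2 + 6*k - 13"
    have qD: "[q = D + 1] (mod 8)" using e four by simp
    obtain j where j: "q = D + 1 + 8 * j" using qD by (rule cong_E)
    have ep: "eps D = -1" unfolding eps_def using four(2) by presburger
    have odd_rhs: "odd (D' * t'^2)" unfolding four(4) by simp
    then have D'o: "odd D'" "odd t'" by auto
    have eq1: "q * y^2 = z^2 + D * x^2" using eq unfolding ep by simp
    have yo: "odd y"
    proof
      assume y: "even y"
      then have "even (z^2 + D * x^2)" unfolding eq1[symmetric] by simp
      then have "even z" using four(2) by simp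
      then show False using ev[OF cop(3)] y by blast
    qed
    have "odd (q * y^2)" using yo j four(2) by simp
    then have zo: "odd z" unfolding eq1 using four(2) by simp
    obtain Y where Y: "y^2 = 8 * Y + 1" using yo by (rule odd_square_E)
    obtain Z where Z: "z^2 = 8 * Z + 1" using zo by (rule odd_square_E)
    \<comment> \<open>Modulo 8, with \<open>y\<close> and \<open>z\<close> odd and
      \<open>q = D + 1\<close>, the equation reads \<open>D = D x^2\<close>. This fails for even
      \<open>x\<close> because \<open>D\<close> is 2 modulo 4.\<close>
    have xo: "odd x"
    proof
      assume "even x"
      then obtain x' where x': "x = 2 * x'" by auto
      have "2 * D' = 8 * (Z + D' * x'^2 - q * Y - j)" using eq1 unfolding Y Z x'
        by (simp add: j four(2) power2_eq_square algebra_simps)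
      then have "D' = 2 * (2 * (Z + D' * x'^2 - q * Y - j))" by simp
      then have "even D'" by (rule dvdI)
      then show False using D'o(1) by simp
    qed
    \<comment> \<open>Half of \<open>b2\<close> in the model to come, fixed by the parity of
      \<open>k\<close>; the sign of \<open>t'\<close> is then adjusted so that
      \<open>\<beta> x = - t'\<close> modulo 4.\<close>
    define \<beta> :: int where "\<beta> = (if even k then 1 else 3)"
    have "odd (\<beta> * x)" unfolding \<beta>_def using xo by simp
    moreover have "odd b \<Longrightarrow> odd t \<Longrightarrow> b mod 4 = - t mod 4 \<or> b mod 4 = - (- t) mod 4" for b t :: int
      by presburger
    ultimately have "[\<beta> * x = - t'] (mod 4) \<or> [\<beta> * x = - (- t')] (mod 4)"
      using D'o(2) unfolding cong_def by blast
    then obtain t'' where t'': "t'' = t' \<or> t'' = - t'" "[\<beta> * x = - t''] (mod 4)" by blast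
    have E: "D * (8 * t'')^2 = A^3 - 1728" using E0 t''(1) four(3) by auto
    have D't: "D' * t''^2 = 32*k^3 + 24*k^2 + 6*k - 13" using four(4) t''(1) by auto
    show ?thesis
    \<comment> \<open>The sign of \<open>t''\<close> has already been chosen, and no further twist
      is made.\<close>
    proof (rule finish[OF E, of 1])
      fix P assume P: "prime_over m P 2"
      show "\<exists>u\<in>K. u \<noteq> 0 \<and> (\<exists>a. coeffs_in (local_ring m P) a \<and>
        u^4 * c4 a = of_int A * of_int D * (of_int 1 * w)^2 \<and>
        u^6 * c6 a = of_int (8 * t'') * of_int D^2 * (of_int 1 * w)^3 \<and> local_unit m P (disc a))"
        using prime_over.model_p2_even[OF P refl mq four(2) D't qD xo yo t''(2) \<beta>_def]
        unfolding w_def four(1) by simp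
    qed simp
  qed
qed

end

subsection \<open>The norm of the discriminant\<close>

text \<open>Multiplication by the twelfth power of the denominator turns \<open>r\<close> into the
  integer \<open>u v^11\<close>. Each local condition says that its multiplicity at \<open>p\<close>
  is divisible by 12, and an integer with this property at all primes is a twelfth power up to
  sign.\<close>

lemma rat_nth_power_local_global:
  fixes r :: rat
  assumes r: "r \<noteq> 0"
    and loc: "\<And>p::int. prime p \<Longrightarrow> \<exists>y a b. \<not> p dvd a \<and> \<not> p dvd b \<and> r * of_int b = y ^ 12 * of_int a"
  shows "\<exists>n. n > 0 \<and> \<bar>r\<bar> = n ^ 12"
proof -
  obtain u v where uv: "v > 0" "coprime u v" "r = of_int u / of_int v" by (rule rat_quotient_E)
  have u0: "u \<noteq> 0" using r uv by auto
  define R where "R = u * v ^ 11"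
  have R0: "R \<noteq> 0" using u0 uv by (simp add: R_def)
  have Rr: "of_int R = r * of_int v ^ 12" using uv by (simp add: R_def numeral_eq_Suc)
  have "12 dvd multiplicity p R" if p: "prime p" for p
  proof -
    obtain y a b where yab: "\<not> p dvd a" "\<not> p dvd b" "r * of_int b = y ^ 12 * of_int a" using loc[OF p] by blast
    obtain c d where cd: "d > 0" "coprime c d" "y = of_int c / of_int d" by (rule rat_quotient_E)
    have b0: "b \<noteq> 0" "a \<noteq> 0" using yab by auto
    have c0: "c \<noteq> 0" using yab(3) cd r b0 by auto
    have "of_int (R * b * d ^ 12) = (r * of_int b) * of_int v ^ 12 * of_int d ^ 12" by (simp add: Rr)
    also have "\<dots> = of_int ((c * v) ^ 12 * a)" unfolding yab(3) cd(3) using cd(1)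
      by (simp add: power_divide power_mult_distrib)
    finally have e: "R * b * d ^ 12 = (c * v) ^ 12 * a" by (simp only: of_int_eq_iff)
    have mz: "multiplicity p a = 0" "multiplicity p b = 0" using yab by (auto simp: not_dvd_imp_multiplicity_0)
    have pe: "prime_elem p" by (rule prime_imp_prime_elem[OF p])
    have "multiplicity p (R * b * d ^ 12) = multiplicity p R + 12 * multiplicity p d"
      using R0 b0 cd(1) mz pe by (simp add: prime_elem_multiplicity_mult_distrib prime_elem_multiplicity_power_distrib)
    moreover have "multiplicity p ((c * v) ^ 12 * a) = 12 * multiplicity p (c * v)"
      using c0 b0 uv(1) mz pe by (simp add: prime_elem_multiplicity_mult_distrib prime_elem_multiplicity_power_distrib)
    ultimately have "multiplicity p R + 12 * multiplicity p d = 12 * multiplicity p (c * v)" using e by simp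
    then show ?thesis by presburger
  qed
  then have "is_nth_power 12 (normalize R)" using is_nth_power_conv_multiplicity[of 12 R] by simp
  then obtain w where w: "\<bar>R\<bar> = w ^ 12" by (auto elim: is_nth_powerE)
  have w0: "w \<noteq> 0" using w R0 by auto
  have "\<bar>r\<bar> * of_int v ^ 12 = of_int (\<bar>w\<bar> ^ 12)"
  proof -
    have "\<bar>r\<bar> * of_int v ^ 12 = \<bar>r * of_int v ^ 12\<bar>" using uv(1) by (simp add: abs_mult)
    also have "\<dots> = of_int \<bar>R\<bar>" unfolding Rr[symmetric] by simp
    also have "\<dots> = of_int (\<bar>w\<bar> ^ 12)" unfolding w by (simp add: power_even_abs)
    finally show ?thesis .
  qed
  then have "\<bar>r\<bar> = (of_int \<bar>w\<bar> / of_int v) ^ 12" using uv(1) by (simp add: power_divide field_simps)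
  moreover have "of_int \<bar>w\<bar> / of_int v > (0::rat)" using w0 uv(1) by simp
  ultimately show ?thesis by blast
qed

lemma rat_power_Ints:
  fixes r :: rat assumes "r ^ k \<in> \<int>" "k > 0" shows "r \<in> \<int>"
proof -
  obtain u v where uv: "v > 0" "coprime u v" "r = of_int u / of_int v" by (rule rat_quotient_E)
  obtain z where "r ^ k = of_int z" using assms(1) by (auto elim: Ints_cases)
  then have "of_int (u ^ k) = (of_int (z * v ^ k) :: rat)" using uv by (simp add: power_divide field_simps)
  then have "u ^ k = z * v ^ k" by (simp only: of_int_eq_iff)
  then have "v dvd u ^ k" using assms(2) by (simp add: dvd_power)
  moreover have "coprime v (u ^ k)" using uv(2) by (simp add: coprime_commute)
  ultimately have "is_unit v" using coprime_absorb_left by blast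
  then show ?thesis using uv by simp
qed

context prime_over
begin

text \<open>True at ramified and inert primes, where \<open>P\<close> is the only prime above
  \<open>p\<close>; false at split ones.\<close>

definition stable :: bool where "stable \<longleftrightarrow> (\<forall>x\<in>P. cj x \<in> P)"

text \<open>If \<open>p\<close> divides \<open>x cj x\<close>, then \<open>x\<close> or its
  conjugate lies in \<open>P\<close>, and stability identifies the two alternatives.\<close>

lemma stable_norm:
  assumes stable "x \<in> OK" "N x = of_int n" shows "x \<in> P \<longleftrightarrow> p dvd n"
proof -
  have "(of_rat (N x) :: complex) = x * cj x" using N_cj assms by blast
  then have e: "x * cj x = of_int n" by (simp add: assms)
  show ?thesis
  proof
    assume "x \<in> P"
    then have "x * cj x \<in> P" using P_mult2 assms by blast
    then show "p dvd n" using e int_in_P by simp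
  next
    assume "p dvd n"
    then have "x * cj x \<in> P" using e int_in_P by simp
    then have "x \<in> P \<or> cj x \<in> P" using P_prime assms by blast
    moreover have "cj (cj x) = x" using assms by simp
    ultimately show "x \<in> P" using assms(1) unfolding stable_def by metis
  qed
qed

lemma lu_of_rat: assumes "lu (of_rat r)" shows "\<exists>a b. \<not> p dvd a \<and> \<not> p dvd b \<and> r = of_int a / of_int b"
proof -
  obtain a b where ab: "\<not> p dvd b" "r = of_int a / of_int b" using rat_in_L lu_L[OF assms] by blast
  have b0: "of_int b \<noteq> (0::complex)" using ab by auto
  have "of_int a = of_rat r * (of_int b :: complex)" using ab b0 by (simp add: of_rat_divide)
  then have "lu (of_int a)" using assms lu_int ab by (metis lu_mult)
  then show ?thesis using ab lu_int by blast
qed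

lemma lu_prime_power: assumes "lu (of_int p powi k)" shows "k = 0"
proof (rule ccontr)
  assume "k \<noteq> 0"
  have p0: "of_int p \<noteq> (0::complex)" using prime_p by auto
  have "lu (of_int p powi \<bar>k\<bar>)"
    using assms lu_inverse[OF assms] by (auto simp: abs_if power_int_minus)
  then have "lu (of_int p ^ nat \<bar>k\<bar>)" by (simp add: power_int_def)
  then have "lu (of_int p)" by (rule lu_of_power[rotated 2]) (use \<open>k \<noteq> 0\<close> in auto)
  then show False using lu_int by simp
qed

end

text \<open>The consequences of good reduction from which the conditions are derived:
  \<open>A\<close> is the integer cube root of \<open>j\<close>, and \<open>n\<close> is the
  positive twelfth root of the absolute norm of the discriminant. Such a rational \<open>n\<close>
  exists although the discriminant need not be a twelfth power in the field.\<close>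

locale good_curve = quad_field +
  fixes a :: wcoeffs and A :: int and n :: rat
  assumes ell: "elliptic_over m a" and goodr: "everywhere_good m a"
    and jA: "c4 a ^ 3 = of_int A ^ 3 * disc a" and n0: "n > 0" and nn: "\<bar>N (disc a)\<bar> = n ^ 12"

context quad_field
begin

text \<open>Locally the discriminant is \<open>v^12\<close> times a unit. At a stable prime the norm
  of that unit is prime to \<open>p\<close>, and \<open>N v\<close> is the required root. At an
  unramified prime the conjugate factor is controlled by a second model at the conjugate
  prime.\<close>

lemma norm_disc_power:
  assumes ell: "elliptic_over m a" and good: "everywhere_good m a"
  shows "\<exists>n. n > 0 \<and> \<bar>N (disc a)\<bar> = n ^ 12"
proof (rule rat_nth_power_local_global)
  obtain a1 a2 a3 a4 a6 where e: "a = (a1, a2, a3, a4, a6)" by (metis prod_cases5)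
  have dK: "disc a \<in> K" "disc a \<noteq> 0" using ell unfolding elliptic_over_def e by (auto simp: Let_def)
  then show "N (disc a) \<noteq> 0" using N_0_iff by blast
  fix p :: int assume "prime p"
  then obtain P where P: "prime_over m P p"
    "(\<forall>x\<in>P. cj x \<in> P) \<or> prime_over.unram m P p" using prime_exists by blast
  interpret prime_over m P p using P by simp
  obtain v a' where v: "v \<in> K" "v \<noteq> 0" "disc a' \<in> OK" "disc a' \<notin> P" "disc a = v^12 * disc a'"
    using integral_model good prime_ideal unfolding everywhere_good_def by blast
  from P(2) show "\<exists>y i j. \<not> p dvd i \<and> \<not> p dvd j \<and> N (disc a) * of_int j = y ^ 12 * of_int i"
  proof
    assume st: "\<forall>x\<in>P. cj x \<in> P"
    obtain d where d: "N (disc a') = of_int d" using OK_N_int v by blast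
    have "\<not> p dvd d" using stable_norm[OF _ v(3) d] v(4) st by (auto simp: stable_def)
    moreover have "N (disc a) = N v ^ 12 * of_int d" unfolding v(5) using v by (simp add: N_mult N_power d)
    ultimately show ?thesis by (intro exI[of _ "N v"] exI[of _ d] exI[of _ 1]) (use prime_p in auto)
  next
    assume un: unram
    interpret Q: prime_over m "cj ` P" p by (rule prime_over_cj) (rule P(1))
    obtain v2 a2 where v2: "v2 \<in> K" "v2 \<noteq> 0" "disc a2 \<in> OK" "disc a2 \<notin> cj ` P" "disc a = v2^12 * disc a2"
      using Q.integral_model good Q.prime_ideal unfolding everywhere_good_def by blast
    have "cj (disc a2) \<notin> P"
    proof
      assume "cj (disc a2) \<in> P"
      then have "cj (cj (disc a2)) \<in> cj ` P" by blast
      then show False using v2 by simp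
    qed
    then have lu2: "lu (cj (disc a2))" using lu_OK v2 by blast
    \<comment> \<open>Both scaling factors are brought to \<open>P\<close>, so that the norm is
      \<open>y^12\<close> times a unit of \<open>L\<close>. Replacing \<open>y\<close> by the power
      of \<open>p\<close> with the same valuation makes the twelfth power rational.\<close>
    define y where "y = v * cj v2"
    have y: "y \<in> K" "y \<noteq> 0" using v v2 by (auto simp: y_def)
    obtain k where k: "lu (y / of_int p powi k)" using unram_val[OF un y] by blast
    have p0: "of_int p \<noteq> (0::complex)" "of_int p \<noteq> (0::rat)" using prime_p by auto
    have pk: "of_rat (of_int p powi k) = (of_int p powi k :: complex)"
      by (simp add: power_int_def of_rat_power of_rat_inverse)
    have "of_rat (N (disc a)) = disc a * cj (disc a)" using N_cj dK by blast
    also have "\<dots> = (v^12 * disc a') * (cj v2^12 * cj (disc a2))"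
      unfolding v(5)[symmetric] using v2 by (simp add: cj_mult cj_power)
    also have "\<dots> = (of_int p powi k)^12 * ((y / of_int p powi k)^12 * (disc a' * cj (disc a2)))"
      using p0 by (simp add: y_def power_divide power_mult_distrib)
    finally have "of_rat (N (disc a) / (of_int p powi k)^12) = (y / of_int p powi k)^12 * (disc a' * cj (disc a2))"
      using p0 by (simp add: of_rat_divide of_rat_power pk)
    moreover have "lu ((y / of_int p powi k)^12 * (disc a' * cj (disc a2)))"
      using k lu2 v lu_OK by blast
    ultimately obtain i j where ij: "\<not> p dvd i" "\<not> p dvd j" "N (disc a) / (of_int p powi k)^12 = of_int i / of_int j"
      using lu_of_rat by metis
    have "j \<noteq> 0" using ij by auto
    then have "N (disc a) * of_int j = (of_int p powi k)^12 * of_int i" using ij(3) p0 by (simp add: field_simps)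
    then show ?thesis using ij by blast
  qed
qed

text \<open>At every prime \<open>j\<close> is \<open>c4^3\<close> divided by a unit, so it is
  integral. Norms of \<open>c4^3 = j \<Delta>\<close> give \<open>j^2 = g^3\<close> with
  \<open>g = |N c4| / n^4\<close>; then \<open>j = (j / g)^3\<close>, and a rational cube root of an
  integer is an integer.\<close>

lemma good_curve_exists:
  assumes ell: "elliptic_over m a" and good: "everywhere_good m a" and j: "j_inv a \<in> \<rat>"
  shows "\<exists>A n. good_curve m a A n"
proof -
  obtain a1 a2 a3 a4 a6 where e: "a = (a1, a2, a3, a4, a6)" by (metis prod_cases5)
  have dK: "disc a \<in> K" "disc a \<noteq> 0" "c4 a \<in> K" using ell unfolding elliptic_over_def e by (auto simp: Let_def)
  obtain n where n: "n > 0" "\<bar>N (disc a)\<bar> = n ^ 12" using norm_disc_power[OF ell good] by blast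
  obtain r where r: "j_inv a = of_rat r" using j by (auto elim: Rats_cases)
  then have cr: "c4 a ^ 3 = of_rat r * disc a" using dK by (simp add: j_inv_def field_simps)
  have "r \<in> \<int>"
  proof -
    obtain u v where uv: "v > 0" "coprime u v" "r = of_int u / of_int v" by (rule rat_quotient_E)
    have "v = 1"
    proof (rule ccontr)
      assume "v \<noteq> 1"
      then have "\<not> is_unit v" using uv by auto
      then obtain p where p: "prime p" "p dvd v" using uv(1) prime_divisor_exists[of v] by auto
      then obtain P where P: "prime_over m P p" using prime_exists by blast
      interpret prime_over m P p using P by simp
      obtain w a' where w: "w \<in> K" "w \<noteq> 0" "coeffs_in OK a'" "disc a' \<in> OK" "disc a' \<notin> P" "c4 a = w^4 * c4 a'" "disc a = w^12 * disc a'"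
        using integral_model good prime_ideal unfolding everywhere_good_def by blast
      obtain b1 b2 b3 b4 b6 where e': "a' = (b1, b2, b3, b4, b6)" by (metis prod_cases5)
      have "c4 a' \<in> OK" using w(3) unfolding e' by (auto simp: Let_def)
      moreover have "w^12 * c4 a' ^ 3 = w^12 * (of_rat r * disc a')" using cr unfolding w(6,7)
        by (simp add: power_mult_distrib flip: power_mult)
      then have "of_rat r = c4 a' ^ 3 / disc a'" using w P_0 by (auto simp: field_simps)
      ultimately have "of_rat r \<in> L" using w(4,5) lu_OK by auto
      then obtain c d where cd: "\<not> p dvd d" "r = of_int c / of_int d" using rat_in_L by blast
      have "d \<noteq> 0" using cd by auto
      then have "of_int (u * d) = (of_int (c * v) :: rat)" using cd uv by (simp add: field_simps)
      then have "u * d = c * v" by (simp only: of_int_eq_iff)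
      then have "p dvd u * d" using p by simp
      then have "p dvd u" using cd p prime_dvd_mult_iff by blast
      then show False using uv(2) p by (meson coprime_common_divisor not_prime_unit)
    qed
    then show ?thesis using uv by simp
  qed
  have "N (c4 a) ^ 3 = r^2 * N (disc a)"
    using arg_cong[OF cr, of N] dK by (simp add: N_mult N_power)
  then have "\<bar>N (c4 a)\<bar> ^ 3 = r^2 * n ^ 12" by (simp add: abs_mult flip: n(2) power_abs)
  then have r2: "r^2 = (\<bar>N (c4 a)\<bar> / n^4)^3" using n(1) by (simp add: power_divide flip: power_mult)
  define g where "g = \<bar>N (c4 a)\<bar> / n^4"
  have "\<exists>\<rho>. \<rho>^3 = r"
  proof (cases "r = 0")
    case True then show ?thesis by (intro exI[of _ 0]) simp
  next
    case False
    then have "g \<noteq> 0" using r2 unfolding g_def by auto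
    then have "(r / g)^3 = r" using r2 False unfolding g_def[symmetric]
      by (simp add: power_divide) (simp add: power3_eq_cube power2_eq_square)
    then show ?thesis by blast
  qed
  then obtain \<rho> where \<rho>: "\<rho>^3 = r" by blast
  then have "\<rho> \<in> \<int>" using \<open>r \<in> \<int>\<close> rat_power_Ints[of \<rho> 3] by simp
  then obtain A where A: "\<rho> = of_int A" by (auto elim: Ints_cases)
  have "c4 a ^ 3 = of_int A ^ 3 * disc a" using cr \<rho> A by (auto simp: of_rat_power)
  then have "good_curve m a A n" using ell good n by unfold_locales
  then show ?thesis by blast
qed

end

section \<open>The shape of \<open>A\<close> at 2\<close>

lemma square_dvd_mult_odd_power:
  fixes A \<nu> :: int assumes "(2^k)^2 dvd A^2 * \<nu>^4" "odd \<nu>" shows "2^k dvd A"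
proof -
  have "coprime ((2^k)^2) (\<nu>^4)" using assms(2) by simp
  then have "(2^k)^2 dvd A^2" using assms(1) coprime_dvd_mult_left_iff by blast
  then show ?thesis by simp
qed

lemma cube_eq_1728_iff: "A^3 = 1728 \<longleftrightarrow> A = 12" for A :: int
proof
  assume h: "A^3 = 1728"
  have "(A - 12) * ((A + 6)^2 + 108) = A^3 - 1728" by (simp add: power2_eq_square power3_eq_cube algebra_simps)
  then have "(A - 12) * ((A + 6)^2 + 108) = 0" using h by simp
  moreover have "(A + 6)^2 + 108 \<noteq> 0" by (smt (verit) zero_le_power2)
  ultimately show "A = 12" by simp
qed simp

text \<open>For good reduction above 2 the invariants are determined modulo squares: the following
  identities express them through \<open>a\<^sub>1\<close> and \<open>a\<^sub>3\<close> modulo 4.\<close>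

lemma c4_mult_c6_mod_4:
  "c4 (a1, a2, a3, a4, a6) * c6 (a1, a2, a3, a4, a6) = - (a1^10) + 4 *
    ((a1^2 + 4*a2)^2 * (9 * (a1^2 + 4*a2) * (2*a4 + a1*a3) - 54 * (a3^2 + 4*a6))
      - 6 * (2*a4 + a1*a3) * (36 * (a1^2 + 4*a2) * (2*a4 + a1*a3) - (a1^2 + 4*a2)^3 - 216 * (a3^2 + 4*a6))
      - a2 * ((a1^2 + 4*a2)^4 + (a1^2 + 4*a2)^3 * a1^2 + (a1^2 + 4*a2)^2 * a1^4 + (a1^2 + 4*a2) * a1^6 + a1^8))"
proof -
  define B b b' where "B = a1^2 + 4*a2" and "b = 2*a4 + a1*a3" and "b' = a3^2 + 4*a6"
  have a2: "4 * a2 = B - a1^2" by (simp add: B_def)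
  \<comment> \<open>The factorisation of \<open>B^5 - (a1^2)^5\<close>, with \<open>4 a2\<close> as
    the factor \<open>B - a1^2\<close>. It replaces the main term \<open>B^5\<close> by
    \<open>a1^10\<close> up to a multiple of 4.\<close>
  have S: "4 * (a2 * (B^4 + B^3 * a1^2 + B^2 * a1^4 + B * a1^6 + a1^8)) = B^5 - a1^10"
  proof -
    have "4 * (a2 * (B^4 + B^3 * a1^2 + B^2 * a1^4 + B * a1^6 + a1^8))
        = (B - a1^2) * (B^4 + B^3 * a1^2 + B^2 * a1^4 + B * a1^6 + a1^8)"
      unfolding a2[symmetric] by simp
    then show ?thesis by (simp add: algebra_simps numeral_eq_Suc)
  qed
  have c: "c4 (a1, a2, a3, a4, a6) = B^2 - 24 * b" "c6 (a1, a2, a3, a4, a6) = 36 * B * b - B^3 - 216 * b'"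
    unfolding c4_altdef c6_def by (simp_all add: B_def b_def b'_def)
  have "c4 (a1, a2, a3, a4, a6) * c6 (a1, a2, a3, a4, a6) = - (B^5) + 4 * (B^2 * (9 * B * b - 54 * b') - 6 * b * (36 * B * b - B^3 - 216 * b'))"
    unfolding c by (simp add: algebra_simps numeral_eq_Suc)
  also have "\<dots> = - (a1^10) + 4 * (B^2 * (9 * B * b - 54 * b') - 6 * b * (36 * B * b - B^3 - 216 * b') - a2 * (B^4 + B^3 * a1^2 + B^2 * a1^4 + B * a1^6 + a1^8))"
    using S by (simp add: algebra_simps)
  finally show ?thesis unfolding B_def b_def b'_def .
qed

lemma invariants_even_a1:
  "c4 (2 * \<alpha>, a2, a3, a4, a6) = 16 * ((\<alpha>^2 + a2)^2 - 3 * (a4 + \<alpha> * a3))"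
  "c6 (2 * \<alpha>, a2, a3, a4, a6) = 8 * (a3^2 + 4 * (9 * (\<alpha>^2 + a2) * (a4 + \<alpha> * a3) - 2 * (\<alpha>^2 + a2)^3 - 7 * a3^2 - 27 * a6))"
  unfolding c4_altdef c6_def by (simp_all add: algebra_simps power2_eq_square power3_eq_cube)

context quad_field
begin

lemma N_uminus: "x \<in> K \<Longrightarrow> N (- x) = N x"
  using N_mult[of "-1" x] N_of_int[of "-1"] by simp

text \<open>\<open>i\<close> is the trace of \<open>x cj y\<close>. For \<open>m\<close> not 1
  modulo 4 all traces of integers are even; this extra factor 2 turns congruences modulo 4 into
  congruences modulo 8.\<close>

lemma N_add_mult:
  assumes "x \<in> OK" "y \<in> OK"
  shows "\<exists>i k::int. N (x + of_int c * y) = N x + of_int (c * i + c^2 * k) \<and> N y = of_int k \<and> (m mod 4 \<noteq> 1 \<longrightarrow> even i)"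
proof -
  obtain a b where x: "x = of_int a + of_int b * om" using assms OK_E by blast
  obtain d e where y: "y = of_int d + of_int e * om" using assms OK_E by blast
  have xy: "x + of_int c * y = of_int (a + c * d) + of_int (b + c * e) * om" by (simp add: x y algebra_simps)
  define i where "i = 2 * a * d + tau * (a * e + b * d) + 2 * nu * b * e"
  define k where "k = d^2 + tau * d * e + nu * e^2"
  have e: "(a + c * d)^2 + tau * (a + c * d) * (b + c * e) + nu * (b + c * e)^2
      = (a^2 + tau * a * b + nu * b^2) + (c * i + c^2 * k)"
    unfolding i_def k_def by (simp add: power2_eq_square algebra_simps)
  have "N (x + of_int c * y) = N x + of_int (c * i + c^2 * k)"
    unfolding xy unfolding x N_Kint e by (simp only: of_int_add)
  moreover have "N y = of_int k" unfolding y N_Kint k_def ..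
  moreover have "m mod 4 \<noteq> 1 \<longrightarrow> even i" by (simp add: i_def tau_def)
  ultimately show ?thesis by blast
qed

lemma OK_s_E: assumes "x \<in> OK" "m mod 4 \<noteq> 1" obtains a b :: int where "x = of_int a + of_int b * s"
  using assms OK_E[of x] om_cases by metis

lemma N_s_form: "N (of_int a + of_int b * s) = of_int (a^2 - m * b^2)"
  using N_em[of "of_int a" "of_int b"] by (simp add: em_def)

lemma s_int_eq_iff: "of_int a + of_int b * s = of_int c + of_int d * s \<longleftrightarrow> a = c \<and> b = d" for a b c d :: int
  using em_eq_iff[of "of_int a" "of_int b" "of_int c" "of_int d"] by (simp add: em_def)

end

context prime_over
begin

text \<open>Modulo 2 one has \<open>c4 = a1^4\<close>.\<close>

lemma c4_in_P_imp_a1: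
  assumes p: "p = 2" and a: "coeffs_in OK (a1, a2, a3, a4, a6)" and c: "c4 (a1, a2, a3, a4, a6) \<in> P"
  shows "a1 \<in> P"
proof -
  have O: "a1 \<in> OK" "a2 \<in> OK" "a3 \<in> OK" "a4 \<in> OK" using a by auto
  have two: "2 \<in> P" using p_in_P p by simp
  have "2 * (2 * a2) \<in> P" by (rule P_mult2[OF two]) (use O in auto)
  then have four: "4 * a2 \<in> P" by simp
  have "2 * (12 * (2*a4 + a1*a3)) \<in> P" by (rule P_mult2[OF two]) (use O in auto)
  moreover have "2 * (12 * (2*a4 + a1*a3)) = 24 * (2*a4 + a1*a3)" by simp
  ultimately have "c4 (a1, a2, a3, a4, a6) + 24 * (2*a4 + a1*a3) \<in> P" using P_add[OF c] by metis
  then have "(a1^2 + 4*a2)^2 \<in> P" by (simp add: Let_def)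
  then have "a1^2 + 4*a2 \<in> P" by (rule P_power[rotated]) (use O in auto)
  then have "a1^2 \<in> P" using P_diff[OF _ four] by fastforce
  then show ?thesis by (rule P_power[rotated]) (use O in auto)
qed

text \<open>If \<open>a1\<close> and \<open>a3\<close> are both in \<open>P\<close>, then so are
  \<open>b2\<close> and \<open>b6\<close>, and with them every term of the discriminant.\<close>

lemma a3_notin_P:
  assumes p: "p = 2" and a: "coeffs_in OK (a1, a2, a3, a4, a6)" and a1: "a1 \<in> P"
    and d: "disc (a1, a2, a3, a4, a6) \<notin> P"
  shows "a3 \<notin> P"
proof
  assume a3: "a3 \<in> P"
  have O: "a1 \<in> OK" "a2 \<in> OK" "a3 \<in> OK" "a4 \<in> OK" "a6 \<in> OK" using a by auto
  have two: "2 \<in> P" using p_in_P p by simp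
  define B b b' b8 where "B = a1^2 + 4*a2" and "b = 2*a4 + a1*a3" and "b' = a3^2 + 4*a6"
    and "b8 = a1^2*a6 + 4*a2*a6 - a1*a3*a4 + a2*a3^2 - a4^2"
  have OB: "B \<in> OK" "b \<in> OK" "b' \<in> OK" "b8 \<in> OK" unfolding B_def b_def b'_def b8_def using O by auto
  have B': "B = a1 * a1 + 2 * (2 * a2)" "b' = a3 * a3 + 2 * (2 * a6)" by (simp_all add: B_def b'_def power2_eq_square)
  have BP: "B \<in> P" "b' \<in> P" unfolding B'
    by (intro P_add P_mult2[OF a1] P_mult2[OF a3] P_mult2[OF two]; use O in auto)+
  have "disc (a1, a2, a3, a4, a6) = 9 * B * b * b' - B^2 * b8 - 8 * b^3 - 27 * b'^2"
    by (simp add: Let_def B_def b_def b'_def b8_def)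
  also have "\<dots> = B * (9 * b * b' - B * b8) - 2 * (4 * b^3) - b' * (27 * b')"
    by (simp add: power2_eq_square algebra_simps)
  also have "\<dots> \<in> P" using OB
    by (intro P_diff P_mult2[OF two] P_mult2[OF BP(1)] P_mult2[OF BP(2)]) auto
  finally show False using d by simp
qed

text \<open>If \<open>a1\<close> lies in \<open>P\<close> but is not divisible by 2, its norm is 2
  modulo 4. Then \<open>b2 / 2\<close> is known modulo 2 and, \<open>a3\<close> being a unit, so is
  \<open>b4\<close>; this pins \<open>c4 / 4\<close> down to \<open>1 + 2 s\<close> modulo 4. The
  class of \<open>c6\<close> is recorded where \<open>m\<close> is 2 modulo 4, the only case that
  will survive.\<close>

lemma ramified_2_form:
  assumes p: "p = 2" and st: stable and m4: "m mod 4 \<noteq> 1" and a: "coeffs_in OK (a1, a2, a3, a4, a6)"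
    and a1: "a1 \<in> P" and a3: "a3 \<notin> P"
  shows "(\<exists>\<alpha>\<in>OK. a1 = 2 * \<alpha>) \<or> (\<exists>e\<in>OK. c4 (a1, a2, a3, a4, a6) = 4 * (1 + 2 * s + 4 * e)) \<and>
    (m mod 4 = 2 \<longrightarrow> (\<exists>h\<in>OK. c6 (a1, a2, a3, a4, a6) = 8 * (s + 2 * h)))"
proof -
  have O: "a1 \<in> OK" "a2 \<in> OK" "a3 \<in> OK" "a4 \<in> OK" "a6 \<in> OK" using a by auto
  obtain \<alpha> \<beta> where ab: "a1 = of_int \<alpha> + of_int \<beta> * s" using O m4 OK_s_E by blast
  obtain c d where cd: "a3 = of_int c + of_int d * s" using O m4 OK_s_E by blast
  have ev: "even (\<alpha>^2 - m * \<beta>^2)" using stable_norm[OF st O(1), of "\<alpha>^2 - m * \<beta>^2"] a1 p N_s_form ab by simp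
  have od: "odd (c^2 - m * d^2)" using stable_norm[OF st O(3), of "c^2 - m * d^2"] a3 p N_s_form cd by simp
  have half: ?thesis if "even \<alpha>" "even \<beta>"
  proof -
    obtain \<alpha>' where \<alpha>': "\<alpha> = 2 * \<alpha>'" using \<open>even \<alpha>\<close> by (rule evenE)
    obtain \<beta>' where \<beta>': "\<beta> = 2 * \<beta>'" using \<open>even \<beta>\<close> by (rule evenE)
    have "a1 = 2 * (of_int \<alpha>' + of_int \<beta>' * s)" unfolding ab \<alpha>' \<beta>' by simp
    moreover have "of_int \<alpha>' + of_int \<beta>' * s \<in> OK" by auto
    ultimately show ?thesis by blast
  qed
  consider "m mod 4 = 2" | "m mod 4 = 3" using m_mod4 m4 by blast
  then show ?thesis
  proof cases
    case 1
    define M' where "M' = m div 4"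
    have mM: "m = 2 * (2 * M' + 1)" using 1 unfolding M'_def by presburger
    have "even \<alpha>" using ev mM by simp
    then obtain \<alpha>' where \<alpha>': "\<alpha> = 2 * \<alpha>'" by (rule evenE)
    have "odd c" using od mM by simp
    then obtain c' where c': "c = 2 * c' + 1" by (rule oddE)
    show ?thesis
    proof (cases "even \<beta>")
      case True
      then show ?thesis using half \<open>even \<alpha>\<close> by blast
    next
      case False
      obtain b where b: "\<beta> = 2 * b + 1" using False by (rule oddE)
      obtain \<beta>2 where \<beta>2: "\<beta>^2 = 8 * \<beta>2 + 1" using False by (rule odd_square_E)
      define x where "x = of_int (\<alpha>'^2 + M' + 4 * (2 * M' + 1) * \<beta>2) + of_int (\<alpha>' * \<beta>) * s + a2"
      define y where "y = a4 + of_int \<alpha>' * a3 + of_int b * s * a3 + of_int c' * s + of_int (d * (2 * M' + 1))"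
      define z where "z = of_int (2 * c'^2 + 2 * c' + d^2 * (2 * M' + 1)) + of_int (c * d) * s + 2 * a6"
      have xyz: "x \<in> OK" "y \<in> OK" "z \<in> OK" unfolding x_def y_def z_def using O by auto
      have "b2 (a1, a2, a3, a4, a6) = of_int (\<alpha>^2) + of_int (\<beta>^2) * (s * s) + of_int (2 * \<alpha> * \<beta>) * s + 4 * a2"
        unfolding ab by (simp add: power2_eq_square algebra_simps)
      also have "\<dots> = of_int (\<alpha>^2 + \<beta>^2 * m) + of_int (2 * \<alpha> * \<beta>) * s + 4 * a2" unfolding ss by simp
      also have "\<alpha>^2 + \<beta>^2 * m = 2 + 4 * (\<alpha>'^2 + M' + 4 * (2 * M' + 1) * \<beta>2)"
        unfolding \<beta>2 mM \<alpha>' by (simp add: power2_eq_square algebra_simps)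
      finally have B: "b2 (a1, a2, a3, a4, a6) = 2 * (1 + 2 * x)" unfolding x_def \<alpha>' by (simp add: algebra_simps)
      have "b4 (a1, a2, a3, a4, a6) = 2 * a4 + 2 * (of_int \<alpha>' * a3) + 2 * (of_int b * s * a3) + s * a3"
        unfolding ab \<alpha>' b by (simp add: algebra_simps)
      also have "s * a3 = of_int c * s + of_int d * (s * s)" unfolding cd by (simp add: algebra_simps)
      also have "\<dots> = s + 2 * (of_int c' * s) + 2 * of_int (d * (2 * M' + 1))" unfolding ss unfolding c' mM by (simp add: algebra_simps)
      finally have b: "b4 (a1, a2, a3, a4, a6) = s + 2 * y" unfolding y_def by (simp add: algebra_simps)
      have "b6 (a1, a2, a3, a4, a6) = of_int (c^2) + of_int (d^2) * (s * s) + of_int (2 * c * d) * s + 4 * a6"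
        unfolding cd by (simp add: power2_eq_square algebra_simps)
      also have "\<dots> = of_int (c^2 + d^2 * m) + of_int (2 * c * d) * s + 4 * a6" unfolding ss by simp
      also have "c^2 + d^2 * m = 1 + 2 * (2 * c'^2 + 2 * c' + d^2 * (2 * M' + 1))"
        unfolding mM c' by (simp add: power2_eq_square algebra_simps)
      finally have b': "b6 (a1, a2, a3, a4, a6) = 1 + 2 * z" unfolding z_def by (simp add: algebra_simps)
      have c4: "c4 (a1, a2, a3, a4, a6) = 4 * (1 + 2 * s + 4 * (x + x^2 - 2 * s - 3 * y))"
        unfolding c4_altdef B b by (simp add: power2_eq_square algebra_simps)
      have c6: "c6 (a1, a2, a3, a4, a6) = 8 * (s + 2 * (- 14 + 4 * s - 3 * x - 6 * x^2 - 4 * x^3 + 9 * y + 9 * x * s + 18 * x * y - 27 * z))"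
        unfolding c6_def B b b' by (simp add: power2_eq_square power3_eq_cube algebra_simps)
      have e: "x + x^2 - 2 * s - 3 * y \<in> OK"
        "- 14 + 4 * s - 3 * x - 6 * x^2 - 4 * x^3 + 9 * y + 9 * x * s + 18 * x * y - 27 * z \<in> OK"
        using xyz by (auto intro!: OK_add OK_diff OK_mult OK_power OK_uminus)
      show ?thesis using c4 c6 e by blast
    qed
  next
    case 2
    define j where "j = m div 4"
    have mj: "m = 4 * j + 3" using 2 unfolding j_def by presburger
    have par: "even \<alpha> \<longleftrightarrow> even \<beta>" using ev mj by auto
    show ?thesis
    proof (cases "even \<beta>")
      case True
      then show ?thesis using half par by blast
    next
      case False
      then have \<alpha>o: "odd \<alpha>" using par by simp
      obtain \<beta>' where \<beta>': "\<beta> = 2 * \<beta>' + 1" using False by (rule oddE)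
      obtain \<alpha>' where \<alpha>': "\<alpha> = 2 * \<alpha>' + 1" using \<alpha>o by (rule oddE)
      obtain \<beta>2 where \<beta>2: "\<beta>^2 = 8 * \<beta>2 + 1" using False by (rule odd_square_E)
      obtain \<alpha>2 where \<alpha>2: "\<alpha>^2 = 8 * \<alpha>2 + 1" using \<alpha>o by (rule odd_square_E)
      have "odd (\<alpha> * \<beta>)" using False \<alpha>o by simp
      then obtain r where r: "\<alpha> * \<beta> = 2 * r + 1" by (rule oddE)
      have "odd (c + d)" using od mj by auto
      then obtain r2 where r2: "c + d = 2 * r2 + 1" by (rule oddE)
      define x where "x = of_int (j + 1 + 2 * \<alpha>2 + 2 * \<beta>2 * m) + of_int r * s + a2"
      define y where "y = a4 + (of_int \<alpha>' + of_int \<beta>' * s) * a3 + of_int (r2 + d + 2 * j * d) + of_int r2 * s"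
      have xy: "x \<in> OK" "y \<in> OK" unfolding x_def y_def using O by auto
      have "b2 (a1, a2, a3, a4, a6) = of_int (\<alpha>^2) + of_int (\<beta>^2) * (s * s) + of_int (2 * (\<alpha> * \<beta>)) * s + 4 * a2"
        unfolding ab by (simp add: power2_eq_square algebra_simps)
      also have "\<dots> = of_int (\<alpha>^2 + \<beta>^2 * m) + of_int (2 * (\<alpha> * \<beta>)) * s + 4 * a2" unfolding ss by simp
      also have "\<alpha>^2 + \<beta>^2 * m = 4 * (j + 1 + 2 * \<alpha>2 + 2 * \<beta>2 * m)"
        unfolding \<beta>2 \<alpha>2 mj by (simp add: algebra_simps)
      finally have B: "b2 (a1, a2, a3, a4, a6) = 2 * (s + 2 * x)" unfolding x_def r by (simp add: algebra_simps)
      have "b4 (a1, a2, a3, a4, a6) = 2 * a4 + 2 * ((of_int \<alpha>' + of_int \<beta>' * s) * a3) + (a3 + s * a3)"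
        unfolding ab \<alpha>' \<beta>' by (simp add: algebra_simps)
      also have "a3 + s * a3 = of_int c + of_int (c + d) * s + of_int d * (s * s)" unfolding cd by (simp add: algebra_simps)
      also have "\<dots> = of_int (c + d * m) + of_int (c + d) * s" unfolding ss by simp
      also have "c + d * m = 1 + 2 * (r2 + d + 2 * j * d)" using r2 unfolding mj by (simp add: algebra_simps)
      finally have b: "b4 (a1, a2, a3, a4, a6) = 1 + s + 2 * y" unfolding y_def r2 by (simp add: algebra_simps)
      have "(s + 2 * x)^2 = s * s + 4 * (x * s) + 4 * x^2" by (simp add: power2_eq_square algebra_simps)
      also have "\<dots> = 3 + 4 * (of_int j + x * s + x^2)" unfolding ss using mj by (simp add: algebra_simps)
      finally have sq: "(s + 2 * x)^2 = 3 + 4 * (of_int j + x * s + x^2)" .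
      have c4: "c4 (a1, a2, a3, a4, a6) = 4 * (1 + 2 * s + 4 * (of_int j - 1 - 2 * s + x * s + x^2 - 3 * y))"
        unfolding c4_altdef B b power_mult_distrib sq by (simp add: algebra_simps)
      have e: "of_int j - 1 - 2 * s + x * s + x^2 - 3 * y \<in> OK"
        using xy by (auto intro!: OK_add OK_diff OK_mult OK_power)
      have "m mod 4 \<noteq> 2" using 2 by simp
      then show ?thesis using c4 e by blast
    qed
  qed
qed

end

context good_curve
begin

lemma c4_c6_K: "c4 a \<in> K" "c6 a \<in> K"
proof -
  obtain a1 a2 a3 a4 a6 where e: "a = (a1, a2, a3, a4, a6)" by (metis prod_cases5)
  show "c4 a \<in> K" "c6 a \<in> K" using ell unfolding elliptic_over_def c4_altdef c6_def e by auto
qed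

lemma c6_sq: "c6 a ^ 2 = of_int (A^3 - 1728) * disc a"
proof -
  have "c6 a ^ 2 = c4 a ^ 3 - 1728 * disc a" using disc_c4_c6[of a] by (simp add: algebra_simps)
  then show ?thesis unfolding jA by (simp add: algebra_simps)
qed

lemma N_c4_c6_coeff: "coeffs_in OK b \<Longrightarrow> c4 b \<in> OK \<and> c6 b \<in> OK"
proof -
  assume h: "coeffs_in OK b"
  obtain a1 a2 a3 a4 a6 where e: "b = (a1, a2, a3, a4, a6)" by (metis prod_cases5)
  show ?thesis using h unfolding c4_altdef c6_def e by auto
qed

text \<open>An equation for the given curve that is integral everywhere but has good reduction only
  at \<open>P\<close>, which enters through \<open>disc b \<notin> P\<close> alone. The integer
  \<nu> measures the excess of its discriminant, and \<open>n = \<nu> |N v|\<close> ties it to the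
  fixed \<open>n\<close>.\<close>

definition is_model :: "complex set \<Rightarrow> complex \<Rightarrow> wcoeffs \<Rightarrow> int \<Rightarrow> bool" where
  "is_model P v b \<nu> \<longleftrightarrow> v \<in> K \<and> v \<noteq> 0 \<and> \<nu> > 0 \<and> coeffs_in OK b \<and> disc b \<in> OK \<and> disc b \<notin> P \<and>
     c4 a = v^4 * c4 b \<and> c6 a = v^6 * c6 b \<and> c4 b ^ 3 = of_int A ^ 3 * disc b \<and>
     c6 b ^ 2 = of_int (A^3 - 1728) * disc b \<and> \<bar>N (disc b)\<bar> = of_int \<nu> ^ 12 \<and> n = of_int \<nu> * \<bar>N v\<bar>"

text \<open>The ratio \<open>n / |N v|\<close> is an integer because its twelfth power is the
  absolute norm of \<open>disc b\<close>.\<close>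

lemma model_exists:
  assumes "prime_over m P p" shows "\<exists>v b \<nu>. is_model P v b \<nu>"
proof -
  interpret prime_over m P p by fact
  obtain v b where v: "v \<in> K" "v \<noteq> 0" "coeffs_in OK b" "disc b \<in> OK" "disc b \<notin> P"
    "c4 a = v^4 * c4 b" "c6 a = v^6 * c6 b" "disc a = v^12 * disc b"
    using integral_model goodr prime_ideal unfolding everywhere_good_def by blast
  have Nv: "N v \<noteq> 0" using v N_0_iff by blast
  have "v^12 * c4 b ^ 3 = v^12 * (of_int A ^ 3 * disc b)"
    using jA unfolding v(6,8) by (simp add: power_mult_distrib flip: power_mult)
  then have c: "c4 b ^ 3 = of_int A ^ 3 * disc b" using v by simp
  have "v^12 * c6 b ^ 2 = v^12 * (of_int (A^3 - 1728) * disc b)"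
    using c6_sq unfolding v(7,8) by (simp add: power_mult_distrib flip: power_mult)
  then have d: "c6 b ^ 2 = of_int (A^3 - 1728) * disc b" using v by simp
  have "n ^ 12 = \<bar>N v\<bar> ^ 12 * \<bar>N (disc b)\<bar>" unfolding nn[symmetric] v(8) using v
    by (simp add: N_mult N_power abs_mult power_abs)
  then have e: "\<bar>N (disc b)\<bar> = (n / \<bar>N v\<bar>)^12" using Nv by (simp add: power_divide)
  obtain k where "N (disc b) = of_int k" using OK_N_int v by blast
  then have "(n / \<bar>N v\<bar>)^12 \<in> \<int>" unfolding e[symmetric] by simp
  then have "n / \<bar>N v\<bar> \<in> \<int>" by (rule rat_power_Ints) simp
  then obtain \<nu> where \<nu>: "n / \<bar>N v\<bar> = of_int \<nu>" by (auto elim: Ints_cases)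
  then have "n = of_int \<nu> * \<bar>N v\<bar>" using Nv by (simp add: field_simps)
  moreover have "of_int \<nu> > (0::rat)" unfolding \<nu>[symmetric] using n0 Nv by simp
  ultimately show ?thesis unfolding is_model_def using v c d e \<nu>
    by (intro exI[of _ v] exI[of _ b] exI[of _ \<nu>] conjI) simp_all
qed

lemma model_norm_c4:
  assumes "is_model P v b \<nu>" shows "\<bar>N (c4 b)\<bar> = of_int (A^2 * \<nu>^4)"
proof -
  have O: "c4 b \<in> OK" "disc b \<in> OK" using assms N_c4_c6_coeff unfolding is_model_def by blast+
  have "\<bar>N (c4 b)\<bar> ^ 3 = \<bar>N (c4 b ^ 3)\<bar>" using O by (simp add: N_power power_abs)
  also have "c4 b ^ 3 = of_int A ^ 3 * disc b" using assms by (simp add: is_model_def)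
  also have "N (of_int A ^ 3 * disc b) = (of_int A^2)^3 * N (disc b)" using O by (simp add: N_mult N_power)
  also have "\<bar>\<dots>\<bar> = (of_int (A^2 * \<nu>^4))^3"
    using assms unfolding is_model_def by (simp add: abs_mult power_mult_distrib flip: power_mult)
  finally show ?thesis by (rule power_eq_imp_eq_base) auto
qed

lemma model_norm_c6:
  assumes "is_model P v b \<nu>" shows "\<bar>N (c6 b)\<bar> = of_int (\<bar>A^3 - 1728\<bar> * \<nu>^6)"
proof -
  have O: "c6 b \<in> OK" "disc b \<in> OK" using assms N_c4_c6_coeff unfolding is_model_def by blast+
  have \<nu>: "\<nu> > 0" using assms by (simp add: is_model_def)
  have "\<bar>N (c6 b)\<bar> ^ 2 = \<bar>N (c6 b ^ 2)\<bar>" using O by (simp add: N_power power_abs)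
  also have "c6 b ^ 2 = of_int (A^3 - 1728) * disc b" using assms by (simp add: is_model_def)
  also have "N (of_int (A^3 - 1728) * disc b) = (of_int (A^3 - 1728))^2 * N (disc b)" using O by (simp only: N_mult N_of_int K_of_int OK_K)
  also have "\<bar>\<dots>\<bar> = (of_int (A^3 - 1728))^2 * of_int \<nu>^12"
    using assms unfolding is_model_def by (simp add: abs_mult)
  also have "\<dots> = (of_int (\<bar>A^3 - 1728\<bar> * \<nu>^6))^2"
    by (simp only: of_int_mult of_int_power of_int_abs power_mult_distrib power2_abs flip: power_mult) simp
  finally show ?thesis by (rule power_eq_imp_eq_base) (use \<nu> in auto)
qed

lemma model_stable:
  assumes "is_model P v b \<nu>" "prime_over m P p" "prime_over.stable m P" shows "\<not> p dvd \<nu>"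
proof -
  interpret prime_over m P p by fact
  have d: "disc b \<in> OK" "disc b \<notin> P" using assms by (auto simp: is_model_def)
  obtain k where k: "N (disc b) = of_int k" using OK_N_int d by blast
  have "of_int \<bar>k\<bar> = (of_int (\<nu>^12) :: rat)" using assms(1) unfolding is_model_def by (simp flip: k)
  then have "\<bar>k\<bar> = \<nu>^12" by (simp only: of_int_eq_iff)
  moreover have "\<not> p dvd k" using stable_norm[OF assms(3) d(1) k] d(2) by blast
  ultimately show ?thesis by (metis dvd_abs_iff dvd_power dvd_trans zero_less_numeral)
qed

lemma model_c4_in_P:
  assumes "is_model P v b \<nu>" "prime_over m P p" "p dvd A" shows "c4 b \<in> P"
proof -
  interpret prime_over m P p by fact
  have "of_int A ^ 3 * disc b \<in> P"
    using P_mult2[of "of_int A" "of_int A ^ 2 * disc b"] int_in_P assms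
    by (simp add: is_model_def power2_eq_square power3_eq_cube mult.assoc)
  then have "c4 b ^ 3 \<in> P" using assms by (simp add: is_model_def)
  then show ?thesis using P_power N_c4_c6_coeff assms unfolding is_model_def by blast
qed

text \<open>Where 2 is a uniformiser, \<open>a1\<close> is twice an element of \<open>L\<close>.
  Then \<open>c4\<close> is divisible by 16, and \<open>c4^3 = A^3 \<Delta>\<close> with \<Delta> a
  unit gives \<open>2^12 dvd A^3\<close>.\<close>

lemma unram_2:
  assumes P: "prime_over m P 2" and un: "prime_over.unram m P 2" and A: "even A" shows "16 dvd A"
proof -
  interpret prime_over m P 2 by fact
  obtain v b \<nu> where M: "is_model P v b \<nu>" using model_exists P by blast
  obtain a1 a2 a3 a4 a6 where e: "b = (a1, a2, a3, a4, a6)" by (metis prod_cases5)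
  have O: "a1 \<in> OK" "a2 \<in> OK" "a3 \<in> OK" "a4 \<in> OK" "a6 \<in> OK" "coeffs_in OK b" using M unfolding is_model_def e by auto
  have d: "lu (disc b)" using M lu_OK unfolding is_model_def by blast
  have "a1 \<in> P" using c4_in_P_imp_a1[OF refl O(6)[unfolded e]] model_c4_in_P[OF M P A] unfolding e by blast
  then have "\<not> lu a1" using lu_OK_iff O by blast
  then obtain \<alpha> where \<alpha>: "\<alpha> \<in> L" "a1 = 2 * \<alpha>" using unram_E[OF un OK_L[OF O(1)]] by auto
  define \<kappa> where "\<kappa> = (\<alpha>^2 + a2)^2 - 3 * (a4 + \<alpha> * a3)"
  have \<kappa>L: "\<kappa> \<in> L" unfolding \<kappa>_def using \<alpha> O by auto
  have "c4 b = 16 * \<kappa>" unfolding e \<alpha> \<kappa>_def by (rule invariants_even_a1)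
  then have "of_int (A^3) * disc b = 2^12 * \<kappa>^3" using M unfolding is_model_def by (simp add: power_mult_distrib)
  then have "of_int (A^3) / of_int 2 ^ 12 = \<kappa>^3 / disc b" using lu_0[OF d] by (simp add: field_simps)
  also have "\<dots> \<in> L" using \<kappa>L d by blast
  finally have "2 ^ 12 dvd A^3" by (rule int_fraction_in_L)
  then have "(2^4)^3 dvd A^3" by simp
  then have "2^4 dvd A" using pow_divides_pow_iff[of 3 "2^4" A] by simp
  then show ?thesis by simp
qed

text \<open>The counterpart of \<open>unram_2\<close> with norms instead of local division:
  \<open>16^2\<close> divides the norm of \<open>c4\<close>, which is \<open>A^2 \<nu>^4\<close> up
  to sign with \<nu> odd.\<close>

lemma half_a1_sixteen:
  assumes M: "is_model P v (2 * \<alpha>, a2, a3, a4, a6) \<nu>" and \<alpha>: "\<alpha> \<in> OK" and \<nu>: "odd \<nu>"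
  shows "16 dvd A"
proof -
  have O: "a2 \<in> OK" "a3 \<in> OK" "a4 \<in> OK" using M unfolding is_model_def by auto
  define \<kappa> where "\<kappa> = (\<alpha>^2 + a2)^2 - 3 * (a4 + \<alpha> * a3)"
  have \<kappa>O: "\<kappa> \<in> OK" unfolding \<kappa>_def using \<alpha> O by auto
  obtain k where k: "N \<kappa> = of_int k" using OK_N_int \<kappa>O by blast
  have "N (c4 (2 * \<alpha>, a2, a3, a4, a6)) = of_int (16^2 * k)" unfolding invariants_even_a1 \<kappa>_def[symmetric]
    using \<kappa>O by (simp add: N_mult k)
  then have "of_int \<bar>16^2 * k\<bar> = (of_int (A^2 * \<nu>^4) :: rat)" using model_norm_c4[OF M] by simp
  then have "\<bar>16^2 * k\<bar> = A^2 * \<nu>^4" by (simp only: of_int_eq_iff)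
  moreover have "(2^4)^2 dvd \<bar>16^2 * k\<bar>" by simp
  ultimately have "2^4 dvd A" using square_dvd_mult_odd_power \<nu> by metis
  then show ?thesis by simp
qed

text \<open>The norm of \<open>c4 / 4\<close> is \<open>1 - 4 m\<close> modulo 8 and, up to sign, an
  odd square. Odd squares are 1 modulo 8, so the sign is plus and \<open>m\<close> is even.\<close>

lemma odd_form:
  assumes m4: "m mod 4 \<noteq> 1" and M: "is_model P v b \<nu>" and \<nu>: "odd \<nu>"
    and e: "e \<in> OK" and c: "c4 b = 4 * (1 + 2 * s + 4 * e)"
  shows "m mod 4 = 2 \<and> (\<exists>A'. A = 4 * A' \<and> odd A')"
proof -
  have O: "1 + 2 * s \<in> OK" by auto
  obtain i k where ik: "N (1 + 2 * s + of_int 4 * e) = N (1 + 2 * s) + of_int (4 * i + 4^2 * k)" "even i"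
    using N_add_mult[OF O e, of 4] m4 by blast
  have N1: "N (1 + 2 * s) = of_int (1 - 4 * m)" using N_s_form[of 1 2] by simp
  define X where "X = 1 + 2 * s + of_int 4 * e"
  have "X \<in> K" unfolding X_def using O e by auto
  then have "N (c4 b) = 4^2 * N X" unfolding c using N_mult[of 4 X] by (simp add: X_def)
  define T where "T = 1 - 4 * m + (4 * i + 4^2 * k)"
  have "N X = of_int T" unfolding X_def ik(1) N1 T_def by simp
  then have "of_int (16 * \<bar>T\<bar>) = (of_int (A^2 * \<nu>^4) :: rat)"
    using model_norm_c4[OF M] \<open>N (c4 b) = 4^2 * N X\<close> by (simp add: abs_mult)
  then have e1: "16 * \<bar>1 - 4 * m + (4 * i + 4^2 * k)\<bar> = A^2 * \<nu>^4" unfolding T_def by (simp only: of_int_eq_iff)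
  have "(2^2)^2 dvd A^2 * \<nu>^4" unfolding e1[symmetric] by simp
 
  then have "2^2 dvd A" using \<nu> by (rule square_dvd_mult_odd_power)
  then obtain A' where A': "A = 4 * A'" by auto
  have e2: "\<bar>1 - 4 * m + (4 * i + 4^2 * k)\<bar> = A'^2 * \<nu>^4" using e1 unfolding A' by (simp add: power_mult_distrib)
  have "odd (A'^2 * \<nu>^4)" unfolding e2[symmetric] by simp
  then have A'o: "odd A'" by simp
  then have "odd (A' * \<nu>^2)" using \<nu> by simp
  then obtain g where g: "(A' * \<nu>^2)^2 = 8 * g + 1" by (rule odd_square_E)
  have "A'^2 * \<nu>^4 = 8 * g + 1" unfolding g[symmetric] by (simp add: power_mult_distrib flip: power_mult)
  then have e3: "\<bar>1 - 4 * m + (4 * i + 4^2 * k)\<bar> = 8 * g + 1" using e2 by simp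
  obtain i' where i': "i = 2 * i'" using ik(2) by (rule evenE)
  have "1 - 4 * m + (8 * i' + 16 * k) = 8 * g + 1 \<or> 1 - 4 * m + (8 * i' + 16 * k) = - (8 * g + 1)"
    using e3 unfolding i' by (simp add: abs_if split: if_splits)
  then have "m mod 4 \<noteq> 3"
  proof
    assume "1 - 4 * m + (8 * i' + 16 * k) = 8 * g + 1"
    then have "m = 2 * (i' + 2 * k - g)" by simp
    then have "even m" by (rule dvdI)
    then show ?thesis by presburger
  next
    assume "1 - 4 * m + (8 * i' + 16 * k) = - (8 * g + 1)"
    then have "2 * m = 2 * (2 * (i' + 2 * k + g)) + 1" by simp
    then have "odd (2 * m)" by (metis even_plus_one_iff dvd_triv_left)
    then show ?thesis by simp
  qed
  then show ?thesis using m_mod4 m4 A' A'o by auto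
qed

text \<open>If 2 is unramified or divides \<open>a1\<close>, then 16 divides \<open>A\<close>. In
  the remaining case \<open>A = 4 A'\<close> with \<open>A'\<close> odd, and it is the norm of
  \<open>c6\<close> that separates the two classes of \<open>A'\<close> modulo 4.\<close>

lemma two_cases:
  assumes A: "even A"
  shows "16 dvd A \<or> 16 dvd A - 4 \<and> m mod 4 = 2"
proof -
  obtain P where P: "prime_over m P 2" "2 dvd disc_K \<and> (\<forall>x\<in>P. cj x \<in> P) \<or> prime_over.unram m P 2"
    using prime_exists[of 2] by auto
  show ?thesis
  proof (cases "prime_over.unram m P 2")
    case True
    then show ?thesis using unram_2[OF P(1) True A] by blast
  next
    case False
    interpret prime_over m P 2 by (rule P(1))
    have st: stable and dk: "2 dvd disc_K" using P(2) False by (auto simp: stable_def)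
    have m4: "m mod 4 \<noteq> 1"
    proof
      assume "m mod 4 = 1"
      then show False using dk unfolding disc_K_eq by presburger
    qed
    obtain v b \<nu> where M: "is_model P v b \<nu>" using model_exists P by blast
    have \<nu>: "odd \<nu>" using model_stable[OF M P(1) st] .
    obtain a1 a2 a3 a4 a6 where e: "b = (a1, a2, a3, a4, a6)" by (metis prod_cases5)
    have O: "coeffs_in OK b" "disc b \<notin> P" using M unfolding is_model_def by auto
    have a1: "a1 \<in> P" using c4_in_P_imp_a1[OF refl O(1)[unfolded e]] model_c4_in_P[OF M P(1) A] unfolding e by blast
    have a3: "a3 \<notin> P" using a3_notin_P[OF refl O(1)[unfolded e] a1] O(2) unfolding e by blast
    from ramified_2_form[OF refl st m4 O(1)[unfolded e] a1 a3] show ?thesis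
    proof
      assume "\<exists>\<alpha>\<in>OK. a1 = 2 * \<alpha>"
      then show ?thesis using half_a1_sixteen M \<nu> unfolding e by blast
    next
      assume h: "(\<exists>e\<in>OK. c4 (a1, a2, a3, a4, a6) = 4 * (1 + 2 * s + 4 * e)) \<and>
        (m mod 4 = 2 \<longrightarrow> (\<exists>h\<in>OK. c6 (a1, a2, a3, a4, a6) = 8 * (s + 2 * h)))"
      then obtain A' where A': "m mod 4 = 2" "A = 4 * A'" "odd A'" using odd_form[OF m4 M \<nu>] unfolding e by blast
      then obtain h where h: "h \<in> OK" "c6 b = 8 * (s + 2 * h)" using h unfolding e by blast
      obtain i k where ik: "N (s + of_int 2 * h) = N s + of_int (2 * i + 2^2 * k)" "even i"
        using N_add_mult[OF OK_s h(1), of 2] m4 by blast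
      define X where "X = s + of_int 2 * h"
      have "X \<in> K" unfolding X_def using h(1) by auto
      then have "N (c6 b) = 8^2 * N X" unfolding h(2) using N_mult[of 8 X] by (simp add: X_def)
      define T where "T = - m + (2 * i + 2^2 * k)"
      have "N X = of_int T" unfolding X_def ik(1) N_s T_def by simp
      then have "of_int (64 * \<bar>T\<bar>) = (of_int (\<bar>A^3 - 1728\<bar> * \<nu>^6) :: rat)"
        using model_norm_c6[OF M] \<open>N (c6 b) = 8^2 * N X\<close> by (simp add: abs_mult)
      then have "64 * \<bar>- m + (2 * i + 2^2 * k)\<bar> = \<bar>A^3 - 1728\<bar> * \<nu>^6" unfolding T_def by (simp only: of_int_eq_iff)
      also have "A^3 - 1728 = 64 * (A'^3 - 27)" unfolding A' by (simp add: power_mult_distrib)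
      also have "\<bar>64 * (A'^3 - 27)\<bar> = 64 * \<bar>A'^3 - 27\<bar>" by (simp only: abs_mult)
      finally have e1: "\<bar>- m + (2 * i + 2^2 * k)\<bar> = \<bar>A'^3 - 27\<bar> * \<nu>^6" by simp
      obtain i' where i': "i = 2 * i'" using ik(2) by (rule evenE)
      \<comment> \<open>As \<open>i\<close> is even, this norm is \<open>- m\<close> modulo 4, and
        \<open>m\<close> is 2 modulo 4.\<close>
      have "\<not> 4 dvd - m + (2 * i + 2^2 * k)"
      proof
        assume "4 dvd - m + (2 * i + 2^2 * k)"
        then have "4 dvd 4 * (i' + k) - (- m + (2 * i + 2^2 * k))" by (intro dvd_diff) auto
        then have "4 dvd m" unfolding i' by simp
        then show False using A'(1) by auto
      qed
      then have "\<not> 4 dvd \<bar>- m + (2 * i + 2^2 * k)\<bar>" by simp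
      then have "\<not> 4 dvd A'^3 - 27" unfolding e1 by (metis dvd_abs_iff dvd_mult2)
      moreover have "4 dvd A'^3 - 27" if h3: "A' mod 4 = 3"
      proof -
        obtain j where "A' = 4 * j + 3" using h3 by (metis mult_div_mod_eq)
        then have "A'^3 - 27 = 4 * (16 * j^3 + 36 * j^2 + 27 * j)" by (simp add: power3_eq_cube power2_eq_square algebra_simps)
        then show ?thesis by simp
      qed
      ultimately have "A' mod 4 = 1" using A'(3) by presburger
      then have "16 dvd A - 4" unfolding A'(2) by presburger
      then show ?thesis using A'(1) by blast
    qed
  qed
qed

end

section \<open>Congruences modulo 8, 9 and 27\<close>

lemma cong_1_mod_4_of_square:
  fixes c g b i k :: int
  assumes "c * g^2 = b^2 + (4 * i + 4^2 * k)" "odd g" "odd c"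
  shows "c mod 4 = 1" "even i \<Longrightarrow> c mod 8 = 1"
proof -
  have "odd (c * g^2)" using assms(2,3) by simp
  then have "odd b" unfolding assms(1) by simp
  then obtain B where B: "b^2 = 8 * B + 1" by (rule odd_square_E)
  obtain G where G: "g^2 = 8 * G + 1" using assms(2) by (rule odd_square_E)
  have c: "c = 1 + 4 * (2 * B + i + 4 * k - 2 * (G * c))" using assms(1) unfolding B G by (simp add: algebra_simps)
  then show "c mod 4 = 1" by (rule int_mod_eqI) simp_all
  assume "even i"
  then obtain i' where "i = 2 * i'" by (rule evenE)
  then have "c = 1 + 8 * (B + i' + 2 * k - G * c)" using c by simp
  then show "c mod 8 = 1" by (rule int_mod_eqI) simp_all
qed

text \<open>With \<open>A = 3 B\<close> the hypothesis becomes \<open>27 dvd B^3 - 64\<close>.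
  Modulo 3 this gives \<open>B = 3 c + 1\<close>; the cube of \<open>3 c + 1\<close> modulo 27
  depends on \<open>c\<close> modulo 3, and only \<open>B = 4\<close> modulo 9 is left.\<close>

lemma three_power_imp_27:
  fixes A :: int assumes "3 dvd A" "3^6 dvd A^3 - 1728" shows "27 dvd A - 12"
proof -
  obtain B where B: "A = 3 * B" using assms(1) by auto
  have "A^3 - 1728 = 27 * (B^3 - 64)" unfolding B by (simp add: power_mult_distrib)
  then have "27 * 27 dvd 27 * (B^3 - 64)" using assms(2) by simp
  then have d: "27 dvd B^3 - 64" by (simp only: dvd_times_left_cancel_iff)
  define c where "c = B div 3"
  have "B = 3 * c \<or> B = 3 * c + 2 \<or> B = 3 * c + 1" unfolding c_def by presburger
  then consider "B = 3 * c" | "B = 3 * c + 2" | "B = 3 * c + 1" by blast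
  then show ?thesis
  proof cases
    case 1
    have "3 dvd B^3 - 64" using d by (rule dvd_trans[rotated]) simp
    moreover have "(B^3 - 64) mod 3 = 2" by (rule int_mod_eqI[of _ _ _ "9 * c^3 - 22"]) (simp_all add: 1 power_mult_distrib)
    ultimately show ?thesis by (simp add: dvd_eq_mod_eq_0)
  next
    case 2
    have "3 dvd B^3 - 64" using d by (rule dvd_trans[rotated]) simp
    moreover have "(B^3 - 64) mod 3 = 1" by (rule int_mod_eqI[of _ _ _ "9 * c^3 + 18 * c^2 + 12 * c - 19"])
      (simp_all add: 2 power3_eq_cube power2_eq_square algebra_simps)
    ultimately show ?thesis by (simp add: dvd_eq_mod_eq_0)
  next
    case 3
    have "9 * 3 dvd B^3 - 64" using d by simp
    moreover have "B^3 - 64 = 9 * (3 * c^3 + 3 * c^2 + c - 7)" unfolding 3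
      by (simp add: power3_eq_cube power2_eq_square algebra_simps)
    ultimately have "9 * 3 dvd 9 * (3 * c^3 + 3 * c^2 + c - 7)" by simp
    then have "3 dvd 3 * c^3 + 3 * c^2 + c - 7" by (simp only: dvd_times_left_cancel_iff)
    then have "3 dvd 3 * (c^3 + c^2) + (c - 7)" by (simp add: algebra_simps)
    then have "3 dvd c - 7" using dvd_add_right_iff[of 3 "3 * (c^3 + c^2)" "c - 7"] by simp
    then show ?thesis unfolding B 3 by presburger
  qed
qed

lemma mod_3_cases:
  fixes z :: int obtains a r where "z = 3 * a + r" "r = -1 \<or> r = 0 \<or> r = 1"
proof (cases "z mod 3 = 2")
  case True
  then have "z = 3 * (z div 3 + 1) + (- 1)" by presburger
  then show ?thesis by (rule that) simp
next
  case False
  have "z = 3 * (z div 3) + z mod 3" by simp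
  then show ?thesis by (rule that) (use False in presburger)
qed

lemma cube_mod_9:
  fixes z :: int assumes "z = 3 * a + r" "r = -1 \<or> r = 0 \<or> r = 1" shows "[z^3 = r] (mod 9)"
  using assms(2) by (elim disjE; intro cong_I[of _ _ _ "3 * a^3 + 3 * a^2 * r + a * r^2"])
    (simp_all add: assms(1) power3_eq_cube power2_eq_square algebra_simps)

text \<open>\<open>e1\<close> and \<open>e2\<close> are the norm equations of \<open>c4\<close> and
  \<open>c6\<close>, divided by 9 and 27, for a model at a ramified prime above 3 in which the
  coefficient \<open>y\<close> of \<open>s\<close> in \<open>b2\<close> is prime to 3. The first is
  read modulo 3, the second modulo 9.\<close>

lemma ramified_3_impossible:
  fixes x y f d u A m' \<mu> \<kappa> c :: int
  assumes nd: "\<not> 3 dvd y" "\<not> 3 dvd m'" "\<not> 3 dvd \<mu>" and \<kappa>: "\<kappa> = 1 \<or> \<kappa> = -1"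
    and e1: "(3 * x^2 + m' * y^2 - 8 * f)^2 - 3 * m' * u^2 = A^2 * \<mu>^4"
    and e2: "27 * c^2 - m' * (- (m' * y^3) + 12 * y * f + 9 * d)^2 = \<kappa> * (A^3 - 64) * \<mu>^6"
  shows False
proof -
  obtain y1 y0 where y: "y = 3 * y1 + y0" "y0 = -1 \<or> y0 = 0 \<or> y0 = 1" by (rule mod_3_cases)
  obtain m1 m0 where m: "m' = 3 * m1 + m0" "m0 = -1 \<or> m0 = 0 \<or> m0 = 1" by (rule mod_3_cases)
  obtain \<mu>1 \<mu>0 where \<mu>: "\<mu> = 3 * \<mu>1 + \<mu>0" "\<mu>0 = -1 \<or> \<mu>0 = 0 \<or> \<mu>0 = 1" by (rule mod_3_cases)
  obtain f1 f0 where f: "f = 3 * f1 + f0" "f0 = -1 \<or> f0 = 0 \<or> f0 = 1" by (rule mod_3_cases)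
  obtain A1 A0 where A: "A = 3 * A1 + A0" "A0 = -1 \<or> A0 = 0 \<or> A0 = 1" by (rule mod_3_cases)
  have nz: "y0 = 1 \<or> y0 = -1" "m0 = 1 \<or> m0 = -1" "\<mu>0 = 1 \<or> \<mu>0 = -1" using nd y m \<mu> by auto
  have sq1: "y0^2 = 1" "m0^2 = 1" "\<mu>0^2 = 1" using nz by auto
  have m3: "[m' = m0] (mod 3)" "[y = y0] (mod 3)" "[\<mu> = \<mu>0] (mod 3)" "[f = f0] (mod 3)" "[A = A0] (mod 3)"
    unfolding y m \<mu> f A by (simp_all add: cong_iff_dvd_diff)
  have "[(3 * x^2 + m' * y^2 - 8 * f)^2 - 3 * m' * u^2 = (0 + m0 * y0^2 - 8 * f0)^2 - 0] (mod 3)"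
    using m3 by (intro cong_diff cong_pow cong_add cong_mult cong_refl) (auto simp: cong_iff_dvd_diff)
  moreover have "[A^2 * \<mu>^4 = A0^2 * \<mu>0^4] (mod 3)" using m3 by (intro cong_mult cong_pow)
  moreover have "\<mu>0^4 = 1" using nz by auto
  ultimately have c1: "[(m0 - 8 * f0)^2 = A0^2] (mod 3)" unfolding e1 sq1 by (simp add: cong_def)
  have yf: "[12 * y * f = 12 * y0 * f0] (mod 9)" unfolding y f
    by (rule cong_I[of _ _ _ "4 * (3 * y1 * f1 + y1 * f0 + y0 * f1)"]) (simp add: algebra_simps)
  have d9: "[9 * d = 0] (mod 9)" by (simp add: cong_iff_dvd_diff)
  have "[(- (m' * y^3) + 12 * y * f + 9 * d)^2 = (- (m' * y0) + 12 * y0 * f0 + 0)^2] (mod 9)"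
    by (intro cong_pow cong_add yf d9 cong_minus_minus_iff[THEN iffD2] cong_mult cong_refl cube_mod_9[OF y])
  then have "[m' * (- (m' * y^3) + 12 * y * f + 9 * d)^2 = m' * (- (m' * y0) + 12 * y0 * f0 + 0)^2] (mod 9)"
    by (intro cong_mult cong_refl)
  also have "m' * (- (m' * y0) + 12 * y0 * f0 + 0)^2 = y0^2 * (m'^3 - 24 * f0 * m'^2 + 9 * (16 * f0^2 * m'))"
    by (simp add: power2_eq_square power3_eq_cube algebra_simps)
  also have "\<dots> = m'^3 - 24 * f0 * m'^2 + 9 * (16 * f0^2 * m')" unfolding sq1 by simp
  also have "[m'^3 - 24 * f0 * m'^2 + 9 * (16 * f0^2 * m') = m0 - 24 * f0 + 0] (mod 9)"
  proof (intro cong_add cong_diff cube_mod_9[OF m])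
    have "m'^2 = 3 * (3 * m1^2 + 2 * m1 * m0) + m0^2" unfolding m by (simp add: power2_eq_square algebra_simps)
    then have "24 * f0 * m'^2 = 24 * f0 + 9 * (8 * f0 * (3 * m1^2 + 2 * m1 * m0))" unfolding sq1 by (simp add: algebra_simps)
    then show "[24 * f0 * m'^2 = 24 * f0] (mod 9)" by (rule cong_I)
  qed (simp add: cong_iff_dvd_diff)
  finally have l: "[m' * (- (m' * y^3) + 12 * y * f + 9 * d)^2 = m0 - 24 * f0 + 0] (mod 9)" .
  have "[27 * c^2 = 0] (mod 9)" by (simp add: cong_iff_dvd_diff)
  from cong_diff[OF this l] have l2: "[\<kappa> * (A^3 - 64) * \<mu>^6 = 0 - (m0 - 24 * f0 + 0)] (mod 9)" unfolding e2 .
  have "[(\<mu>^3)^2 = \<mu>0^2] (mod 9)" by (intro cong_pow cube_mod_9[OF \<mu>])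
  then have \<mu>6: "[\<mu>^6 = 1] (mod 9)" unfolding sq1 by (simp flip: power_mult)
  have r: "[\<kappa> * (A^3 - 64) * \<mu>^6 = \<kappa> * (A0 - 64) * 1] (mod 9)"
    by (intro cong_mult cong_diff cong_refl \<mu>6 cube_mod_9[OF A])
  have "[\<kappa> * (A0 - 64) * 1 = 0 - (m0 - 24 * f0 + 0)] (mod 9)" using cong_trans[OF cong_sym[OF r] l2] .
  then have c2: "[\<kappa> * (A0 - 64) = 24 * f0 - m0] (mod 9)" by simp
  \<comment> \<open>Both congruences involve only \<open>m0\<close>, \<open>f0\<close>,
    \<open>A0\<close> and \<kappa>, which leaves 36 combinations to inspect.\<close>
  show False using c1 c2 nz(2) f(2) A(2) \<kappa> by (elim disjE) (simp_all add: cong_def)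
qed

context prime_over
begin

text \<open>The hypothesis \<open>res\<close> makes the residue field that of two elements, so a
  unit has the form \<open>1 + 2 z\<close>, and its square is
  \<open>1 + 4 (z + z^2)\<close>.\<close>

lemma lu_square_one4:
  assumes p: "p = 2" and un: unram and res: "\<forall>x\<in>OK. \<exists>k::int. x - of_int k \<in> P" and x: "lu x"
  shows "one4 (x^2)"
proof -
  obtain y t where yt: "y \<in> OK" "t \<in> OK" "t \<notin> P" "t \<noteq> 0" "x = y / t" using lu_L[OF x] by (rule L_E)
  have yP: "y \<notin> P" using x yt lu_fraction_iff by blast
  obtain k where k: "y - of_int k \<in> P" using res yt by blast
  obtain l where l: "t - of_int l \<in> P" using res yt by blast
  have odd: "odd j" if "z - of_int j \<in> P" "z \<notin> P" for z j
  proof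
    assume "even j"
    then have "of_int j \<in> P" using int_in_P p by simp
    then have "z \<in> P" using P_add[OF that(1)] by fastforce
    then show False using that by simp
  qed
  have "odd k" "odd l" using odd k l yP yt by blast+
  then have "of_int (k - l) \<in> P" unfolding int_in_P p by simp
  then have "(y - of_int k) - (t - of_int l) + of_int (k - l) \<in> P" using k l P_add P_diff by blast
  then have ytP: "y - t \<in> P" by simp
  have "x - 1 = (y - t) / t" using yt by (simp add: field_simps)
  then have "x - 1 \<in> L" "\<not> lu (x - 1)" using lu_fraction_iff[of "y - t" t] ytP yt lu_OK by auto
  then obtain z where z: "z \<in> L" "x - 1 = 2 * z" using unram_E[OF un] p by auto
  have "x = 1 + 2 * z" using z(2) by (simp add: algebra_simps)
  then have "x^2 = 1 + 4 * (z + z^2)" by (simp add: power2_eq_square algebra_simps)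
  then show ?thesis unfolding one4_def using z by (intro bexI[of _ "z + z^2"]) auto
qed

text \<open>With \<open>y = h / g\<close> one has \<open>c = y^2 \<phi>\<close>. As \<open>c\<close>
  and \<phi> are units, \<open>y\<close> is a unit too, so \<open>y^2\<close> is 1 modulo 4 by
  \<open>lu_square_one4\<close>; the resulting congruence for \<open>c\<close> in \<open>L\<close>
  descends to the integers.\<close>

lemma split_2_sign:
  assumes p: "p = 2" and un: unram and res: "\<forall>x\<in>OK. \<exists>k::int. x - of_int k \<in> P"
    and \<phi>: "one4 \<phi>" and h: "h \<in> K" and g: "g \<noteq> 0" and c: "odd c"
    and eq: "of_int c * of_rat g^2 = h^2 * \<phi>"
  shows "c mod 4 = 1"
proof -
  define y where "y = h / of_rat g"
  have c0: "c \<noteq> 0" using c by auto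
  have h0: "h \<noteq> 0" using eq c0 g by auto
  have y: "y \<in> K" "y \<noteq> 0" unfolding y_def using h h0 g by auto
  have yc: "of_int c = y^2 * \<phi>" unfolding y_def using eq g by (simp add: power_divide field_simps)
  have cu: "lu (of_int c)" using lu_int p c by simp
  have \<phi>u: "lu \<phi>" using one4_lu p \<phi> by blast
  have "y^2 = of_int c / \<phi>" using yc lu_0[OF \<phi>u] by simp
  then have y2: "lu (y^2)" using cu \<phi>u by simp
  obtain k where k: "lu (y / of_int p powi k)" using unram_val[OF un y] by blast
  have p0: "of_int p \<noteq> (0::complex)" using p by simp
  have "lu (y^2 / (y / of_int p powi k)^2)" using y2 k by blast
  moreover have "y^2 / (y / of_int p powi k)^2 = of_int p powi (k * 2)"
    using y p0 by (simp add: power_divide power_int_mult)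
  ultimately have "k * 2 = 0" using lu_prime_power by metis
  then have "lu y" using k by simp
  then have "one4 (of_int c)" unfolding yc using one4_mult[OF lu_square_one4[OF p un res] \<phi>] by blast
  then obtain z where z: "z \<in> L" "of_int c = 1 + 4 * z" by (auto simp: one4_def)
  have "of_int (c - 1) / of_int p ^ 2 = z" using z p by simp
  then have "of_int (c - 1) / of_int p ^ 2 \<in> L" using z(1) by simp
  then have "p^2 dvd c - 1" by (rule int_fraction_in_L)
  then show ?thesis unfolding p by simp presburger
qed

lemma one4_add_4: "one4 x \<Longrightarrow> y \<in> L \<Longrightarrow> one4 (x + 4 * y)"
proof -
  assume "one4 x" "y \<in> L"
  then obtain z where z: "z \<in> L" "x = 1 + 4 * z" by (auto simp: one4_def)
  have "x + 4 * y = 1 + 4 * (z + y)" by (simp add: z algebra_simps)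
  then show ?thesis unfolding one4_def using z \<open>y \<in> L\<close> by (intro bexI[of _ "z + y"]) auto
qed

end

section \<open>The sign of the norm of \<open>c6\<close>\<close>

context good_curve
begin

text \<open>12 is even, but modulo 16 it is neither 0 nor 4. Hence \<open>j = 1728\<close> does not
  occur and \<open>c6\<close> is nonzero.\<close>

lemma A_ne_12: "A \<noteq> 12"
  using two_cases by auto

lemma cube_ne: "A^3 - 1728 \<noteq> 0"
  using cube_eq_1728_iff A_ne_12 by simp

text \<open>In \<open>c6^2 = (A^3 - 1728) \<Delta>\<close> the norms of \<open>c6^2\<close> and of
  the nonzero rational factor are squares, so the norm of \<Delta> is positive.\<close>

lemma model_norm_disc_pos:
  assumes "is_model P v b \<nu>" shows "N (disc b) > 0"
proof -
  have O: "c6 b \<in> OK" "disc b \<in> OK" "disc b \<notin> P" using assms N_c4_c6_coeff unfolding is_model_def by blast+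
  have "N (c6 b) ^ 2 = N (c6 b ^ 2)" using O by (simp add: N_power)
  also have "c6 b ^ 2 = of_int (A^3 - 1728) * disc b" using assms by (simp add: is_model_def)
  also have "N (of_int (A^3 - 1728) * disc b) = (of_int (A^3 - 1728))^2 * N (disc b)" using O by (simp only: N_mult N_of_int K_of_int OK_K)
  finally have e: "N (c6 b) ^ 2 = (of_int (A^3 - 1728))^2 * N (disc b)" .
  have c: "(of_int (A^3 - 1728) :: rat)^2 > 0" using cube_ne by (simp only: of_int_eq_0_iff zero_less_power2) simp
  have "\<nu> > 0" "\<bar>N (disc b)\<bar> = of_int \<nu> ^ 12" using assms by (auto simp: is_model_def)
  then have "N (disc b) \<noteq> 0" by auto
  moreover have "N (disc b) \<ge> 0"
    using e c by (metis zero_le_mult_iff zero_le_power2 not_less order_less_imp_le)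
  ultimately show ?thesis by simp
qed

lemma model_norm_c4_eq:
  assumes "is_model P v b \<nu>" shows "N (c4 b) = of_int (A^2 * \<nu>^4)"
proof -
  have O: "c4 b \<in> OK" "disc b \<in> OK" using assms N_c4_c6_coeff unfolding is_model_def by blast+
  have "N (c4 b) ^ 3 = N (c4 b ^ 3)" using O by (simp add: N_power)
  also have "c4 b ^ 3 = of_int A ^ 3 * disc b" using assms by (simp add: is_model_def)
  also have "N (of_int A ^ 3 * disc b) = (of_int A^2)^3 * N (disc b)" using O by (simp add: N_mult N_power)
  finally have "N (c4 b) ^ 3 \<ge> 0" using model_norm_disc_pos[OF assms] by simp
  then have "N (c4 b) \<ge> 0" using zero_le_power_eq[of "N (c4 b)" 3] by auto
  then show ?thesis using model_norm_c4[OF assms] by simp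
qed

lemma norm_c4: "N (c4 a) = (of_int A * n^2)^2"
proof -
  obtain P where P: "prime_over m P 2" using prime_exists[of 2] by auto
  obtain v b \<nu> where M: "is_model P v b \<nu>" using model_exists P by blast
  have v: "v \<in> K" "c4 b \<in> OK" "c4 a = v^4 * c4 b" "n = of_int \<nu> * \<bar>N v\<bar>" using M N_c4_c6_coeff unfolding is_model_def by blast+
  have "N (c4 a) = N v ^ 4 * of_int (A^2 * \<nu>^4)" unfolding v(3) using v(1,2) by (simp add: N_mult N_power model_norm_c4_eq[OF M])
  also have "N v ^ 4 = \<bar>N v\<bar> ^ 4" by simp
  finally show ?thesis unfolding v(4) by (simp add: power_mult_distrib flip: power_mult)
qed

text \<open>One sign serves all models because the passage from one to another multiplies the norm
  of \<open>c6\<close> by a sixth power. In the end \<kappa> turns out to be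
  \<open>eps D\<close>.\<close>

lemma norm_c6_sign:
  "\<exists>\<kappa>::int. (\<kappa> = 1 \<or> \<kappa> = -1) \<and> N (c6 a) = of_int (\<kappa> * (A^3 - 1728)) * n^6 \<and>
    (\<forall>P v b \<nu>. is_model P v b \<nu> \<longrightarrow> N (c6 b) = of_int (\<kappa> * (A^3 - 1728) * \<nu>^6))"
proof -
  have rel: "N (c6 a) = \<bar>N v\<bar>^6 * N (c6 b)" if M: "is_model P v b \<nu>" for P v b \<nu>
  proof -
    have v: "v \<in> K" "c6 b \<in> OK" "c6 a = v^6 * c6 b" using M N_c4_c6_coeff unfolding is_model_def by blast+
    have "N (c6 a) = N v ^ 6 * N (c6 b)" unfolding v(3) using v(1,2) by (simp add: N_mult N_power)
    then show ?thesis by simp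
  qed
  obtain P where P: "prime_over m P 2" using prime_exists[of 2] by auto
  obtain v b \<nu> where M: "is_model P v b \<nu>" using model_exists P by blast
  have v: "n = of_int \<nu> * \<bar>N v\<bar>" "\<nu> > 0" using M unfolding is_model_def by blast+
  have "\<bar>N (c6 a)\<bar> = \<bar>N v\<bar>^6 * of_int (\<bar>A^3 - 1728\<bar> * \<nu>^6)" unfolding rel[OF M]
    by (simp only: abs_mult model_norm_c6[OF M]) simp
  also have "\<dots> = \<bar>of_int (A^3 - 1728) * n^6\<bar>" unfolding v(1) using v(2)
    by (simp only: abs_mult power_mult_distrib of_int_mult of_int_abs power_abs abs_abs) (simp add: power_abs)
  finally have "N (c6 a) = of_int (A^3 - 1728) * n^6 \<or> N (c6 a) = - (of_int (A^3 - 1728) * n^6)"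
    by (simp only: abs_eq_iff)
  then obtain \<kappa> :: int where \<kappa>: "\<kappa> = 1 \<or> \<kappa> = -1" "N (c6 a) = of_int (\<kappa> * (A^3 - 1728)) * n^6"
  proof
    assume "N (c6 a) = of_int (A^3 - 1728) * n^6" then show ?thesis using that[of 1] by simp
  next
    assume "N (c6 a) = - (of_int (A^3 - 1728) * n^6)" then show ?thesis using that[of "-1"] by (simp add: algebra_simps)
  qed
  have "N (c6 b) = of_int (\<kappa> * (A^3 - 1728) * \<nu>^6)" if M: "is_model P v b \<nu>" for P v b \<nu>
  proof -
    have v: "n = of_int \<nu> * \<bar>N v\<bar>" "v \<in> K" "v \<noteq> 0" using M unfolding is_model_def by blast+
    have "\<bar>N v\<bar>^6 * N (c6 b) = \<bar>N v\<bar>^6 * of_int (\<kappa> * (A^3 - 1728) * \<nu>^6)"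
      using \<kappa>(2) unfolding rel[OF M] unfolding v(1) by (simp add: power_mult_distrib algebra_simps)
    moreover have "\<bar>N v\<bar>^6 \<noteq> 0" using v N_0_iff by simp
    ultimately show ?thesis by (simp only: mult_cancel_left) simp
  qed
  then show ?thesis using \<kappa> by blast
qed

lemma a1_iff_c4:
  assumes M: "is_model P v (a1, a2, a3, a4, a6) \<nu>" and P: "prime_over m P 2"
  shows "a1 \<in> P \<longleftrightarrow> even A"
proof -
  interpret prime_over m P 2 by (rule P)
  have O: "coeffs_in OK (a1, a2, a3, a4, a6)" "disc (a1, a2, a3, a4, a6) \<in> OK" "disc (a1, a2, a3, a4, a6) \<notin> P"
    "c4 (a1, a2, a3, a4, a6) ^ 3 = of_int A ^ 3 * disc (a1, a2, a3, a4, a6)" using M unfolding is_model_def by blast+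
  have O': "a1 \<in> OK" "a2 \<in> OK" "a3 \<in> OK" "a4 \<in> OK" using O(1) by auto
  show ?thesis
  proof
    assume "even A"
    then show "a1 \<in> P" using c4_in_P_imp_a1[OF refl O(1)] model_c4_in_P[OF M P] by blast
  next
    assume a1: "a1 \<in> P"
    have two: "2 \<in> P" using p_in_P by simp
    have "c4 (a1, a2, a3, a4, a6) = a1 * (a1 * (a1^2 + 8 * a2)) + 2 * (8 * a2^2 - 12 * (2 * a4 + a1 * a3))"
      by (simp add: Let_def power2_eq_square algebra_simps)
    also have "\<dots> \<in> P" by (intro P_add P_mult2[OF a1] P_mult2[OF two]) (use O' in auto)
    finally have "c4 (a1, a2, a3, a4, a6) * c4 (a1, a2, a3, a4, a6)^2 \<in> P"
      using N_c4_c6_coeff[OF O(1)] by (intro P_mult2) blast+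
    then have "of_int A ^ 3 * disc (a1, a2, a3, a4, a6) \<in> P" unfolding O(4)[symmetric] by (simp only: power3_eq_cube power2_eq_square mult.assoc)
    then have "of_int A ^ 3 \<in> P" using P_prime O by (meson OK_of_int OK_power)
    then have "of_int A \<in> P" by (rule P_power[rotated]) simp
    then show "even A" using int_in_P[of A] by simp
  qed
qed

end

context quad_field
begin

lemma cj_c6:
  assumes "a1 \<in> K" "a2 \<in> K" "a3 \<in> K" "a4 \<in> K" "a6 \<in> K"
  shows "cj (c6 (a1, a2, a3, a4, a6)) = c6 (cj a1, cj a2, cj a3, cj a4, cj a6)"
  using assms by (simp add: c6_def cj_add cj_diff cj_mult cj_power)

end

context good_curve
begin

text \<open>For odd \<open>A\<close> the product \<open>c4 c6\<close> is \<open>- a1^10\<close>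
  modulo 4, and for \<open>A\<close> divisible by 16 the quotient \<open>c6 / 8\<close> is
  \<open>a3^2\<close> modulo 4. The norm of either is \<kappa> D times an odd square when the model
  has odd \<nu>, which gives the claim modulo 4; at a ramified prime the evenness of traces improves
  it to modulo 8. When 2 splits, the same congruences are used in \<open>L\<close> instead.\<close>

lemma sign_mod_4:
  assumes E: "D * t^2 = A^3 - 1728" and sf: "squarefree D" and D: "odd D"
    and \<kappa>: "\<kappa> = 1 \<or> \<kappa> = -1" and Na: "N (c6 a) = of_int (\<kappa> * (A^3 - 1728)) * n^6"
    and Nb: "\<And>P v b \<nu>. is_model P v b \<nu> \<Longrightarrow> N (c6 b) = of_int (\<kappa> * (A^3 - 1728) * \<nu>^6)"
  shows "(\<kappa> * D) mod 4 = 1 \<and> (m mod 4 \<noteq> 1 \<longrightarrow> (\<kappa> * D) mod 8 = 1)"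
proof -
  have A2: "2 dvd A \<Longrightarrow> 16 dvd A \<or> 16 dvd A - 4" using two_cases by blast
  have \<kappa>D: "odd (\<kappa> * D)" using \<kappa> D by auto
  have At: "odd A \<and> odd t \<or> 16 dvd A \<and> (\<exists>t'. t = 8 * t' \<and> odd t')"
    by (rule good_cases[OF A2 sf E]) (use D in auto)
  obtain P where P: "prime_over m P 2"
    and alt: "2 dvd disc_K \<and> (\<forall>x\<in>P. cj x \<in> P) \<or>
      prime_over.unram m P 2 \<and> (\<forall>x\<in>P. cj x \<in> P) \<and> (\<forall>x\<in>P. \<exists>y\<in>OK. x = of_int 2 * y) \<or>
      \<not> 2 dvd disc_K \<and> prime_over.unram m P 2 \<and> (\<forall>x\<in>OK. \<exists>k::int. x - of_int k \<in> P)"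
    using prime_exists[of 2] by auto
  interpret prime_over m P 2 by (rule P)
  have dk: "2 dvd disc_K \<longleftrightarrow> m mod 4 \<noteq> 1"
  proof (cases "m mod 4 = 1")
    case True
    then have "odd m" by presburger
    then show ?thesis using True by (simp add: disc_K_eq)
  qed (simp add: disc_K_eq)
  obtain v b \<nu> where M: "is_model P v b \<nu>" using model_exists P by blast
  obtain a1 a2 a3 a4 a6 where e: "b = (a1, a2, a3, a4, a6)" by (metis prod_cases5)
  have O: "a1 \<in> OK" "a2 \<in> OK" "a3 \<in> OK" "a4 \<in> OK" "a6 \<in> OK" "coeffs_in OK b" "disc b \<notin> P"
    using M unfolding is_model_def e by auto
  have cO: "c4 b \<in> OK" "c6 b \<in> OK" using N_c4_c6_coeff O(6) by blast+
  have a1A: "a1 \<in> P \<longleftrightarrow> even A" using a1_iff_c4[OF M[unfolded e] P] .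
  \<comment> \<open>Covers the ramified and the inert case alike: \<nu> is odd there, so integer
    norms can be compared directly.\<close>
  have stable_case: ?thesis
    if st: stable and half: "even A \<Longrightarrow> \<exists>\<alpha>\<in>OK. a1 = 2 * \<alpha>"
  proof -
    have \<nu>: "odd \<nu>" using model_stable[OF M P st] .
    from At show ?thesis
    proof
      assume o: "odd A \<and> odd t"
      obtain F where F: "F \<in> OK" "c4 b * c6 b = - (a1^10) + of_int 4 * F"
      proof (rule that)
        show "c4 b * c6 b = - (a1^10) + of_int 4 *
          ((a1^2 + 4*a2)^2 * (9 * (a1^2 + 4*a2) * (2*a4 + a1*a3) - 54 * (a3^2 + 4*a6))
          - 6 * (2*a4 + a1*a3) * (36 * (a1^2 + 4*a2) * (2*a4 + a1*a3) - (a1^2 + 4*a2)^3 - 216 * (a3^2 + 4*a6))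
          - a2 * ((a1^2 + 4*a2)^4 + (a1^2 + 4*a2)^3 * a1^2 + (a1^2 + 4*a2)^2 * a1^4 + (a1^2 + 4*a2) * a1^6 + a1^8))"
          unfolding e c4_mult_c6_mod_4 by simp
      qed (use O in \<open>auto intro!: OK_add OK_diff OK_mult OK_power\<close>)
      obtain i k where ik: "N (- (a1^10) + of_int 4 * F) = N (- (a1^10)) + of_int (4 * i + 4^2 * k)" "m mod 4 \<noteq> 1 \<longrightarrow> even i"
        using N_add_mult[of "- (a1^10)" F 4] O F by blast
      obtain l where l: "N a1 = of_int l" using OK_N_int O by blast
      have "N (- (a1^10)) = of_int (l^10)" using O l by (simp add: N_uminus N_power)
      moreover have "N (c4 b * c6 b) = of_int (A^2 * \<nu>^4) * of_int (\<kappa> * (A^3 - 1728) * \<nu>^6)"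
        using cO Nb[OF M] model_norm_c4_eq[OF M] by (simp only: N_mult OK_K)
      ultimately have "of_int (A^2 * \<nu>^4 * (\<kappa> * (A^3 - 1728) * \<nu>^6)) = (of_int (l^10 + (4 * i + 4^2 * k)) :: rat)"
        using ik(1) unfolding F(2) by (simp only: of_int_mult of_int_add)
      then have "A^2 * \<nu>^4 * (\<kappa> * (A^3 - 1728) * \<nu>^6) = l^10 + (4 * i + 4^2 * k)" by (simp only: of_int_eq_iff)
      moreover have "A^2 * \<nu>^4 * (\<kappa> * (D * t^2) * \<nu>^6) = (\<kappa> * D) * (A * t * \<nu>^5)^2"
        by (simp add: power_mult_distrib flip: power_mult power_add)
      moreover have "l^10 = (l^5)^2" by (simp flip: power_mult)
      ultimately have "(\<kappa> * D) * (A * t * \<nu>^5)^2 = (l^5)^2 + (4 * i + 4^2 * k)" unfolding E by metis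
      then show ?thesis using cong_1_mod_4_of_square[OF _ _ \<kappa>D] ik(2) o \<nu> by (metis even_mult_iff even_power)
    next
      assume o: "16 dvd A \<and> (\<exists>t'. t = 8 * t' \<and> odd t')"
      then obtain t' where t': "t = 8 * t'" "odd t'" by blast
      have "even A" using o by auto
      then obtain \<alpha> where \<alpha>: "\<alpha> \<in> OK" "a1 = 2 * \<alpha>" using half by blast
      define F where "F = 9 * (\<alpha>^2 + a2) * (a4 + \<alpha> * a3) - 2 * (\<alpha>^2 + a2)^3 - 7 * a3^2 - 27 * a6"
      have F: "F \<in> OK" unfolding F_def using \<alpha> O by auto
      have c6: "c6 b = 8 * (a3^2 + of_int 4 * F)" unfolding e \<alpha> F_def by (simp only: invariants_even_a1 of_int_numeral)
      obtain i k where ik: "N (a3^2 + of_int 4 * F) = N (a3^2) + of_int (4 * i + 4^2 * k)" "m mod 4 \<noteq> 1 \<longrightarrow> even i"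
        using N_add_mult[of "a3^2" F 4] O F by blast
      obtain l where l: "N a3 = of_int l" using OK_N_int O by blast
      have "N (a3^2) = of_int (l^2)" using O l by (simp add: N_power)
      moreover have "N (c6 b) = 8^2 * N (a3^2 + of_int 4 * F)" unfolding c6
        using N_mult[of 8 "a3^2 + of_int 4 * F"] O F by auto
      ultimately have "of_int (\<kappa> * (A^3 - 1728) * \<nu>^6) = (of_int (8^2 * (l^2 + (4 * i + 4^2 * k))) :: rat)"
        unfolding Nb[OF M] ik(1) by (simp only: of_int_mult of_int_add of_int_power of_int_numeral)
      then have "\<kappa> * (A^3 - 1728) * \<nu>^6 = 8^2 * (l^2 + (4 * i + 4^2 * k))" by (simp only: of_int_eq_iff)
      moreover have "\<kappa> * (D * t^2) * \<nu>^6 = 8^2 * ((\<kappa> * D) * (t' * \<nu>^3)^2)"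
        unfolding t' by (simp add: power_mult_distrib flip: power_mult)
      ultimately have "8^2 * ((\<kappa> * D) * (t' * \<nu>^3)^2) = 8^2 * (l^2 + (4 * i + 4^2 * k))" unfolding E by metis
      then have "(\<kappa> * D) * (t' * \<nu>^3)^2 = l^2 + (4 * i + 4^2 * k)" by simp
      then show ?thesis using cong_1_mod_4_of_square[OF _ _ \<kappa>D] ik(2) t' \<nu> by (metis even_mult_iff even_power)
    qed
  qed
  from alt show ?thesis
  proof (elim disjE conjE)
    assume d: "2 dvd disc_K" and st: "\<forall>x\<in>P. cj x \<in> P"
    have st: stable using st by (simp add: stable_def)
    have m4: "m mod 4 \<noteq> 1" using d dk by blast
    have \<nu>: "odd \<nu>" using model_stable[OF M P st] .
    show ?thesis
    proof (rule stable_case[OF st])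
      assume Ae: "even A"
      then have "16 dvd A" using At by blast
      have a1: "a1 \<in> P" using a1A Ae by blast
      have a3: "a3 \<notin> P" using a3_notin_P[OF refl O(6)[unfolded e] a1] O(7) unfolding e by blast
      from ramified_2_form[OF refl st m4 O(6)[unfolded e] a1 a3] show "\<exists>\<alpha>\<in>OK. a1 = 2 * \<alpha>"
      proof
        assume "(\<exists>f\<in>OK. c4 (a1, a2, a3, a4, a6) = 4 * (1 + 2 * s + 4 * f)) \<and>
          (m mod 4 = 2 \<longrightarrow> (\<exists>h\<in>OK. c6 (a1, a2, a3, a4, a6) = 8 * (s + 2 * h)))"
        then obtain A' where "A = 4 * A'" "odd A'" using odd_form[OF m4 M \<nu>] unfolding e by blast
        then show ?thesis using \<open>16 dvd A\<close> by presburger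
      qed
    qed
  next
    assume "unram" and st: "\<forall>x\<in>P. cj x \<in> P" and two: "\<forall>x\<in>P. \<exists>y\<in>OK. x = of_int 2 * y"
    show ?thesis
    proof (rule stable_case)
      show stable using st by (simp add: stable_def)
      assume "even A"
      then show "\<exists>\<alpha>\<in>OK. a1 = 2 * \<alpha>" using a1A two by simp
    qed
  next
    assume d: "\<not> 2 dvd disc_K" and un: unram and res: "\<forall>x\<in>OK. \<exists>k::int. x - of_int k \<in> P"
    have m4: "m mod 4 = 1" using d dk by blast
    have P2: "prime_over m (cj ` P) 2" by (rule prime_over_cj) (rule P)
    interpret Q: prime_over m "cj ` P" 2 by (rule P2)
    have cjP: "cj x \<notin> P" if "x \<in> OK" "x \<notin> cj ` P" for x
    proof
      assume "cj x \<in> P"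
      then have "cj (cj x) \<in> cj ` P" by blast
      then show False using that by simp
    qed
    \<comment> \<open>When 2 splits, \<nu> may be even. The first factor of each norm is therefore
      computed from the model at \<open>P\<close>, and the conjugate factor from a second model at
      the conjugate prime, carried back to \<open>P\<close> by conjugation.\<close>
    obtain v2 b' \<nu>2 where M2: "is_model (cj ` P) v2 b' \<nu>2" using model_exists P2 by blast
    obtain e1 e2 e3 e4 e6 where e': "b' = (e1, e2, e3, e4, e6)" by (metis prod_cases5)
    have O': "e1 \<in> OK" "e2 \<in> OK" "e3 \<in> OK" "e4 \<in> OK" "e6 \<in> OK" "coeffs_in OK b'" "disc b' \<notin> cj ` P"
      using M2 unfolding is_model_def e' by auto
    have e1A: "e1 \<in> cj ` P \<longleftrightarrow> even A" using a1_iff_c4[OF M2[unfolded e'] P2] .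
    have v: "v \<in> K" "v \<noteq> 0" "v2 \<in> K" "v2 \<noteq> 0" "c4 a = v^4 * c4 b" "c6 a = v^6 * c6 b"
      "c4 a = v2^4 * c4 b'" "c6 a = v2^6 * c6 b'" using M M2 unfolding is_model_def by blast+
    define y where "y = v * cj v2"
    have y: "y \<in> K" unfolding y_def using v by auto
    have sq: "one4 (x^2)" if "x \<in> OK" "x \<notin> P" for x
      using lu_square_one4[OF refl un res] lu_OK that by blast
    have "(\<kappa> * D) mod 4 = 1"
      using At
    proof
      assume o: "odd A \<and> odd t"
      define F where "F = (\<lambda>a1 a2 a3 a4 a6 :: complex. (a1^2 + 4*a2)^2 * (9 * (a1^2 + 4*a2) * (2*a4 + a1*a3) - 54 * (a3^2 + 4*a6))
          - 6 * (2*a4 + a1*a3) * (36 * (a1^2 + 4*a2) * (2*a4 + a1*a3) - (a1^2 + 4*a2)^3 - 216 * (a3^2 + 4*a6))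
          - a2 * ((a1^2 + 4*a2)^4 + (a1^2 + 4*a2)^3 * a1^2 + (a1^2 + 4*a2)^2 * a1^4 + (a1^2 + 4*a2) * a1^6 + a1^8))"
      have FO: "F a1 a2 a3 a4 a6 \<in> OK" "F e1 e2 e3 e4 e6 \<in> OK" unfolding F_def using O O'
        by (auto intro!: OK_add OK_diff OK_mult OK_power)
      have "c4 b * c6 b = - (a1^10) + 4 * F a1 a2 a3 a4 a6" "c4 b' * c6 b' = - (e1^10) + 4 * F e1 e2 e3 e4 e6"
        unfolding e e' F_def by (rule c4_mult_c6_mod_4)+
      moreover have "c4 a * c6 a = v^10 * (c4 b * c6 b)" unfolding v(5,6) by (simp add: numeral_eq_Suc mult_ac)
      moreover have "c4 a * c6 a = v2^10 * (c4 b' * c6 b')" unfolding v(7,8) by (simp add: numeral_eq_Suc mult_ac)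
      ultimately have X: "c4 a * c6 a = v^10 * (- (a1^10) + 4 * F a1 a2 a3 a4 a6)"
        "c4 a * c6 a = v2^10 * (- (e1^10) + 4 * F e1 e2 e3 e4 e6)" by metis+
      define \<phi> where "\<phi> = (a1^10 + 4 * (- F a1 a2 a3 a4 a6)) * (cj e1^10 + 4 * (- cj (F e1 e2 e3 e4 e6)))"
      have "a1 \<notin> P" "e1 \<notin> cj ` P" using o a1A e1A by auto
      then have "a1^5 \<notin> P" "cj e1^5 \<notin> P" using P_power O(1) cjP[OF O'(1)] O'(1) by blast+
      then have "one4 ((a1^5)^2)" by (intro sq OK_power O(1))
      moreover have "one4 ((cj e1^5)^2)" using \<open>cj e1^5 \<notin> P\<close> by (intro sq OK_power OK_cj O'(1))
      ultimately have "one4 (a1^10)" "one4 (cj e1^10)" by (simp_all flip: power_mult)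
      then have \<phi>1: "one4 \<phi>" unfolding \<phi>_def using FO by (intro one4_mult one4_add_4) auto
      have "of_rat (N (c4 a * c6 a)) = (c4 a * c6 a) * cj (c4 a * c6 a)" using N_cj c4_c6_K by blast
      also have "cj (c4 a * c6 a) = cj v2^10 * (- (cj e1^10) + 4 * cj (F e1 e2 e3 e4 e6))"
        unfolding X(2) using v O'(1) FO(2) by (simp add: cj_mult cj_diff cj_power)
      also have "(c4 a * c6 a) * \<dots> = (y^5)^2 * \<phi>" unfolding X(1) y_def \<phi>_def
        by (simp add: power_mult_distrib flip: power_mult) (simp add: algebra_simps)
      finally have e1: "of_rat (N (c4 a * c6 a)) = (y^5)^2 * \<phi>" .
      have "N (c4 a * c6 a) = (of_int A * n^2)^2 * (of_int (\<kappa> * (D * t^2)) * n^6)"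
        using c4_c6_K by (simp only: N_mult norm_c4 Na E)
      also have "\<dots> = of_int (\<kappa> * D) * (of_int A * of_int t * n^5)^2"
        by (simp add: power_mult_distrib flip: power_mult power_add)
      finally have "of_int (\<kappa> * D) * of_rat (of_int A * of_int t * n^5)^2 = (y^5)^2 * \<phi>"
        using e1 by (simp add: of_rat_mult of_rat_power)
      moreover have "of_int A * of_int t * n^5 \<noteq> 0" using o n0 by auto
      moreover have "y^5 \<in> K" using y by simp
      ultimately show ?thesis using split_2_sign[OF refl un res \<phi>1 _ _ \<kappa>D] by blast
    next
      assume o: "16 dvd A \<and> (\<exists>t'. t = 8 * t' \<and> odd t')"
      then obtain t' where t': "t = 8 * t'" "odd t'" by blast
      have Ae: "even A" using o by auto
      have a1: "a1 \<in> P" "e1 \<in> cj ` P" using a1A e1A Ae by blast+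
      have a3: "a3 \<notin> P" using a3_notin_P[OF refl O(6)[unfolded e] a1(1)] O(7) unfolding e by blast
      have e3: "e3 \<notin> cj ` P" using Q.a3_notin_P[OF refl O'(6)[unfolded e'] a1(2)] O'(7) unfolding e' by blast
      have "\<not> lu a1" using lu_OK_iff a1 O by blast
      then obtain \<alpha> where \<alpha>: "\<alpha> \<in> L" "a1 = 2 * \<alpha>" using unram_E[OF un OK_L[OF O(1)]] by auto
      obtain e0 where e0: "e0 \<in> P" "e1 = cj e0" using a1(2) by blast
      then have "cj e1 \<in> P" using P_OK by auto
      then have "\<not> lu (cj e1)" using lu_OK_iff O' by blast
      then obtain \<gamma> where \<gamma>: "\<gamma> \<in> L" "cj e1 = 2 * \<gamma>" using unram_E[OF un OK_L[OF OK_cj[OF O'(1)]]] by auto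
      define F where "F = (\<lambda>\<alpha> a2 a3 a4 a6 :: complex. 9 * (\<alpha>^2 + a2) * (a4 + \<alpha> * a3) - 2 * (\<alpha>^2 + a2)^3 - 7 * a3^2 - 27 * a6)"
      have FL: "F \<alpha> a2 a3 a4 a6 \<in> L" "F \<gamma> (cj e2) (cj e3) (cj e4) (cj e6) \<in> L"
        unfolding F_def using \<alpha> \<gamma> O O' by (auto intro!: L_add L_diff L_mult L_power)
      define \<phi> where "\<phi> = (a3^2 + 4 * F \<alpha> a2 a3 a4 a6) * (cj e3^2 + 4 * F \<gamma> (cj e2) (cj e3) (cj e4) (cj e6))"
      have \<phi>1: "one4 \<phi>" unfolding \<phi>_def using sq[OF O(3) a3] sq[OF OK_cj[OF O'(3)] cjP[OF O'(3) e3]] FL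
        by (intro one4_mult one4_add_4) auto
      have c6b: "c6 b = 8 * (a3^2 + 4 * F \<alpha> a2 a3 a4 a6)" unfolding e \<alpha> F_def by (rule invariants_even_a1)
      have "cj (c6 b') = c6 (2 * \<gamma>, cj e2, cj e3, cj e4, cj e6)" unfolding e' using O' \<gamma> by (simp add: cj_c6)
      then have c6b': "cj (c6 b') = 8 * (cj e3^2 + 4 * F \<gamma> (cj e2) (cj e3) (cj e4) (cj e6))"
        unfolding F_def invariants_even_a1 .
      have "of_rat (N (c6 a)) = c6 a * cj (c6 a)" using N_cj c4_c6_K by blast
      also have "cj (c6 a) = cj v2^6 * cj (c6 b')" unfolding v(8) using v(3) N_c4_c6_coeff[OF O'(6)]
        by (simp add: cj_mult cj_power)
      also have "c6 a * \<dots> = (8 * y^3)^2 * \<phi>" unfolding v(6) c6b c6b' y_def \<phi>_def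
        by (simp add: power2_eq_square power3_eq_cube power_mult_distrib numeral_eq_Suc algebra_simps)
      finally have e1: "of_rat (N (c6 a)) = (8 * y^3)^2 * \<phi>" .
      have "N (c6 a) = of_int (\<kappa> * (D * t^2)) * n^6" unfolding Na E ..
      also have "\<dots> = of_int (\<kappa> * D) * (8 * of_int t' * n^3)^2"
        unfolding t' by (simp add: power_mult_distrib flip: power_mult)
      finally have "of_int (\<kappa> * D) * of_rat (8 * of_int t' * n^3)^2 = (8 * y^3)^2 * \<phi>"
        using e1 by (simp add: of_rat_mult of_rat_power)
      moreover have "8 * of_int t' * n^3 \<noteq> 0" using t'(2) n0 by auto
      moreover have "8 * y^3 \<in> K" using y by simp
      ultimately show ?thesis using split_2_sign[OF refl un res \<phi>1 _ _ \<kappa>D] by blast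
    qed
    then show ?thesis using m4 by blast
  qed
qed

end

section \<open>The norm equation and the conditions (a)-(c)\<close>

lemma Legendre_eq_1I:
  fixes p a u v :: int
  assumes p: "prime p" and u: "\<not> p dvd u" and a: "\<not> p dvd a" and d: "p dvd a * u^2 - v^2"
  shows "Legendre a p = 1"
proof -
  have "coprime u p" using p u prime_imp_coprime coprime_commute by blast
  then obtain w where "[u * w = 1] (mod p)" using cong_solve_coprime_int by blast
  then obtain j where j: "u * w = 1 + p * j" by (rule cong_E)
  obtain i where i: "a * u^2 - v^2 = p * i" using d by (rule dvdE)
  have "(v * w)^2 = a * (u * w)^2 - (a * u^2 - v^2) * w^2" by (simp add: power2_eq_square algebra_simps)
  also have "\<dots> = a + p * (a * (2 * j + p * j^2) - i * w^2)" unfolding i j by (simp add: power2_eq_square algebra_simps)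
  finally have "[(v * w)^2 = a] (mod p)" by (rule cong_I)
  then have "QuadRes p a" unfolding QuadRes_def by blast
  moreover have "\<not> [a = 0] (mod p)" using a by (simp add: cong_iff_dvd_diff)
  ultimately show ?thesis by (simp add: Legendre_def)
qed

context quad_field
begin

lemma OK_double:
  assumes "x \<in> OK" obtains i j :: int where "2 * x = of_int i + of_int j * s"
proof -
  obtain a b where x: "x = of_int a + of_int b * om" using assms OK_E by blast
  from om_cases show ?thesis
  proof
    assume "m mod 4 = 1 \<and> 2 * om = 1 + s"
    then have "2 * x = 2 * of_int a + of_int b * (1 + s)" unfolding x by (metis distrib_left mult.left_commute)
    then have "2 * x = of_int (2 * a + b) + of_int b * s" by (simp add: algebra_simps)
    then show ?thesis by (rule that)
  next
    assume "m mod 4 \<noteq> 1 \<and> om = s"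
    then have "2 * x = of_int (2 * a) + of_int (2 * b) * s" unfolding x by (simp add: algebra_simps)
    then show ?thesis by (rule that)
  qed
qed

lemma norm_integer_point:
  fixes c :: int
  assumes x: "x \<in> K" and g: "g \<noteq> 0" and e: "N x = of_int c * g^2"
  obtains X Y Z :: int where "Z \<noteq> 0" "X^2 - m * Y^2 = c * Z^2"
    "\<forall>p. prime p \<longrightarrow> \<not> (p dvd X \<and> p dvd Y \<and> p dvd Z)"
proof -
  obtain \<alpha> \<beta> where ab: "x = em \<alpha> \<beta>" using x K_E by blast
  obtain u1 v1 where 1: "v1 > 0" "\<alpha> = of_int u1 / of_int v1" by (rule rat_quotient_E)
  obtain u2 v2 where 2: "v2 > 0" "\<beta> = of_int u2 / of_int v2" by (rule rat_quotient_E)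
  obtain u3 v3 where 3: "v3 > 0" "g = of_int u3 / of_int v3" by (rule rat_quotient_E)
  define X0 Y0 Z0 where "X0 = u1 * v2 * v3" and "Y0 = u2 * v1 * v3" and "Z0 = u3 * v1 * v2"
  have V: "of_int X0 = \<alpha> * of_int (v1 * v2 * v3)" "of_int Y0 = \<beta> * of_int (v1 * v2 * v3)" "of_int Z0 = g * of_int (v1 * v2 * v3)"
    unfolding X0_def Y0_def Z0_def 1 2 3 using 1(1) 2(1) 3(1) by (simp_all add: field_simps)
  have "\<alpha>^2 - of_int m * \<beta>^2 = of_int c * g^2" using e unfolding ab N_em .
  then have "(\<alpha>^2 - of_int m * \<beta>^2) * of_int (v1 * v2 * v3)^2 = of_int c * g^2 * of_int (v1 * v2 * v3)^2" by simp
  then have "of_int (X0^2 - m * Y0^2) = (of_int (c * Z0^2) :: rat)"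
    unfolding of_int_diff of_int_mult of_int_power V by (simp add: power_mult_distrib algebra_simps)
  then have e0: "X0^2 - m * Y0^2 = c * Z0^2" by (simp only: of_int_eq_iff)
  have "Z0 \<noteq> 0" using g 3 1(1) 2(1) by (auto simp: Z0_def)
  then obtain d X Y Z where d: "d \<noteq> 0" "X0 = d * X" "Y0 = d * Y" "Z0 = d * Z"
    and pr: "\<forall>p. prime p \<longrightarrow> \<not> (p dvd X \<and> p dvd Y \<and> p dvd Z)"
    using primitive_triple[of X0 Y0 Z0] by metis
  have "d^2 * (X^2 - m * Y^2) = d^2 * (c * Z^2)" using e0 unfolding d by (simp add: power_mult_distrib algebra_simps)
  then have "X^2 - m * Y^2 = c * Z^2" using d(1) by simp
  then show ?thesis using that[of Z X Y] pr \<open>Z0 \<noteq> 0\<close> d by auto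
qed

text \<open>At \<open>p\<close> dividing \<open>D\<close>, the equation makes \<open>p\<close>
  divide \<open>X\<close>, and one division by \<open>p\<close> leaves
  \<open>\<kappa> Z^2 + q Y^2 = 0\<close> modulo \<open>p\<close>. At \<open>l\<close> dividing
  \<open>q\<close> it reads \<open>X^2 = \<kappa> D Z^2\<close> modulo \<open>l\<close>. Primitivity
  and squarefreeness of \<open>m\<close> ensure that \<open>Y\<close> and \<open>Z\<close>,
  respectively, are invertible there.\<close>

lemma hilbert_conditions:
  fixes D q \<kappa> X Y Z :: int
  assumes mq: "m = q * D" and \<kappa>: "\<kappa> = 1 \<or> \<kappa> = -1" and Z0: "Z \<noteq> 0" and e: "X^2 - m * Y^2 = (\<kappa> * D) * Z^2"
    and pr: "\<forall>p. prime p \<longrightarrow> \<not> (p dvd X \<and> p dvd Y \<and> p dvd Z)"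
  shows "prime p \<Longrightarrow> p dvd D \<Longrightarrow> Legendre (- \<kappa> * q) p = 1"
    and "prime l \<Longrightarrow> l dvd q \<Longrightarrow> Legendre (\<kappa> * D) l = 1"
    and "\<kappa> * D < 0 \<Longrightarrow> m > 0"
proof -
  have nd: "\<not> (r dvd q \<and> r dvd D)" if "prime r" for r
  proof
    assume "r dvd q \<and> r dvd D"
    then have "r^2 dvd m" unfolding mq by (simp add: mult_dvd_mono power2_eq_square)
    then have "is_unit r" using sqfree squarefreeD by blast
    then show False using that by auto
  qed
  have \<kappa>\<kappa>: "\<kappa> * \<kappa> = 1" using \<kappa> by auto
  have D0: "D \<noteq> 0" using m0 mq by auto
  {
    assume p: "prime p" "p dvd D"
    obtain D1 where D1: "D = p * D1" using p by auto
    have p0: "p \<noteq> 0" using p by auto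
    have "X^2 = p * (q * D1 * Y^2 + \<kappa> * D1 * Z^2)" using e unfolding mq D1 by (simp add: algebra_simps)
    then have "p dvd X^2" by simp
    then have pX: "p dvd X" using p prime_dvd_power by blast
    then obtain X1 where X1: "X = p * X1" by auto
    have "p * (D1 * (\<kappa> * Z^2 + q * Y^2)) = p * (p * X1^2)"
      using e unfolding mq D1 X1 by (simp add: power2_eq_square algebra_simps)
    then have "D1 * (\<kappa> * Z^2 + q * Y^2) = p * X1^2" using p0 by simp
    then have "p dvd D1 * (\<kappa> * Z^2 + q * Y^2)" by simp
    moreover have "\<not> p dvd D1"
    proof
      assume "p dvd D1"
      then have "p^2 dvd m" unfolding mq D1 by (simp add: mult_dvd_mono power2_eq_square)
      then have "is_unit p" using sqfree squarefreeD by blast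
      then show False using p by auto
    qed
    ultimately have d: "p dvd \<kappa> * Z^2 + q * Y^2" using p prime_dvd_mult_iff by blast
    have Y: "\<not> p dvd Y"
    proof
      assume pY: "p dvd Y"
      then have "p dvd q * Y^2" by (simp add: power2_eq_square)
      then have "p dvd \<kappa> * Z^2" using d dvd_add_left_iff by blast
      then have "p dvd Z^2" using \<kappa> by auto
      then show False using p prime_dvd_power pr pX pY by blast
    qed
    have "(- \<kappa> * q) * Y^2 - Z^2 = - \<kappa> * (\<kappa> * Z^2 + q * Y^2)" using \<kappa> by auto
    then have "p dvd (- \<kappa> * q) * Y^2 - Z^2" using d by simp
    moreover have "\<not> p dvd - \<kappa> * q" using nd[OF p(1)] p \<kappa> by auto
    ultimately show "Legendre (- \<kappa> * q) p = 1" using Legendre_eq_1I p Y by blast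
  next
    assume l: "prime l" "l dvd q"
    have lm: "l dvd m" using l mq by simp
    have d: "l dvd (\<kappa> * D) * Z^2 - X^2"
    proof -
      have "(\<kappa> * D) * Z^2 - X^2 = - m * Y^2" using e by simp
      then show ?thesis using lm by simp
    qed
    have "\<not> l dvd Z"
    proof
      assume lZ: "l dvd Z"
      then have "l dvd (\<kappa> * D) * Z^2" by (simp add: power2_eq_square)
      from dvd_diff[OF this d] have "l dvd X^2" by simp
      then have lX: "l dvd X" using l prime_dvd_power by blast
      have "m * Y^2 = X^2 - (\<kappa> * D) * Z^2" using e by simp
      also have "l^2 dvd \<dots>" using lX lZ by (intro dvd_diff dvd_mult dvd_power_same)
      finally have "l dvd Y" using squarefree_dvd_mult_square_int[OF sqfree l(1)] by blast
      then show False using pr l lX lZ by blast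
    qed
    moreover have "\<not> l dvd \<kappa> * D" using nd[OF l(1)] l \<kappa> by auto
    ultimately show "Legendre (\<kappa> * D) l = 1" using Legendre_eq_1I l d by blast
  next
    assume neg: "\<kappa> * D < 0"
    show "m > 0"
    proof (rule ccontr)
      assume "\<not> m > 0"
      then have "m * Y^2 \<le> 0" by (simp add: mult_nonpos_nonneg)
      then have "X^2 - m * Y^2 \<ge> 0" using zero_le_power2[of X] by linarith
      moreover have "(\<kappa> * D) * Z^2 < 0" using neg Z0 by (simp add: mult_neg_pos)
      ultimately show False using e by simp
    qed
  }
qed

end

section \<open>The prime 3, divisibility of \<open>m\<close> by \<open>D\<close>, and even
  \<open>D\<close>\<close>

context good_curve
begin

text \<open>Modulo 3 one has \<open>c4 = b2^2\<close>, so 3 divides \<open>b2\<close> in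
  \<open>L\<close>. Then \<open>c6\<close> is divisible by 27, and
  \<open>c6^2 = (A^3 - 1728) \<Delta>\<close> with \<Delta> a unit gives the factor
  \<open>3^6\<close>.\<close>

lemma three_unram:
  assumes P: "prime_over m P 3" and un: "prime_over.unram m P 3" and A: "3 dvd A"
  shows "27 dvd A - 12"
proof -
  interpret prime_over m P 3 by (rule P)
  obtain v b \<nu> where M: "is_model P v b \<nu>" using model_exists P by blast
  obtain a1 a2 a3 a4 a6 where e: "b = (a1, a2, a3, a4, a6)" by (metis prod_cases5)
  have O: "coeffs_in OK b" "a1 \<in> OK" "a2 \<in> OK" "a3 \<in> OK" "a4 \<in> OK" "a6 \<in> OK" using M unfolding is_model_def e by auto
  have bO: "b2 b \<in> OK" "b4 b \<in> OK" "b6 b \<in> OK" unfolding e using O by auto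
  have d: "lu (disc b)" using M lu_OK unfolding is_model_def by blast
  have cO: "c4 b \<in> OK" using N_c4_c6_coeff O by blast
  have "\<not> lu (c4 b)" using lu_OK_iff[OF cO] model_c4_in_P[OF M P A] by blast
  moreover have "\<not> lu 24" using lu_int[of 24] by simp
  then have "\<not> lu (24 * b4 b)" by (rule not_lu_mult[rotated]) (use bO in auto)
  ultimately have "\<not> lu (c4 b + 24 * b4 b)" using cO bO by (intro not_lu_add) auto
  then have "\<not> lu (b2 b ^ 2)" unfolding c4_altdef by simp
  then have "\<not> lu (b2 b)" by blast
  then obtain \<beta> where \<beta>: "\<beta> \<in> L" "b2 b = 3 * \<beta>" using unram_E[OF un OK_L[OF bO(1)]] by auto
  define h where "h = 4 * \<beta> * b4 b - \<beta>^3 - 8 * b6 b"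
  have hL: "h \<in> L" unfolding h_def using \<beta> bO by auto
  have "c6 b = 27 * h" unfolding c6_def \<beta> h_def by (simp add: power_mult_distrib)
  then have "of_int (A^3 - 1728) * disc b = 3^6 * h^2" using M unfolding is_model_def by (simp add: power_mult_distrib)
  then have "of_int (A^3 - 1728) / of_int 3 ^ 6 = h^2 / disc b" using lu_0[OF d] by (simp add: field_simps)
  also have "\<dots> \<in> L" using hL d by blast
  finally have "3^6 dvd A^3 - 1728" by (rule int_fraction_in_L)
  then show ?thesis using three_power_imp_27 A by blast
qed

text \<open>Here 3 does not generate the maximal ideal, so \<open>b2\<close> in \<open>P\<close>
  only makes its rational coordinate divisible by 3. If the other coordinate is divisible too, the
  norm of \<open>c6\<close> yields \<open>3^6\<close> as in the unramified case; if not, the norms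
  of \<open>c4\<close> and \<open>c6\<close> contradict each other.\<close>

lemma three_ramified:
  assumes P: "prime_over m P 3" and st: "prime_over.stable m P" and m3: "3 dvd m" and A: "3 dvd A"
  shows "27 dvd A - 12"
proof -
  interpret prime_over m P 3 by (rule P)
  obtain v b \<nu> where M: "is_model P v b \<nu>" using model_exists P by blast
  have \<nu>: "\<not> 3 dvd \<nu>" using model_stable[OF M P st] .
  obtain a1 a2 a3 a4 a6 where e: "b = (a1, a2, a3, a4, a6)" by (metis prod_cases5)
  have O: "coeffs_in OK b" "a1 \<in> OK" "a2 \<in> OK" "a3 \<in> OK" "a4 \<in> OK" "a6 \<in> OK" using M unfolding is_model_def e by auto
  have bO: "b2 b \<in> OK" "b4 b \<in> OK" "b6 b \<in> OK" unfolding e using O by auto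
  have cO: "c4 b \<in> OK" "c6 b \<in> OK" using N_c4_c6_coeff O by blast+
  obtain \<kappa> where \<kappa>: "\<kappa> = 1 \<or> \<kappa> = -1" and Nb: "N (c6 b) = of_int (\<kappa> * (A^3 - 1728) * \<nu>^6)"
    using norm_c6_sign M by blast
  obtain A' where A': "A = 3 * A'" using A by auto
  obtain m' where m': "m = 3 * m'" using m3 by auto
  have nm: "\<not> 3 dvd m'"
  proof
    assume "3 dvd m'"
    then have "3^2 dvd m" unfolding m' by auto
    then have "is_unit (3::int)" by (rule squarefreeD[OF sqfree])
    then show False by simp
  qed
  obtain X0 Y0 where X0: "2 * b2 b = of_int X0 + of_int Y0 * s" using OK_double bO by blast
  obtain f0 g0 where f0: "2 * b4 b = of_int f0 + of_int g0 * s" using OK_double bO by blast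
  obtain i0 j0 where i0: "2 * b6 b = of_int i0 + of_int j0 * s" using OK_double bO by blast
  \<comment> \<open>The doubled quantities have integer coordinates with respect to 1 and
    \<open>s\<close>. Enlarging the factors to 4, 16 and 64 respects the weights of
    \<open>b2\<close>, \<open>b4\<close> and \<open>b6\<close>, so \<open>c4\<close> and
    \<open>c6\<close> are just multiplied by 16 and 64, and \<open>\<mu> = 4 \<nu>\<close> absorbs
    the change of the norms.\<close>
  define X Y f g i j where "X = 2 * X0" and "Y = 2 * Y0" and "f = 8 * f0" and "g = 8 * g0" and "i = 32 * i0" and "j = 32 * j0"
  define \<mu> where "\<mu> = 4 * \<nu>"
  have B: "4 * b2 b = of_int X + of_int Y * s" "16 * b4 b = of_int f + of_int g * s" "64 * b6 b = of_int i + of_int j * s"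
  proof -
    have "4 * b2 b = 2 * (2 * b2 b)" "16 * b4 b = 8 * (2 * b4 b)" "64 * b6 b = 32 * (2 * b6 b)" by simp_all
    then show "4 * b2 b = of_int X + of_int Y * s" "16 * b4 b = of_int f + of_int g * s" "64 * b6 b = of_int i + of_int j * s"
      unfolding X0 f0 i0 X_def Y_def f_def g_def i_def j_def by (simp_all add: algebra_simps)
  qed
  have \<mu>3: "\<not> 3 dvd \<mu>" unfolding \<mu>_def using \<nu> prime_dvd_mult_iff[of 3 4 \<nu>] by simp
  have c4: "16 * c4 b = (4 * b2 b)^2 - 24 * (16 * b4 b)" unfolding c4_altdef by (simp add: power_mult_distrib)
  have c6: "64 * c6 b = 36 * (4 * b2 b) * (16 * b4 b) - (4 * b2 b)^3 - 216 * (64 * b6 b)"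
    unfolding c6_def by (simp add: power_mult_distrib)
  have N4: "N (16 * c4 b) = of_int (A^2 * \<mu>^4)" using cO N_mult[of 16 "c4 b"] model_norm_c4_eq[OF M]
    by (simp add: \<mu>_def power_mult_distrib)
  have N6: "N (64 * c6 b) = of_int (\<kappa> * (A^3 - 1728) * \<mu>^6)"
  proof -
    have "N (64 * c6 b) = 64^2 * N (c6 b)" using cO N_mult[of 64 "c6 b"] by simp
    then show ?thesis unfolding Nb by (simp add: \<mu>_def power_mult_distrib)
  qed
  have "3 dvd X"
  proof -
    have "24 * b4 b = of_int 3 * (8 * b4 b)" by simp
    then have "24 * b4 b \<in> P" using P_mult2[OF p_in_P, of "8 * b4 b"] bO by auto
    then have "c4 b + 24 * b4 b \<in> P" using model_c4_in_P[OF M P A] P_add by blast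
    then have "b2 b ^ 2 \<in> P" unfolding c4_altdef by simp
    then have "b2 b \<in> P" using P_power bO by blast
    then have BP: "4 * b2 b \<in> P" using P_mult by auto
    have "3 dvd X^2 - m * Y^2"
      using stable_norm[OF st _ N_s_form[of X Y]] BP unfolding B by auto
    then have "3 dvd (X^2 - m * Y^2) + m * Y^2" using m3 by (intro dvd_add dvd_mult2)
    then have "3 dvd X^2" by simp
    then show ?thesis using prime_dvd_power[of 3 X 2] by simp
  qed
  then obtain x where x: "X = 3 * x" by auto
  \<comment> \<open>\<open>3 W\<close> and \<open>27 c\<close> are the coordinates of
    \<open>64 c6\<close> once \<open>X = 3 x\<close> and \<open>m = 3 m'\<close> are
    inserted.\<close>
  define W where "W = - (m' * Y^3) + 12 * Y * f + 9 * (4 * x * g - x^2 * Y - 8 * j)"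
  define c where "c = 4 * x * f + 4 * m' * Y * g - x^3 - x * m' * Y^2 - 8 * i"
  have sq: "(of_int X + of_int Y * s)^2 = of_int (X^2 + m * Y^2) + of_int (2 * X * Y) * s"
  proof -
    have "(of_int X + of_int Y * s)^2 = of_int X^2 + of_int Y^2 * (s * s) + of_int (2 * X * Y) * s"
      by (simp add: power2_eq_square algebra_simps)
    then show ?thesis unfolding ss by simp
  qed
  have cu: "(of_int X + of_int Y * s)^3 = of_int (X^3 + 3 * m * X * Y^2) + of_int (3 * X^2 * Y + m * Y^3) * s"
  proof -
    have "(of_int X + of_int Y * s)^3 = (of_int X + of_int Y * s) * (of_int (X^2 + m * Y^2) + of_int (2 * X * Y) * s)"
      unfolding sq[symmetric] by (simp add: power2_eq_square power3_eq_cube)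
    also have "\<dots> = of_int (X * (X^2 + m * Y^2)) + of_int (2 * X * Y^2) * (s * s) + of_int (2 * X^2 * Y + Y * (X^2 + m * Y^2)) * s"
      by (simp add: power2_eq_square algebra_simps)
    finally show ?thesis unfolding ss by (simp add: power2_eq_square power3_eq_cube algebra_simps)
  qed
  have "16 * c4 b = of_int (X^2 + m * Y^2 - 24 * f) + of_int (2 * X * Y - 24 * g) * s"
    unfolding c4 B sq by (simp add: algebra_simps)
  then have "of_int ((X^2 + m * Y^2 - 24 * f)^2 - m * (2 * X * Y - 24 * g)^2) = (of_int (A^2 * \<mu>^4) :: rat)"
    using N4 N_s_form by metis
  then have "(X^2 + m * Y^2 - 24 * f)^2 - m * (2 * X * Y - 24 * g)^2 = A^2 * \<mu>^4" by (simp only: of_int_eq_iff)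
  moreover have "(X^2 + m * Y^2 - 24 * f)^2 - m * (2 * X * Y - 24 * g)^2
     = 9 * ((3 * x^2 + m' * Y^2 - 8 * f)^2 - 3 * m' * (2 * x * Y - 8 * g)^2)"
    unfolding x m' by (simp add: power2_eq_square algebra_simps)
  moreover have "A^2 * \<mu>^4 = 9 * (A'^2 * \<mu>^4)" unfolding A' by (simp add: power_mult_distrib)
  ultimately have e1: "(3 * x^2 + m' * Y^2 - 8 * f)^2 - 3 * m' * (2 * x * Y - 8 * g)^2 = A'^2 * \<mu>^4" by simp
  have "36 * (of_int X + of_int Y * s) * (of_int f + of_int g * s)
      = of_int (36 * X * f) + of_int (36 * Y * g) * (s * s) + of_int (36 * (X * g + Y * f)) * s"
    by (simp add: algebra_simps)
  then have pr: "36 * (of_int X + of_int Y * s) * (of_int f + of_int g * s)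
      = of_int (36 * (X * f + m * Y * g)) + of_int (36 * (X * g + Y * f)) * s"
    unfolding ss by (simp add: algebra_simps)
  have "64 * c6 b = of_int (36 * (X * f + m * Y * g) - (X^3 + 3 * m * X * Y^2) - 216 * i)
      + of_int (36 * (X * g + Y * f) - (3 * X^2 * Y + m * Y^3) - 216 * j) * s"
    unfolding c6 B pr cu by (simp add: algebra_simps)
  also have "36 * (X * f + m * Y * g) - (X^3 + 3 * m * X * Y^2) - 216 * i = 27 * c"
    unfolding c_def x m' by (simp add: power2_eq_square power3_eq_cube algebra_simps)
  also have "36 * (X * g + Y * f) - (3 * X^2 * Y + m * Y^3) - 216 * j = 3 * W"
    unfolding W_def x m' by (simp add: power2_eq_square power3_eq_cube algebra_simps)
  finally have "of_int ((27 * c)^2 - m * (3 * W)^2) = (of_int (\<kappa> * (A^3 - 1728) * \<mu>^6) :: rat)"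
    using N6 N_s_form by metis
  then have e2: "(27 * c)^2 - m * (3 * W)^2 = \<kappa> * (A^3 - 1728) * \<mu>^6" by (simp only: of_int_eq_iff)
  show ?thesis
  proof (cases "3 dvd Y")
    case True
    then obtain Y' where Y': "Y = 3 * Y'" by auto
    define W' where "W' = - (3 * m' * Y'^3) + 4 * Y' * f + (4 * x * g - x^2 * Y - 8 * j)"
    have "W = 9 * W'" unfolding W_def W'_def Y' by (simp add: power_mult_distrib algebra_simps)
    then have "\<kappa> * (A^3 - 1728) * \<mu>^6 = 3^6 * (c^2 - m * W'^2)" using e2 by (simp add: power_mult_distrib algebra_simps)
    then have "3^6 dvd \<kappa> * (A^3 - 1728) * \<mu>^6" by simp
    moreover have "coprime 3 \<mu>" using \<mu>3 prime_imp_coprime[of 3 \<mu>] by simp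
    then have "coprime (3^6) (\<mu>^6)" by (simp only: coprime_power_left_iff coprime_power_right_iff simp_thms)
    ultimately have "3^6 dvd \<kappa> * (A^3 - 1728)" using coprime_dvd_mult_left_iff by blast
    then have "3^6 dvd A^3 - 1728" using \<kappa> by (metis mult_1 mult_minus1 dvd_minus_iff)
    then show ?thesis using three_power_imp_27 A by blast
  next
    case False
    have "27 * (27 * c^2 - m' * W^2) = \<kappa> * (A^3 - 1728) * \<mu>^6" using e2 unfolding m' by (simp add: power_mult_distrib algebra_simps)
    also have "A^3 - 1728 = 27 * (A'^3 - 64)" unfolding A' by (simp add: power_mult_distrib)
    finally have "27 * (27 * c^2 - m' * W^2) = 27 * (\<kappa> * (A'^3 - 64) * \<mu>^6)" by (simp only: mult_ac)
    then have "27 * c^2 - m' * W^2 = \<kappa> * (A'^3 - 64) * \<mu>^6" by simp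
    then show ?thesis using ramified_3_impossible[OF False nm \<mu>3 \<kappa> e1] unfolding W_def by blast
  qed
qed

lemma three_case: assumes "3 dvd A" shows "27 dvd A - 12"
proof -
  obtain P where P: "prime_over m P 3" "3 dvd disc_K \<and> (\<forall>x\<in>P. cj x \<in> P) \<or> prime_over.unram m P 3"
    using prime_exists[of 3] by auto
  show ?thesis
  proof (cases "prime_over.unram m P 3")
    case True
    then show ?thesis using three_unram P assms by blast
  next
    case False
    then have d: "3 dvd disc_K" "prime_over.stable m P" using P prime_over.stable_def[OF P(1)] by auto
    have "3 dvd m"
    proof (cases "m mod 4 = 1")
      case True then show ?thesis using d by (simp add: disc_K_eq)
    next
      case False
      then have "3 dvd 4 * m" using d by (simp add: disc_K_eq)
      then show ?thesis by presburger
    qed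
    then show ?thesis using three_ramified P d assms by blast
  qed
qed

lemma A_in_R_set: "A \<in> R_set"
  unfolding R_set_def using two_cases three_case by auto

text \<open>The parity argument needs a valuation normalised by \<open>p\<close> itself. It is
  available because an odd \<open>p\<close> not dividing \<open>m\<close> does not divide
  \<open>disc_K\<close>.\<close>

lemma odd_prime_dvd_m:
  assumes E: "D * t^2 = A^3 - 1728" and sf: "squarefree D" and p: "prime p" "odd p" "p dvd D"
  shows "p dvd m"
proof (rule ccontr)
  assume nm: "\<not> p dvd m"
  have p4: "\<not> p dvd 4"
  proof
    assume "p dvd 4"
    then have "p dvd 2 ^ 2" by simp
    then have "p dvd 2" using p prime_dvd_power by blast
    then show False using p primes_dvd_imp_eq[of p 2] by auto
  qed
  have "\<not> p dvd disc_K" using nm p4 p by (simp add: disc_K_eq prime_dvd_mult_iff)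
  then obtain P where P: "prime_over m P p" "prime_over.unram m P p" using prime_exists p by metis
  interpret prime_over m P p by (rule P(1))
  obtain v b \<nu> where M: "is_model P v b \<nu>" using model_exists P by blast
  have d: "lu (disc b)" "c6 b ^ 2 = of_int (A^3 - 1728) * disc b" "c6 b \<in> OK"
    using M lu_OK N_c4_c6_coeff unfolding is_model_def by blast+
  define r where "r = D * t^2"
  have r0: "r \<noteq> 0" unfolding r_def E by (rule cube_ne)
  have Dt0: "D \<noteq> 0" "t \<noteq> 0" using r0 by (auto simp: r_def)
  have cr: "c6 b ^ 2 = of_int r * disc b" using d unfolding r_def E by simp
  have "c6 b \<noteq> 0" using cr r0 lu_0[OF d(1)] by auto
  then obtain k where k: "lu (c6 b / of_int p powi k)" using unram_val[OF P(2), of "c6 b"] d(3) by blast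
  define i where "i = multiplicity p r"
  have "\<not> is_unit p" using p not_prime_unit by blast
  then obtain r' where r': "r = p ^ i * r'" "\<not> p dvd r'"
    using multiplicity_decompose'[OF r0, of p] unfolding i_def by metis
  have p0: "of_int p \<noteq> (0::complex)" using p by auto
  have "lu ((c6 b / of_int p powi k)^2 / (of_int r' * disc b))" using k r' lu_int d(1) by blast
  moreover have "r' \<noteq> 0" using r' r0 by auto
  then have "(c6 b / of_int p powi k)^2 / (of_int r' * disc b) = of_int p ^ i / (of_int p powi k)^2"
    unfolding power_divide cr r'(1) using lu_0[OF d(1)] p0 by (simp add: field_simps)
  also have "\<dots> = of_int p powi (int i - k * 2)"
    using p0 by (simp add: power_int_diff power_int_mult)
  ultimately have "int i - k * 2 = 0" using lu_prime_power by metis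
  then have "even i" by presburger
  moreover have "i = multiplicity p D + 2 * multiplicity p t"
    unfolding i_def r_def using prime_imp_prime_elem[OF p(1)] Dt0
    by (simp add: prime_elem_multiplicity_mult_distrib prime_elem_multiplicity_power_distrib)
  moreover have "multiplicity p D = 1"
  proof (rule multiplicity_eqI)
    show "p ^ 1 dvd D" using p by simp
    show "\<not> p ^ Suc 1 dvd D"
    proof
      assume "p ^ Suc 1 dvd D"
      then have "p^2 dvd D" by (simp add: power2_eq_square)
      then have "is_unit p" by (rule squarefreeD[OF sf])
      then show False using p by auto
    qed
  qed
  ultimately show False by simp
qed

text \<open>As 16 does not divide \<open>A\<close>, the model above 2 has the exceptional form of
  \<open>ramified_2_form\<close>. The norm of \<open>c6 / 8\<close> then gives
  \<open>D x^2 - q h1^2 = \<kappa> t'^2 \<nu>^6\<close>, an equation whose variables are all odd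
  once \<open>x\<close> is; modulo 8 it says \<open>D - q = \<kappa>\<close>.\<close>

lemma even_case:
  assumes E: "A = 16 * k + 4" "D = 2 * D'" "t = 8 * t'" "D' * t'^2 = 32*k^3 + 24*k^2 + 6*k - 13"
    "D * t^2 = A^3 - 1728" and sf: "squarefree D" and mq: "m = q * D"
    and \<kappa>: "\<kappa> = 1 \<or> \<kappa> = -1"
    and Nb: "\<And>P v b \<nu>. is_model P v b \<nu> \<Longrightarrow> N (c6 b) = of_int (\<kappa> * (A^3 - 1728) * \<nu>^6)"
  shows "\<kappa> = -1 \<and> [q = D + 1] (mod 8)"
proof -
  have A16: "\<not> 16 dvd A" unfolding E(1) by presburger
  have "even A" unfolding E(1) by simp
  then have m2: "m mod 4 = 2" using two_cases A16 by blast
  then have m4: "m mod 4 \<noteq> 1" by simp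
  have Dt: "odd D'" "odd t'"
  proof -
    have "odd (D' * t'^2)" unfolding E(4) by simp
    then show "odd D'" "odd t'" by auto
  qed
  have oq: "odd q"
  proof
    assume "even q"
    then have "4 dvd m" unfolding mq E(2) by auto
    then show False using m2 by auto
  qed
  have D0: "D \<noteq> 0" "q \<noteq> 0" using m0 mq by auto
  obtain P where P: "prime_over m P 2" "\<forall>x\<in>P. cj x \<in> P"
    using prime_exists[of 2] m4 by (auto simp: disc_K_eq)
  interpret prime_over m P 2 by (rule P(1))
  have st: stable using P(2) by (simp add: stable_def)
  obtain v b \<nu> where M: "is_model P v b \<nu>" using model_exists P by blast
  have \<nu>: "odd \<nu>" using model_stable[OF M P(1) st] .
  obtain a1 a2 a3 a4 a6 where e: "b = (a1, a2, a3, a4, a6)" by (metis prod_cases5)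
  have O: "coeffs_in OK b" "disc b \<in> OK" "disc b \<notin> P" using M unfolding is_model_def by auto
  have a1: "a1 \<in> P" using a1_iff_c4[OF M[unfolded e] P(1)] \<open>even A\<close> by blast
  have a3: "a3 \<notin> P" using a3_notin_P[OF refl O(1)[unfolded e] a1] O(3) unfolding e by blast
  have "\<not> (\<exists>\<alpha>\<in>OK. a1 = 2 * \<alpha>)" using half_a1_sixteen M \<nu> A16 unfolding e by blast
  then obtain f h where f: "f \<in> OK" "c4 b = 4 * (1 + 2 * s + 4 * f)" and h: "h \<in> OK" "c6 b = 8 * (s + 2 * h)"
    using ramified_2_form[OF refl st m4 O(1)[unfolded e] a1 a3] m2 unfolding e by blast
  obtain c0 b0 where ab: "h = of_int c0 + of_int b0 * s" using OK_s_E h(1) m4 by blast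
  define h0 h1 where "h0 = 2 * c0" and "h1 = 2 * b0 + 1"
  define H where "H = of_int h0 + of_int h1 * s"
  have H: "c6 b = 8 * H" unfolding h(2) H_def ab h0_def h1_def by (simp add: algebra_simps)
  have HO: "H \<in> OK" unfolding H_def by auto
  define A' where "A' = 4 * k + 1"
  have A': "A = 4 * A'" unfolding A'_def E(1) by simp
  have At: "A^3 - 1728 = 64 * (D * t'^2)" unfolding E(5)[symmetric] E(3) by (simp add: power_mult_distrib)
  have "N (c6 b) = 64 * N H" unfolding H using N_mult[of 8 H] HO by simp
  then have "of_int (64 * (h0^2 - m * h1^2)) = (of_int (\<kappa> * (64 * (D * t'^2)) * \<nu>^6) :: rat)"
    unfolding Nb[OF M] At unfolding H_def N_s_form by simp
  then have "64 * (h0^2 - m * h1^2) = \<kappa> * (64 * (D * t'^2)) * \<nu>^6" by (simp only: of_int_eq_iff)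
  then have "64 * (h0^2 - m * h1^2) = 64 * (D * (\<kappa> * t'^2 * \<nu>^6))" by (simp only: mult_ac)
  then have e1: "h0^2 - m * h1^2 = D * (\<kappa> * t'^2 * \<nu>^6)" by (simp only: mult_cancel_left) simp
  then have "h0^2 = D * (\<kappa> * t'^2 * \<nu>^6 + q * h1^2)" unfolding mq by (simp add: algebra_simps)
  then have "D dvd h0^2" by simp
  then have "D dvd h0" using squarefree_dvdI[OF sf, of h0] by (meson dvd_trans prime_dvd_power)
  then obtain x where x: "h0 = D * x" by auto
  have "D * (D * x^2 - q * h1^2) = D * (\<kappa> * t'^2 * \<nu>^6)" using e1 unfolding x mq by (simp add: power2_eq_square algebra_simps)
  then have e2: "D * x^2 - q * h1^2 = \<kappa> * t'^2 * \<nu>^6" using D0 by simp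
  \<comment> \<open>\<open>hh\<close> is \<open>q H / s\<close>: the factor \<open>s\<close> that
    \<open>H\<close> has above 2 is divided out.\<close>
  define hh where "hh = of_int (q * h1) + of_int x * s"
  have sm: "s * s = of_int q * of_int D" using ss mq by simp
  have qH: "of_int q * H = s * hh"
  proof -
    have "s * hh = of_int (q * h1) * s + of_int x * (s * s)" unfolding hh_def by (simp add: algebra_simps)
    then show ?thesis unfolding sm H_def x by (simp add: algebra_simps)
  qed
  have "64 * H^2 = 64 * (of_int D * of_int t'^2 * disc b)" using M unfolding is_model_def At H by (simp add: power_mult_distrib)
  then have H2: "H^2 = of_int D * of_int t'^2 * disc b" by simp
  define G where "G = 1 + 2 * s + 4 * f"
  have GO: "G \<in> OK" unfolding G_def using f by auto
  have "c4 b ^ 3 = of_int A ^ 3 * disc b" using M unfolding is_model_def by blast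
  then have "64 * (of_int A'^3 * disc b) = 64 * G^3" unfolding A' f(2) G_def[symmetric] by (simp add: power_mult_distrib)
  then have G3: "of_int A'^3 * disc b = G^3" by simp
  have "of_int q * of_int D * hh^2 = (s * hh)^2" by (simp only: power_mult_distrib power2_eq_square[of s] sm)
  also have "\<dots> = of_int q^2 * (of_int D * of_int t'^2 * disc b)" unfolding qH[symmetric] power_mult_distrib H2 ..
  finally have "of_int q * of_int D * hh^2 = of_int q * of_int D * (of_int q * of_int t'^2 * disc b)"
    by (simp add: power2_eq_square algebra_simps)
  then have hh2: "hh^2 = of_int q * of_int t'^2 * disc b" using D0 by simp
  \<comment> \<open>Obtained by eliminating the discriminant between \<open>c4^3\<close> and
    \<open>c6^2\<close>. Modulo 4 both \<open>A'^3\<close> and \<open>t'^2\<close> are 1 and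
    \<open>G^3\<close> is \<open>1 + 2 s\<close>, so \<open>hh^2\<close> is
    \<open>q (1 + 2 s)\<close> modulo 4.\<close>
  have key: "of_int (A'^3) * hh^2 = of_int q * of_int (t'^2) * G^3" unfolding hh2 G3[symmetric] by simp
  obtain i2 where i2: "t'^2 = 8 * i2 + 1" using Dt(2) by (rule odd_square_E)
  have "A'^3 = 1 + 4 * (16 * k^3 + 12 * k^2 + 3 * k)" unfolding A'_def by (simp add: power2_eq_square power3_eq_cube algebra_simps)
  then obtain i1 where i1: "A'^3 = 1 + 4 * i1" by blast
  have G2: "G^2 = 1 + 4 * (of_int m + s + 2 * f + 4 * s * f + 4 * f^2)"
  proof -
    have "G^2 = 1 + 4 * (s * s + s + 2 * f + 4 * s * f + 4 * f^2)" unfolding G_def by (simp add: power2_eq_square algebra_simps)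
    then show ?thesis unfolding ss .
  qed
  define e3 where "e3 = f + G * (of_int m + s + 2 * f + 4 * s * f + 4 * f^2)"
  have e3O: "e3 \<in> OK" unfolding e3_def using f GO by auto
  have G3': "G^3 = 1 + 2 * s + 4 * e3"
  proof -
    have "G^3 = G * G^2" by (simp add: power2_eq_square power3_eq_cube)
    also have "\<dots> = G + 4 * (G * (of_int m + s + 2 * f + 4 * s * f + 4 * f^2))" unfolding G2 by (simp add: algebra_simps)
    also have "\<dots> = 1 + 2 * s + 4 * e3" unfolding e3_def by (simp add: G_def algebra_simps)
    finally show ?thesis .
  qed
  have hhO: "hh \<in> OK" unfolding hh_def by auto
  define e4 where "e4 = of_int q * e3 + 2 * of_int q * of_int i2 * G^3 - of_int i1 * hh^2"
  have e4O: "e4 \<in> OK" unfolding e4_def using e3O GO hhO by auto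
  have "hh^2 = of_int q * of_int (t'^2) * G^3 - 4 * (of_int i1 * hh^2)" using key unfolding i1 by (simp add: algebra_simps)
  also have "\<dots> = of_int q * G^3 + 4 * (2 * of_int q * of_int i2 * G^3 - of_int i1 * hh^2)" unfolding i2 by (simp add: algebra_simps)
  also have "\<dots> = of_int q + of_int (2 * q) * s + 4 * e4" unfolding e4_def unfolding G3' by (simp add: algebra_simps)
  finally have hh4: "hh^2 = of_int q + of_int (2 * q) * s + 4 * e4" .
  obtain c d where cd: "e4 = of_int c + of_int d * s" using OK_s_E e4O m4 by blast
  have "hh^2 = of_int ((q * h1)^2) + of_int (x^2) * (s * s) + of_int (2 * q * h1 * x) * s"
    unfolding hh_def by (simp add: power2_eq_square algebra_simps)
  then have "of_int ((q * h1)^2 + x^2 * m) + of_int (2 * q * h1 * x) * s = of_int (q + 4 * c) + of_int (2 * q + 4 * d) * s"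
    unfolding ss using hh4 unfolding cd by (simp add: algebra_simps)
  \<comment> \<open>The coefficients of \<open>s\<close> make \<open>x\<close> odd, and the rational
    parts give \<open>q = 1 + m\<close> modulo 4.\<close>
  then have cmp: "(q * h1)^2 + x^2 * m = q + 4 * c" "2 * q * h1 * x = 2 * q + 4 * d" unfolding s_int_eq_iff by auto
  have "q * h1 * x = q + 2 * d" using cmp(2) by simp
  moreover have "odd (q + 2 * d)" using oq by simp
  ultimately have xo: "odd x" by (metis even_mult_iff)
  have h1o: "odd h1" unfolding h1_def by simp
  have "odd (q * h1)" using oq h1o by simp
  then obtain z1 where z1: "(q * h1)^2 = 8 * z1 + 1" by (rule odd_square_E)
  obtain z2 where z2: "x^2 = 8 * z2 + 1" using xo by (rule odd_square_E)
  obtain z3 where z3: "h1^2 = 8 * z3 + 1" using h1o by (rule odd_square_E)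
  have "odd (t' * \<nu>^3)" using Dt \<nu> by simp
  then obtain z4 where z4: "(t' * \<nu>^3)^2 = 8 * z4 + 1" by (rule odd_square_E)
  have "q = 1 + m + 4 * (2 * z1 + 2 * z2 * m - c)" using cmp(1) unfolding z1 z2 by (simp add: algebra_simps)
  then obtain w1 where w1: "q = 1 + m + 4 * w1" by blast
  have "\<kappa> * t'^2 * \<nu>^6 = \<kappa> * (t' * \<nu>^3)^2" by (simp add: power_mult_distrib flip: power_mult)
  then have "D * (8 * z2 + 1) - q * (8 * z3 + 1) = \<kappa> * (8 * z4 + 1)" using e2 unfolding z2 z3 z4 by simp
  then have "D - q = \<kappa> + 8 * (\<kappa> * z4 - D * z2 + q * z3)" by (simp add: algebra_simps)
  then obtain w2 where w2: "D - q = \<kappa> + 8 * w2" by blast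
  have q3: "q mod 4 = 3" using w1 m2 by presburger
  \<comment> \<open>\<open>D\<close> is 2 and \<open>q\<close> is 3 modulo 4, so
    \<open>D - q\<close> is -1 modulo 4.\<close>
  have "\<kappa> = -1"
  proof (rule ccontr)
    assume "\<kappa> \<noteq> -1"
    then have "\<kappa> = 1" using \<kappa> by simp
    then have "2 * D' - q = 1 + 8 * w2" using w2 E(2) by simp
    then show False using q3 Dt(1) by presburger
  qed
  moreover have "[q = D + 1] (mod 8)" by (rule cong_I[of _ _ _ "- w2"]) (use w2 \<open>\<kappa> = -1\<close> in simp)
  ultimately show ?thesis by blast
qed

lemma norm_condition_of_curve:
  "\<exists>D q. good D \<and> m = q * D \<and>
     (\<forall>p. prime p \<and> odd p \<and> p dvd D \<longrightarrow> Legendre (- eps D * q) p = 1) \<and>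
     (\<forall>l. prime l \<and> odd l \<and> l dvd q \<longrightarrow> Legendre (eps D * D) l = 1) \<and>
     (eps D * D < 0 \<longrightarrow> m > 0) \<and>
     ((D mod 8 = 3 \<or> D mod 8 = 5) \<longrightarrow> [q = D] (mod 4)) \<and>
     (even D \<longrightarrow> [q = D + 1] (mod 8))"
proof -
  define D t where "D = squarefree_part (A^3 - 1728)" and "t = square_part (A^3 - 1728)"
  have E: "D * t^2 = A^3 - 1728" unfolding D_def t_def by (rule squarefree_decompose[symmetric])
  have sf: "squarefree D" unfolding D_def by simp
  have gd: "good D" unfolding good_def using sf A_in_R_set E by blast
  have A2: "2 dvd A \<Longrightarrow> 16 dvd A \<or> 16 dvd A - 4" using two_cases by blast
  obtain \<kappa> where \<kappa>: "\<kappa> = 1 \<or> \<kappa> = -1" and Na: "N (c6 a) = of_int (\<kappa> * (A^3 - 1728)) * n^6"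
    and Nb: "\<And>P v b \<nu>. is_model P v b \<nu> \<Longrightarrow> N (c6 b) = of_int (\<kappa> * (A^3 - 1728) * \<nu>^6)"
    using norm_c6_sign by blast
  have "D dvd m"
  proof (rule squarefree_dvdI[OF sf])
    fix p assume p: "prime p" "p dvd D"
    show "p dvd m"
    proof (cases "odd p")
      case True then show ?thesis using odd_prime_dvd_m[OF E sf] p by blast
    next
      case False
      then have p2: "p = 2" using p primes_dvd_imp_eq[of 2 p] by auto
      then have "even D" using p by simp
      have "\<not> 16 dvd A \<and> even A"
      proof (rule good_cases[OF A2 sf E])
        fix k assume k: "A = 16 * k + 4"
        have "\<not> 16 dvd A" unfolding k by presburger
        then show ?thesis using k by simp
      qed (use \<open>even D\<close> in auto)
      then have "m mod 4 = 2" using two_cases by blast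
      then show ?thesis unfolding p2 by presburger
    qed
  qed
  then obtain q where mq: "m = q * D" by (metis dvdE mult.commute)
  have t0: "t \<noteq> 0" using E cube_ne by auto
  \<comment> \<open>Up to the rational square \<open>(t n^3)^2\<close>, the norm of
    \<open>c6\<close> is \<kappa> D; this produces the point on the conic
    \<open>X^2 - m Y^2 = \<kappa> D Z^2\<close>.\<close>
  have "N (c6 a) = of_int (\<kappa> * D) * (of_int t * n^3)^2"
    unfolding Na E[symmetric] by (simp add: power_mult_distrib flip: power_mult)
  moreover have "of_int t * n^3 \<noteq> 0" using t0 n0 by simp
  ultimately obtain X Y Z where XYZ: "Z \<noteq> 0" "X^2 - m * Y^2 = (\<kappa> * D) * Z^2"
    "\<forall>p. prime p \<longrightarrow> \<not> (p dvd X \<and> p dvd Y \<and> p dvd Z)"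
    using norm_integer_point[OF c4_c6_K(2)] by metis
  note hc = hilbert_conditions[OF mq \<kappa> XYZ]
  have ev: "\<kappa> = -1 \<and> [q = D + 1] (mod 8)" if "even D"
  proof (rule good_cases[OF A2 sf E])
    fix k t' D'
    assume "A = 16 * k + 4" "D = 2 * D'" "t = 8 * t'" "D' * t'^2 = 32*k^3 + 24*k^2 + 6*k - 13"
    then show ?thesis using even_case E sf mq \<kappa> Nb by blast
  qed (use that in auto)
  have od: "(\<kappa> * D) mod 4 = 1 \<and> (m mod 4 \<noteq> 1 \<longrightarrow> (\<kappa> * D) mod 8 = 1)" if "odd D"
    by (rule sign_mod_4[OF E sf that \<kappa> Na Nb])
  have \<kappa>e: "\<kappa> = eps D"
  proof (cases "even D")
    case True
    then have "D mod 4 \<noteq> 1" by presburger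
    then show ?thesis using ev[OF True] by (simp add: eps_def)
  next
    case False
    have o: "(\<kappa> * D) mod 4 = 1" using od False by blast
    from \<kappa> show ?thesis
    proof
      assume "\<kappa> = 1" then show ?thesis using o by (simp add: eps_def)
    next
      assume k: "\<kappa> = -1"
      then have "(- D) mod 4 = 1" using o by simp
      then have "D mod 4 \<noteq> 1" by presburger
      then show ?thesis using k by (simp add: eps_def)
    qed
  qed
  \<comment> \<open>For \<open>m\<close> not 1 modulo 4, \<kappa> D is 1 modulo 8, which excludes
    \<open>D\<close> being 3 or 5 modulo 8. So \<open>q D = m\<close> is 1 modulo 4, and multiplying
    by \<open>D\<close> gives \<open>q = D\<close> modulo 4.\<close>
  have dd: "[q = D] (mod 4)" if D8: "D mod 8 = 3 \<or> D mod 8 = 5"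
  proof -
    have oD: "odd D" using D8 by presburger
    have "m mod 4 = 1"
    proof (rule ccontr)
      assume "m mod 4 \<noteq> 1"
      then have "(\<kappa> * D) mod 8 = 1" using od[OF oD] by blast
      then have "D mod 8 = 1 \<or> (- D) mod 8 = 1" using \<kappa> by auto
      then show False using D8 by presburger
    qed
    then have "m = 4 * (m div 4) + 1" by presburger
    then obtain k where k: "m = 4 * k + 1" by blast
    obtain d where d: "D^2 = 8 * d + 1" using oD by (rule odd_square_E)
    have "q * D^2 = m * D" unfolding mq by (simp add: power2_eq_square)
    then have "q = D + 4 * (k * D - 2 * d * q)" unfolding d k by (simp add: algebra_simps)
    then show ?thesis by (rule cong_I)
  qed
  show ?thesis
    using gd mq hc ev dd unfolding \<kappa>e by blast
qed

end

theorem theorem2p3: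
  fixes m :: int
  assumes "squarefree m" and "m \<noteq> 0" and "m \<noteq> 1"
  shows "(\<exists>a. elliptic_over m a \<and> everywhere_good m a \<and> j_inv a \<in> \<rat>) \<longleftrightarrow>
         (\<exists>D q. good D \<and> m = q * D \<and>
            (\<forall>p. prime p \<and> odd p \<and> p dvd D \<longrightarrow> Legendre (- eps D * q) p = 1) \<and>
            (\<forall>l. prime l \<and> odd l \<and> l dvd q \<longrightarrow> Legendre (eps D * D) l = 1) \<and>
            (eps D * D < 0 \<longrightarrow> m > 0) \<and>
            ((D mod 8 = 3 \<or> D mod 8 = 5) \<longrightarrow> [q = D] (mod 4)) \<and>
            (even D \<longrightarrow> [q = D + 1] (mod 8)))"
proof -
  interpret quad_field m using assms by unfold_locales
  show ?thesis
  proof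
    assume "\<exists>a. elliptic_over m a \<and> everywhere_good m a \<and> j_inv a \<in> \<rat>"
    then obtain a A n where "good_curve m a A n" using good_curve_exists by blast
    then show "\<exists>D q. good D \<and> m = q * D \<and>
            (\<forall>p. prime p \<and> odd p \<and> p dvd D \<longrightarrow> Legendre (- eps D * q) p = 1) \<and>
            (\<forall>l. prime l \<and> odd l \<and> l dvd q \<longrightarrow> Legendre (eps D * D) l = 1) \<and>
            (eps D * D < 0 \<longrightarrow> m > 0) \<and>
            ((D mod 8 = 3 \<or> D mod 8 = 5) \<longrightarrow> [q = D] (mod 4)) \<and>
            (even D \<longrightarrow> [q = D + 1] (mod 8))"
      by (rule good_curve.norm_condition_of_curve)
  qed (use curve_of_norm_condition in blast)
qed

end
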